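(* For each $n$, let $p_n$ be a probability distribution on the positive integers, not supported on a single integer, and let $X_n$ be a random variable with distribution $p_n$. Set $$\mu_n=E(\log X_n),\quad \sigma_n^2=\mathrm{Var}(\log X_n),\quad \xi_n=\frac{\log X_n-\mu_n}{\sigma_n},$$ assume $0<\mu_n,\sigma_n<\infty$, and set $$t_n=\frac{3\log n}{2\mu_n},\qquad b_n=\frac1{\mu_n}\max\left\{1,\sqrt{\frac{\sigma_n^2\log n}{\mu_n}}\right\}.$$ Assume that $$\forall\,\epsilon>0,\qquad \lim_{n\to\infty}E\left(\xi_n^2\mathbf 1_{\{\xi_n^2>\epsilon\mu_n^{-1}\log n\}}\right)=0.$$ Then the family $\{(S_n,Q_{n,p_n},U_n)\}_{n\ge1}$ of $p_n$-shuffles presents a $(t_n,b_n)$ total variation cutoff. Moreover, if $b_n$ is bounded from below by a positive real number, then the $(t_n,b_n)$ total variation cutoff is optimal.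
   Context: Shuffles. $S_n$ is the set of arrangements of a deck of $n$ cards labelled $1,\dots,n$, identified with the symmetric group (an arrangement $\sigma$ lists cards $\sigma(1),\dots,\sigma(n)$ from top to bottom); $U_n$ is the uniform distribution on $S_n$. A rising sequence of $\sigma$ is a maximal set of cards with consecutive face values appearing in increasing order in $\sigma$; $r(\sigma)$ is the number of rising sequences, i.e. $1$ plus the number of $i\in\{1,\dots,n-1\}$ such that card $i+1$ appears before card $i$. For an integer $m\ge1$, an $m$-shuffle cuts the deck into $m$ packs of sizes $(a_1,\dots,a_m)$ with multinomial probability $m^{-n}\frac{n!}{a_1!\cdots a_m!}$, then drops cards one by one, from pack $i$ with probability proportional to its current size. Its distribution $Q_{n,m}$, started from a deck in order, is given by (Bayer–Diaconis) $Q_{n,m}(\sigma)=m^{-n}\binom{n+m-r(\sigma)}{n}$ (the binomial being $0$ if $m<r(\sigma)$), and this may be taken as the definition. For a probability $p$ on $\{1,2,\dots\}$, the $p$-shuffle is $Q_{n,p}=\sum_{m\ge1}p(m)Q_{n,m}$. For a probability $Q$ on $S_n$, $Q^k$ is the distribution after $k$ independent successive $Q$-shuffles from a deck in order, i.e. the $k$-fold convolution power of $Q$ on the symmetric group ($Q^0$ is the point mass at the identity). It is known that $Q_{n,m}*Q_{n,m'}=Q_{n,mm'}$. $\|\mu-\nu\|_{\mathrm{TV}}=\sup_{A}\{\mu(A)-\nu(A)\}$. Cutoff. For probabilities $Q_n$ on $S_n$, the family $\{(S_n,Q_n,U_n)\}$ presents a $(t_n,b_n)$ total variation cutoff if: (1)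 $t_n>0$ for all sufficiently large $n$ and $b_n/t_n\to0$; (2) for $c\neq0$, setting $k=k(n,c)=\lceil t_n+cb_n\rceil$ if $c>0$ and $k=\lfloor t_n+cb_n\rfloor$ if $c<0$ (non-negative for large $n$), the functions $\overline f(c)=\limsup_{n\to\infty}\|Q_n^{k}-U_n\|_{\mathrm{TV}}$ and $\underline f(c)=\liminf_{n\to\infty}\|Q_n^{k}-U_n\|_{\mathrm{TV}}$ satisfy $\lim_{c\to\infty}\overline f(c)=0$ and $\lim_{c\to-\infty}\underline f(c)=1$. The cutoff is optimal if moreover $\underline f(c)>0$ and $\overline f(-c)<1$ for all $c>0$. (By group invariance the starting arrangement is irrelevant.) *)

theory Defs
  imports "HOL-Probability.Probability" "HOL-Combinatorics.Multiset_Permutations"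
begin

subsection \<open>Arrangements of a deck and riffle shuffles\<close>

text \<open>
  An arrangement \<open>\<sigma>\<close> lists the cards \<open>\<sigma> 1, \<dots>, \<sigma> n\<close> from top to bottom, so that
  \<open>inv \<sigma> i\<close> is the position of card \<open>i\<close>.
\<close>

definition arrangements :: "nat \<Rightarrow> (nat \<Rightarrow> nat) set" where
  "arrangements n = {\<sigma>. \<sigma> permutes {1..n}}"

definition uniform_arrangement :: "nat \<Rightarrow> (nat \<Rightarrow> nat) pmf" where
  "uniform_arrangement n = pmf_of_set (arrangements n)"

definition rising_sequences :: "nat \<Rightarrow> (nat \<Rightarrow> nat) \<Rightarrow> nat" where
  "rising_sequences n \<sigma> = 1 + card {i \<in> {1..<n}. inv \<sigma> (i + 1) < inv \<sigma> i}"

text \<open>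
  The Bayer--Diaconis formula for the distribution of an \<open>m\<close>-shuffle (\<open>m \<ge> 1\<close>) of an ordered
  deck. The truncated subtraction is harmless for \<open>m \<ge> 1\<close>, because the number of rising
  sequences never exceeds \<open>max 1 n\<close>. That the formula is a probability mass function is
  established in \<open>pmf_m_shuffle\<close> below.
\<close>

definition m_shuffle :: "nat \<Rightarrow> nat \<Rightarrow> (nat \<Rightarrow> nat) pmf" where
  "m_shuffle n m = embed_pmf (\<lambda>\<sigma>. if \<sigma> \<in> arrangements n
     then real ((n + m - rising_sequences n \<sigma>) choose n) / real m ^ n else 0)"

definition p_shuffle :: "nat \<Rightarrow> nat pmf \<Rightarrow> (nat \<Rightarrow> nat) pmf" where
  "p_shuffle n p = bind_pmf p (m_shuffle n)"

text \<open>
  Shuffling the arrangement \<open>\<tau>\<close> by \<open>\<rho>\<close> puts at position \<open>i\<close> the card that was at position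
  \<open>\<rho> i\<close>, which yields the arrangement \<open>\<tau> \<circ> \<rho>\<close>.
\<close>

definition convolution_pmf ::
    "(nat \<Rightarrow> nat) pmf \<Rightarrow> (nat \<Rightarrow> nat) pmf \<Rightarrow> (nat \<Rightarrow> nat) pmf" where
  "convolution_pmf P Q = bind_pmf P (\<lambda>\<tau>. map_pmf (\<lambda>\<rho>. \<tau> \<circ> \<rho>) Q)"

primrec convolution_power :: "(nat \<Rightarrow> nat) pmf \<Rightarrow> nat \<Rightarrow> (nat \<Rightarrow> nat) pmf" where
  "convolution_power Q 0 = return_pmf id"
| "convolution_power Q (Suc k) = convolution_pmf (convolution_power Q k) Q"


subsection \<open>Total variation cutoff\<close>

definition tv_dist :: "'a pmf \<Rightarrow> 'a pmf \<Rightarrow> real" where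
  "tv_dist \<mu> \<nu> = (SUP A. measure_pmf.prob \<mu> A - measure_pmf.prob \<nu> A)"

text \<open>
  Only \<open>c \<noteq> 0\<close> is meaningful in the following three definitions; the value at \<open>c = 0\<close> is
  never used.
\<close>

definition cutoff_time :: "(nat \<Rightarrow> real) \<Rightarrow> (nat \<Rightarrow> real) \<Rightarrow> real \<Rightarrow> nat \<Rightarrow> nat" where
  "cutoff_time t b c n =
     (if c > 0 then nat \<lceil>t n + c * b n\<rceil> else nat \<lfloor>t n + c * b n\<rfloor>)"

definition upper_profile ::
    "(nat \<Rightarrow> (nat \<Rightarrow> nat) pmf) \<Rightarrow> (nat \<Rightarrow> real) \<Rightarrow> (nat \<Rightarrow> real) \<Rightarrow> real \<Rightarrow> ereal" where
  "upper_profile Q t b c = limsup (\<lambda>n. ereal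
     (tv_dist (convolution_power (Q n) (cutoff_time t b c n)) (uniform_arrangement n)))"

definition lower_profile ::
    "(nat \<Rightarrow> (nat \<Rightarrow> nat) pmf) \<Rightarrow> (nat \<Rightarrow> real) \<Rightarrow> (nat \<Rightarrow> real) \<Rightarrow> real \<Rightarrow> ereal" where
  "lower_profile Q t b c = liminf (\<lambda>n. ereal
     (tv_dist (convolution_power (Q n) (cutoff_time t b c n)) (uniform_arrangement n)))"

definition tv_cutoff ::
    "(nat \<Rightarrow> (nat \<Rightarrow> nat) pmf) \<Rightarrow> (nat \<Rightarrow> real) \<Rightarrow> (nat \<Rightarrow> real) \<Rightarrow> bool" where
  "tv_cutoff Q t b \<longleftrightarrow>
     (\<forall>\<^sub>F n in sequentially. t n > 0) \<and>
     (\<lambda>n. b n / t n) \<longlonglongrightarrow> 0 \<and>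
     (upper_profile Q t b \<longlongrightarrow> 0) at_top \<and>
     (lower_profile Q t b \<longlongrightarrow> 1) at_bot"

definition optimal_tv_cutoff ::
    "(nat \<Rightarrow> (nat \<Rightarrow> nat) pmf) \<Rightarrow> (nat \<Rightarrow> real) \<Rightarrow> (nat \<Rightarrow> real) \<Rightarrow> bool" where
  "optimal_tv_cutoff Q t b \<longleftrightarrow> tv_cutoff Q t b \<and>
     (\<forall>c>0. lower_profile Q t b c > 0 \<and> upper_profile Q t b (- c) < 1)"


subsection \<open>The Bayer--Diaconis formula is a probability mass function\<close>

text \<open>
  After passing to inverse permutations this is Worpitzky's identity, proved here by inserting
  the largest letter into words without repetition.
\<close>

fun descents :: "nat list \<Rightarrow> nat" where
  "descents (x # y # ys) = (if y < x then 1 else 0) + descents (y # ys)"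
| "descents _ = 0"

lemma descents_less_length: "xs \<noteq> [] \<Longrightarrow> descents xs < length xs"
  by (induction xs rule: descents.induct) auto

lemma descents_le_length: "descents xs \<le> length xs"
  by (induction xs rule: descents.induct) auto

lemma descents_insert_max:
  fixes g :: "nat \<Rightarrow> nat"
  assumes "\<forall>x\<in>set xs. x < a" "xs \<noteq> []"
  shows "(\<Sum>k\<le>length xs. g (descents (take k xs @ a # drop k xs))) =
    (descents xs + 1) * g (descents xs) + (length xs - descents xs) * g (descents xs + 1)"
  using assms
proof (induction xs arbitrary: g rule: descents.induct)
  case (1 x y ys)
  define e where "e = (if y < x then 1 else 0 :: nat)"
  define d where "d = descents (y # ys)"
  have d: "d \<le> length ys"
    using descents_less_length[of "y # ys"] by (simp add: d_def)
  have IH: "(\<Sum>k\<le>length (y # ys). g (e + descents (take k (y # ys) @ a # drop k (y # ys)))) =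
     (d + 1) * g (e + d) + (Suc (length ys) - d) * g (e + d + 1)"
    using "1.IH"[of "\<lambda>d. g (e + d)"] "1.prems" by (simp add: d_def)
  have hd: "a > x" "a > y" using "1.prems" by auto
  have "(\<Sum>k\<le>length (x # y # ys). g (descents (take k (x # y # ys) @ a # drop k (x # y # ys)))) =
     g (1 + e + d) + g (1 + d) +
     (\<Sum>k\<le>length ys. g (e + descents (y # take k ys @ a # drop k ys)))"
    using hd by (simp add: sum.atMost_Suc_shift e_def d_def del: sum.atMost_Suc)
  moreover have "(\<Sum>k\<le>length (y # ys). g (e + descents (take k (y # ys) @ a # drop k (y # ys)))) =
     g (1 + e + d) + (\<Sum>k\<le>length ys. g (e + descents (y # take k ys @ a # drop k ys)))"
    using hd by (simp add: sum.atMost_Suc_shift d_def del: sum.atMost_Suc)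
  ultimately have "(\<Sum>k\<le>length (x # y # ys).
       g (descents (take k (x # y # ys) @ a # drop k (x # y # ys)))) =
     g (1 + d) + ((d + 1) * g (e + d) + (Suc (length ys) - d) * g (e + d + 1))"
    using IH by linarith
  also have "\<dots> = (e + d + 1) * g (e + d) + (Suc (Suc (length ys)) - (e + d)) * g (e + d + 1)"
  proof -
    obtain l where l: "length ys = d + l" using d le_Suc_ex by blast
    show ?thesis by (simp add: e_def l)
  qed
  finally show ?case by (simp add: e_def d_def)
qed auto

lemma bij_betw_insert_letter:
  assumes "finite A" "a \<notin> A"
  shows "bij_betw (\<lambda>(xs, k). take k xs @ a # drop k xs)
    (permutations_of_set A \<times> {..card A}) (permutations_of_set (insert a A))"
    (is "bij_betw ?f ?D ?R")
proof -
  have inj: "inj_on ?f ?D"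
  proof (rule inj_onI, clarify)
    fix xs k ys l
    assume xs: "xs \<in> permutations_of_set A" and k: "k \<le> card A"
      and ys: "ys \<in> permutations_of_set A" and l: "l \<le> card A"
      and eq: "take k xs @ a # drop k xs = take l ys @ a # drop l ys"
    have "a \<notin> set xs" "a \<notin> set ys"
      using xs ys assms by (auto simp: permutations_of_set_def)
    then have "a \<notin> set (take k xs)" "a \<notin> set (take l ys)" "a \<notin> set (drop k xs)" "a \<notin> set (drop l ys)"
      by (auto dest: in_set_takeD in_set_dropD)
    then have *: "take k xs = take l ys \<and> drop k xs = drop l ys"
      using eq by (simp add: append_Cons_eq_iff)
    have "length xs = card A" "length ys = card A"
      using xs ys by (auto simp: length_finite_permutations_of_set)
    then have "length (take k xs) = k" "length (take l ys) = l" using k l by auto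
    with * show "xs = ys \<and> k = l" by (metis append_take_drop_id)
  qed
  have sub: "?f ` ?D \<subseteq> ?R"
  proof clarify
    fix xs k assume xs: "xs \<in> permutations_of_set A"
    then have "set (take k xs) \<union> set (drop k xs) = A" "distinct xs"
      by (auto simp: permutations_of_set_def simp flip: set_append)
    then show "take k xs @ a # drop k xs \<in> permutations_of_set (insert a A)"
      using assms(2) set_take_disj_set_drop_if_distinct[of xs k k]
      by (auto simp: permutations_of_set_def)
  qed
  have "card (?f ` ?D) = card ?R"
    using assms by (simp add: card_image[OF inj] card_cartesian_product algebra_simps)
  then have "?f ` ?D = ?R" by (intro card_subset_eq sub) auto
  with inj show ?thesis by (simp add: bij_betw_def)
qed

lemma binomial_insert_step:
  fixes d n m :: nat
  assumes "m \<ge> 1" "d < n"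
  shows "(d + 1) * ((n + m - d) choose Suc n) + (n - d) * ((n + m - 1 - d) choose Suc n) =
    m * ((n + m - 1 - d) choose n)"
proof -
  define N where "N = n + m - 1 - d"
  have N: "n + m - d = Suc N" "n + m - 1 - d = N" using assms by (auto simp: N_def)
  have absorb: "(n + 1) * (N choose Suc n) + n * (N choose n) = N * (N choose n)"
  proof (cases "n \<le> N")
    case True
    have "Suc n * (N choose Suc n) = (N - n) * (N choose n)"
      using binomial_absorption[of n N] binomial_absorb_comp[of N n] by simp
    moreover have "(N - n) * (N choose n) + n * (N choose n) = N * (N choose n)"
      using True by (metis add_mult_distrib le_add_diff_inverse2)
    ultimately show ?thesis by simp
  next
    case False
    then show ?thesis by (simp add: binomial_eq_0)
  qed
  have "(d + 1) * (Suc N choose Suc n) + (n - d) * (N choose Suc n) =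
     (d + 1) * (N choose n) + ((d + 1) + (n - d)) * (N choose Suc n)"
    by (simp add: algebra_simps)
  also have "(d + 1) + (n - d) = n + 1" using assms by simp
  finally have "(d + 1) * (Suc N choose Suc n) + (n - d) * (N choose Suc n) + n * (N choose n) =
     (N + d + 1) * (N choose n)"
    using absorb by (simp add: algebra_simps)
  also have "N + d + 1 = m + n" using assms by (simp add: N_def)
  also have "(m + n) * (N choose n) = m * (N choose n) + n * (N choose n)"
    by (rule add_mult_distrib)
  finally show ?thesis unfolding N by (rule add_right_imp_eq)
qed

lemma worpitzky_lists:
  assumes "m \<ge> 1"
  shows "(\<Sum>xs\<in>permutations_of_set {1..n}. (n + m - 1 - descents xs) choose n) = m ^ n"
proof (induction n)
  case 0
  then show ?case by simp
next
  case (Suc n)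
  have ins: "{1..Suc n} = insert (Suc n) {1..n}" by auto
  have "(\<Sum>xs\<in>permutations_of_set {1..Suc n}. (Suc n + m - 1 - descents xs) choose Suc n) =
     (\<Sum>(xs, k)\<in>permutations_of_set {1..n} \<times> {..n}.
        (n + m - descents (take k xs @ Suc n # drop k xs)) choose Suc n)"
    unfolding ins
    by (subst sum.reindex_bij_betw[OF bij_betw_insert_letter, symmetric])
       (auto simp: case_prod_unfold)
  also have "\<dots> = (\<Sum>xs\<in>permutations_of_set {1..n}. \<Sum>k\<le>n.
        (n + m - descents (take k xs @ Suc n # drop k xs)) choose Suc n)"
    by (simp add: sum.cartesian_product)
  also have "\<dots> = (\<Sum>xs\<in>permutations_of_set {1..n}. m * ((n + m - 1 - descents xs) choose n))"
  proof (rule sum.cong)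
    fix xs assume xs: "xs \<in> permutations_of_set {1..n}"
    then have len: "length xs = n" and set: "\<forall>x\<in>set xs. x < Suc n"
      by (auto simp: length_finite_permutations_of_set permutations_of_set_def)
    show "(\<Sum>k\<le>n. (n + m - descents (take k xs @ Suc n # drop k xs)) choose Suc n) =
      m * ((n + m - 1 - descents xs) choose n)"
    proof (cases "n = 0")
      case True
      then show ?thesis using len assms by simp
    next
      case False
      then have ne: "xs \<noteq> []" using len by auto
      then have "descents xs < n" using descents_less_length len by blast
      then show ?thesis
        using descents_insert_max[OF set ne, of "\<lambda>d. (n + m - d) choose Suc n"]
          binomial_insert_step[OF assms, of "descents xs" n] len
        by simp
    qed
  qed simp
  also have "\<dots> = m ^ Suc n" using Suc by (simp flip: sum_distrib_left)
  finally show ?case .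
qed

lemma bij_betw_arrangements_lists:
  "bij_betw (\<lambda>\<sigma>. map \<sigma> [1..<Suc n]) (arrangements n) (permutations_of_set {1..n})"
proof -
  let ?f = "\<lambda>\<sigma>::nat \<Rightarrow> nat. map \<sigma> [1..<Suc n]"
  have inj: "inj_on ?f (arrangements n)"
  proof (rule inj_onI, rule ext)
    fix \<sigma> \<tau> i assume "\<sigma> \<in> arrangements n" "\<tau> \<in> arrangements n" "?f \<sigma> = ?f \<tau>"
    then show "\<sigma> i = \<tau> i"
      by (cases "i \<in> {1..n}") (auto simp: arrangements_def permutes_not_in simp del: upt_Suc)
  qed
  have sub: "?f ` arrangements n \<subseteq> permutations_of_set {1..n}"
  proof clarify
    fix \<sigma> assume "\<sigma> \<in> arrangements n"
    then have s: "\<sigma> permutes {1..n}" by (simp add: arrangements_def)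
    have *: "set [1..<Suc n] = {1..n}" by (auto simp del: upt_Suc)
    show "?f \<sigma> \<in> permutations_of_set {1..n}"
      using permutes_image[OF s] permutes_inj_on[OF s]
      unfolding permutations_of_set_def mem_Collect_eq set_map distinct_map *
      by (simp del: upt_Suc)
  qed
  have "card (?f ` arrangements n) = card (permutations_of_set {1..n})"
    by (subst card_image[OF inj]) (simp add: arrangements_def card_permutations)
  then have "?f ` arrangements n = permutations_of_set {1..n}"
    by (intro card_subset_eq sub) auto
  with inj show ?thesis by (simp add: bij_betw_def)
qed

lemma descents_map_upt:
  "descents (map f [a..<b]) = card {i \<in> {a..<b - 1}. f (i + 1) < f i}"
proof (induction "b - a" arbitrary: a)
  case 0
  then show ?case by simp
next
  case (Suc k)
  show ?case
  proof (cases "Suc a < b")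
    case False
    then have "[a..<b] = [a]" using Suc by (metis Suc_lessI upt_conv_Cons upt_rec zero_less_Suc zero_less_diff)
    then show ?thesis using False by simp
  next
    case True
    have eq: "{i \<in> {a..<b - 1}. f (i + 1) < f i} =
      (if f (a + 1) < f a then {a} else {}) \<union> {i \<in> {Suc a..<b - 1}. f (i + 1) < f i}"
      using True by (auto simp: le_eq_less_or_eq Suc_le_eq)
    have "[a..<b] = a # Suc a # [Suc (Suc a)..<b]" "[Suc a..<b] = Suc a # [Suc (Suc a)..<b]"
      using True by (simp_all add: upt_conv_Cons)
    then have "descents (map f [a..<b]) =
      (if f (a + 1) < f a then 1 else 0) + descents (map f [Suc a..<b])" by simp
    also have "descents (map f [Suc a..<b]) = card {i \<in> {Suc a..<b - 1}. f (i + 1) < f i}"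
      using Suc by (intro Suc(1)) auto
    finally show ?thesis unfolding eq by (simp add: card_insert_if)
  qed
qed

lemma finite_arrangements [simp]: "finite (arrangements n)"
  by (simp add: arrangements_def finite_permutations)

lemma worpitzky_arrangements:
  assumes "m \<ge> 1"
  shows "(\<Sum>\<sigma>\<in>arrangements n. (n + m - rising_sequences n \<sigma>) choose n) = m ^ n"
proof -
  let ?D = "\<lambda>\<sigma>::nat \<Rightarrow> nat. card {i \<in> {1..<n}. \<sigma> (i + 1) < \<sigma> i}"
  have "(\<Sum>\<sigma>\<in>arrangements n. (n + m - rising_sequences n \<sigma>) choose n) =
     (\<Sum>\<sigma>\<in>arrangements n. (n + m - 1 - ?D (inv \<sigma>)) choose n)"
    by (simp add: rising_sequences_def)
  also have "\<dots> = (\<Sum>\<sigma>\<in>arrangements n. (n + m - 1 - ?D \<sigma>) choose n)"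
    unfolding arrangements_def by (rule sum_permutations_inverse[symmetric])
  also have "\<dots> = (\<Sum>\<sigma>\<in>arrangements n. (n + m - 1 - descents (map \<sigma> [1..<Suc n])) choose n)"
    by (simp add: descents_map_upt del: upt_Suc)
  also have "\<dots> = m ^ n"
    using sum.reindex_bij_betw[OF bij_betw_arrangements_lists,
        of "\<lambda>xs. (n + m - 1 - descents xs) choose n" n]
      worpitzky_lists[OF assms, of n] by simp
  finally show ?thesis .
qed

lemma pmf_m_shuffle:
  assumes "m \<ge> 1"
  shows "pmf (m_shuffle n m) \<sigma> = (if \<sigma> \<in> arrangements n
     then real ((n + m - rising_sequences n \<sigma>) choose n) / real m ^ n else 0)"
  unfolding m_shuffle_def
proof (rule pmf_embed_pmf)
  let ?q = "\<lambda>\<sigma>. if \<sigma> \<in> arrangements n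
     then real ((n + m - rising_sequences n \<sigma>) choose n) / real m ^ n else 0"
  have "(\<integral>\<^sup>+ \<sigma>. ennreal (?q \<sigma>) \<partial>count_space UNIV) = (\<Sum>\<sigma>\<in>arrangements n. ennreal (?q \<sigma>))"
    by (rule nn_integral_count_space') auto
  also have "\<dots> = ennreal (\<Sum>\<sigma>\<in>arrangements n. ?q \<sigma>)"
    by (rule sum_ennreal) simp
  also have "(\<Sum>\<sigma>\<in>arrangements n. ?q \<sigma>) =
     real (\<Sum>\<sigma>\<in>arrangements n. (n + m - rising_sequences n \<sigma>) choose n) / real m ^ n"
    by (simp add: sum_divide_distrib)
  also have "\<dots> = 1"
    using assms by (simp add: worpitzky_arrangements del: of_nat_sum)
  finally show "(\<integral>\<^sup>+ \<sigma>. ennreal (?q \<sigma>) \<partial>count_space UNIV) = 1" by simp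
qed simp

end

theory Submission
  imports Defs "HOL-Real_Asymp.Real_Asymp"
begin

text \<open>
  Write \<open>L = ln n\<close>. Successive riffle shuffles with \<open>m\<close> and \<open>m'\<close> packs amount to one riffle shuffle
  with \<open>m * m'\<close> packs. Hence the law after \<open>k\<close> steps is the mixture of the laws of \<open>m\<close>-shuffles
  in which \<open>m\<close> is a product of \<open>k\<close> independent copies of \<open>X\<close>, and \<open>ln m\<close> is a sum of \<open>k\<close>
  independent copies of \<open>ln X\<close> (lemma \<open>convolution_power_p_shuffle\<close>).

  A single \<open>m\<close>-shuffle goes from far from uniform to close to uniform as \<open>ln m\<close> crosses
  \<open>3/2 L\<close> within a window of constant width. Its density with respect to the uniform distribution
  is \<open>\<Prod>i=1..n. 1 + (i - r)/m\<close>, where \<open>r\<close> is the number of rising sequences. For \<open>m = a * n powr (3/2)\<close>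
  and \<open>r = (n + 1)/2 + s * sqrt n\<close> the logarithm of this product is \<open>- s/a\<close> minus a quantity of
  order \<open>1/a\<^sup>2\<close>. Under the uniform distribution \<open>s\<close> is of order one, by Chebyshev's
  inequality. So for large \<open>a\<close> the density is close to one on almost all of the space, and for every
  \<open>a\<close> it is bounded below on most of the space; for small \<open>a\<close> it is tiny unless \<open>s\<close> is very
  negative, and for every \<open>a\<close> it is at most some constant below one on the half \<open>s \<ge> 0\<close>. These are
  lemmas \<open>prob_diff_uniform_le\<close> and \<open>prob_diff_few_rising_sequences_ge\<close>. The lower bound uses one
  test event, ``few rising sequences'', for all \<open>m\<close> at once. This is possible because the likelihood
  ratio of two shuffles is monotone in \<open>r\<close>, so that the event becomes more likely as \<open>m\<close> decreases
  and never falls below its uniform probability.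

  It remains to locate \<open>ln m\<close>. Since \<open>X \<ge> 1\<close>, the Lindeberg condition implies that \<open>L/\<mu>\<close> tends
  to infinity and that \<open>\<sigma>\<^sup>2/(\<mu> L)\<close> tends to zero; this gives \<open>b/t \<longlonglongrightarrow> 0\<close>. For \<open>k\<close> asymptotic to \<open>t\<close>
  it is, up to a constant factor in the threshold, the Lindeberg condition for \<open>k\<close> copies of \<open>ln X\<close>, so \<open>ln m\<close> is asymptotically normal with
  mean \<open>k \<mu>\<close> and standard deviation \<open>\<sigma> * sqrt k\<close>, which is comparable to \<open>sqrt (\<sigma>\<^sup>2 L/\<mu>)\<close>
  (lemma \<open>clt_in_window\<close>). The quantity \<open>b \<mu>\<close> is the larger of this standard deviation and the
  constant width above: at time \<open>t + c b\<close> the mean of \<open>ln m\<close> exceeds \<open>3/2 L\<close> by \<open>c\<close> times the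
  combined width, which gives the cutoff. For optimality, \<open>ln m\<close> stays with positive limiting
  probability on the unfavourable side of \<open>3/2 L\<close>, up to a constant; the lower bound on \<open>b\<close> is what
  controls the effect \<open>\<mu>\<close> of rounding the time to an integer.
\<close>

section \<open>Riffle shuffles as standardisations of random words\<close>

definition words :: "nat \<Rightarrow> nat \<Rightarrow> (nat \<Rightarrow> nat) set" where
  "words n m = {1..n} \<rightarrow>\<^sub>E {..<m}"

definition letter_before :: "(nat \<Rightarrow> nat) \<Rightarrow> nat \<Rightarrow> nat \<Rightarrow> bool" where
  "letter_before w i j \<longleftrightarrow> w i < w j \<or> (w i = w j \<and> i < j)"

text \<open>
  A word \<open>w\<close> assigns to each position of the shuffled deck the pack its card came from. Within a pack
  cards keep their order, so numbering the cards pack by pack, and from top to bottom inside each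
  pack, recovers the arrangement. This is the description of a riffle shuffle backwards in time.
\<close>

definition standardisation :: "nat \<Rightarrow> (nat \<Rightarrow> nat) \<Rightarrow> nat \<Rightarrow> nat" where
  "standardisation n w j = (if j \<in> {1..n} then Suc (card {i \<in> {1..n}. letter_before w i j}) else j)"

lemma finite_words [simp]: "finite (words n m)"
  by (simp add: words_def finite_PiE)

lemma card_words: "card (words n m) = m ^ n"
  by (simp add: words_def card_PiE)

lemma words_nonempty: "m \<ge> 1 \<Longrightarrow> words n m \<noteq> {}"
  by (auto simp: words_def PiE_eq_empty_iff lessThan_empty_iff)

lemma standardisation_less_iff:
  assumes "i \<in> {1..n}" "j \<in> {1..n}"
  shows "standardisation n w i < standardisation n w j \<longleftrightarrow> letter_before w i j"
proof -
  have mono: "standardisation n w i < standardisation n w j"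
    if "letter_before w i j" "i \<in> {1..n}" "j \<in> {1..n}" for i j
  proof -
    have "{k \<in> {1..n}. letter_before w k i} \<subset> {k \<in> {1..n}. letter_before w k j}"
      using that by (auto simp: letter_before_def)
    then have "card {k \<in> {1..n}. letter_before w k i} < card {k \<in> {1..n}. letter_before w k j}"
      by (intro psubset_card_mono) auto
    then show ?thesis using that by (simp add: standardisation_def)
  qed
  show ?thesis
    using mono[of i j] mono[of j i] assms
    by (metis letter_before_def linorder_neqE_nat order_less_asym)
qed

lemma standardisation_permutes: "standardisation n w permutes {1..n}"
proof -
  have "inj_on (standardisation n w) {1..n}"
  proof (rule inj_onI)
    fix i j assume *: "i \<in> {1..n}" "j \<in> {1..n}" "standardisation n w i = standardisation n w j"
    show "i = j"
      using standardisation_less_iff[OF *(1,2), of w] standardisation_less_iff[OF *(2,1), of w] *(3)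
      by (auto simp: letter_before_def)
  qed
  moreover have "standardisation n w ` {1..n} \<subseteq> {1..n}"
  proof clarify
    fix j assume j: "j \<in> {1..n}"
    have "j \<notin> {i \<in> {1..n}. letter_before w i j}" by (simp add: letter_before_def)
    then have "{i \<in> {1..n}. letter_before w i j} \<subset> {1..n}" using j by blast
    then have "card {i \<in> {1..n}. letter_before w i j} < card {1..n}"
      by (intro psubset_card_mono) auto
    then show "standardisation n w j \<in> {1..n}" using j by (simp add: standardisation_def)
  qed
  ultimately show ?thesis
    using endo_inj_surj[of "{1..n}" "standardisation n w"]
    by (intro bij_imp_permutes) (auto simp: bij_betw_def standardisation_def simp del: atLeastAtMost_iff)
qed

text \<open>
  A permutation of \<open>{1..n}\<close> is determined by the order that it induces, because its value at a
  position exceeds by one the number of positions with smaller values.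
\<close>

lemma standardisation_unique:
  assumes "\<sigma> permutes {1..n}"
    and "\<And>i j. i \<in> {1..n} \<Longrightarrow> j \<in> {1..n} \<Longrightarrow> letter_before w i j \<longleftrightarrow> \<sigma> i < \<sigma> j"
  shows "standardisation n w = \<sigma>"
proof
  fix j
  show "standardisation n w j = \<sigma> j"
  proof (cases "j \<in> {1..n}")
    case True
    then have \<sigma>j: "\<sigma> j \<in> {1..n}" using permutes_in_image[OF assms(1)] by blast
    have "\<sigma> ` {i \<in> {1..n}. \<sigma> i < \<sigma> j} = {1..<\<sigma> j}"
    proof (intro equalityI subsetI)
      fix y assume y: "y \<in> {1..<\<sigma> j}"
      then have "y \<in> \<sigma> ` {1..n}" using \<sigma>j permutes_image[OF assms(1)] by auto
      then show "y \<in> \<sigma> ` {i \<in> {1..n}. \<sigma> i < \<sigma> j}" using y by auto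
    qed (use permutes_in_image[OF assms(1)] in \<open>auto simp: Suc_le_eq\<close>)
    moreover have "inj_on \<sigma> A" for A using permutes_inj_on[OF assms(1)] .
    ultimately have "card {i \<in> {1..n}. \<sigma> i < \<sigma> j} = \<sigma> j - 1"
      by (metis card_image card_atLeastLessThan)
    moreover have "{i \<in> {1..n}. letter_before w i j} = {i \<in> {1..n}. \<sigma> i < \<sigma> j}"
      using assms(2) True by auto
    ultimately show ?thesis using True \<sigma>j by (simp add: standardisation_def)
  next
    case False
    then show ?thesis
      unfolding standardisation_def using permutes_not_in[OF assms(1) False] by (simp only: if_False)
  qed
qed

text \<open>
  These are the words read in the order of the card labels instead of the positions. The letters
  then increase weakly, and the pack has to change where card \<open>i + 1\<close> lies above card \<open>i\<close>; these
  \<open>i\<close> are marked by \<open>D\<close>.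
\<close>

definition staircases :: "(nat \<Rightarrow> bool) \<Rightarrow> nat \<Rightarrow> nat \<Rightarrow> (nat \<Rightarrow> nat) set" where
  "staircases D n m = {a \<in> words n m. \<forall>i\<in>{1..<n}. a i < a (Suc i) \<or> (a i = a (Suc i) \<and> \<not> D i)}"

lemma staircase_le_last:
  assumes "a \<in> staircases D n m" "1 \<le> i" "i \<le> n"
  shows "a i \<le> a n"
  using assms(3,2)
proof (induction i rule: inc_induct)
  case (step k)
  have "k \<in> {1..<n}" using step by simp
  then have "a k \<le> a (Suc k)" using assms(1) unfolding staircases_def by fastforce
  with step show ?case by simp
qed simp

text \<open>
  When the last letter is the largest one available, the letter before it may be equal to it unless
  a strict step is required between the two; deleting the last letter leaves a shorter staircase
  over an alphabet with or without the letter \<open>m\<close>.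
\<close>

lemma card_staircases_top:
  "card {a \<in> staircases D (Suc (Suc n)) (Suc m). a (Suc (Suc n)) = m} =
    card (staircases D (Suc n) (if D (Suc n) then m else Suc m))"
proof -
  let ?N = "Suc (Suc n)"
  let ?A = "{a \<in> staircases D ?N (Suc m). a ?N = m}"
  let ?B = "staircases D (Suc n) (if D (Suc n) then m else Suc m)"
  have "bij_betw (\<lambda>a. a(?N := undefined)) ?A ?B"
  proof (rule bij_betw_byWitness[where f' = "\<lambda>a. a(?N := m)"])
    show "\<forall>a\<in>?A. (a(?N := undefined))(?N := m) = a" by auto
    show "\<forall>a\<in>?B. (a(?N := m))(?N := undefined) = a"
      by (auto simp: staircases_def words_def PiE_def extensional_def fun_upd_idem_iff split: if_splits)
    show "(\<lambda>a. a(?N := undefined)) ` ?A \<subseteq> ?B"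
    proof (rule image_subsetI)
      fix a assume a: "a \<in> ?A"
      have adjacent: "a i < a (Suc i) \<or> (a i = a (Suc i) \<and> \<not> D i)" if "i \<in> {1..Suc n}" for i
        using a that by (auto simp: staircases_def)
      have am: "a ?N = m" using a by simp
      have mono: "a i \<le> a (Suc n)" if "i \<in> {1..Suc n}" for i
      proof -
        have "i \<le> Suc n" "i \<ge> 1" using that by auto
        then show ?thesis
        proof (induction i rule: inc_induct)
          case (step k)
          then have "a k \<le> a (Suc k)"
            using adjacent[of k] by auto
          with step show ?case by simp
        qed simp
      qed
      have top: "a i < (if D (Suc n) then m else Suc m)" if "i \<in> {1..Suc n}" for i
        using mono[OF that] adjacent[of "Suc n"] am by auto
      have ext: "i \<notin> {1..?N} \<Longrightarrow> a i = undefined" for i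
        using a by (auto simp: staircases_def words_def)
      show "a(?N := undefined) \<in> ?B"
        unfolding staircases_def words_def mem_Collect_eq
      proof (intro conjI ballI)
        show "a(?N := undefined) \<in> {1..Suc n} \<rightarrow>\<^sub>E {..<if D (Suc n) then m else Suc m}"
          using top ext by (intro PiE_I) auto
        fix i assume "i \<in> {1..<Suc n}"
        then show "(a(?N := undefined)) i < (a(?N := undefined)) (Suc i) \<or>
            ((a(?N := undefined)) i = (a(?N := undefined)) (Suc i) \<and> \<not> D i)"
          using adjacent[of i] by auto
      qed
    qed
    show "(\<lambda>a. a(?N := m)) ` ?B \<subseteq> ?A"
    proof clarify
      fix a assume a: "a \<in> ?B"
      have lt: "a i < (if D (Suc n) then m else Suc m)" if "i \<in> {1..Suc n}" for i
        using a that by (auto simp: staircases_def words_def PiE_iff)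
      have step: "a i < a (Suc i) \<or> (a i = a (Suc i) \<and> \<not> D i)" if "i \<in> {1..<Suc n}" for i
        using a that by (auto simp: staircases_def)
      have ext: "i \<notin> {1..Suc n} \<Longrightarrow> a i = undefined" for i
        using a by (auto simp: staircases_def words_def)
      have "(a(?N := m)) i < Suc m" if "i \<in> {1..?N}" for i
        using lt[of i] that by (cases "i = ?N") (auto split: if_splits)
      then have "a(?N := m) \<in> words ?N (Suc m)"
        unfolding words_def using ext by (intro PiE_I) auto
      moreover have "(a(?N := m)) i < (a(?N := m)) (Suc i) \<or> ((a(?N := m)) i = (a(?N := m)) (Suc i) \<and> \<not> D i)"
        if "i \<in> {1..<?N}" for i
        using lt[of "Suc n"] step[of i] that by (cases "i = Suc n") (auto split: if_splits)
      ultimately show "a(?N := m) \<in> staircases D ?N (Suc m) \<and> (a(?N := m)) ?N = m"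
        by (auto simp: staircases_def)
    qed
  qed
  then show ?thesis by (rule bij_betw_same_card)
qed

text \<open>
  Splitting by whether the last letter is the largest one gives Pascal's rule. Only the number of
  strict steps matters: each of them costs one letter of the alphabet.
\<close>

lemma card_staircases:
  assumes "n \<ge> 1"
  shows "card (staircases D n m) = (n + m - 1 - card {i \<in> {1..<n}. D i}) choose n"
  using assms
proof (induction n arbitrary: m)
  case (Suc n)
  note IH = Suc.IH
  show ?case
  proof (cases n)
    case 0
    have "staircases D 1 m = words 1 m" by (auto simp: staircases_def)
    then show ?thesis using 0 by (simp add: card_words)
  next
    case (Suc n')
    let ?d = "\<lambda>n. card {i \<in> {1..<n}. D i}"
    have d: "?d (Suc n) = (if D n then 1 else 0) + ?d n"
    proof -
      have "{i \<in> {1..<Suc n}. D i} = (if D n then {n} else {}) \<union> {i \<in> {1..<n}. D i}"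
        using Suc by (auto simp: less_Suc_eq)
      then show ?thesis by (simp add: card_insert_if)
    qed
    have dn: "?d n < n"
    proof -
      have "?d n \<le> card {1..<n}" by (intro card_mono) auto
      then show ?thesis using Suc by simp
    qed
    show ?thesis
    proof (induction m)
      case 0
      have "staircases D (Suc n) 0 = {}" by (auto simp: staircases_def words_def)
      then show ?case using dn d by simp
    next
      case (Suc m)
      have split: "staircases D (Suc n) (Suc m) =
          staircases D (Suc n) m \<union> {a \<in> staircases D (Suc n) (Suc m). a (Suc n) = m}"
        (is "?L = ?A \<union> ?B")
      proof (intro equalityI subsetI)
        fix a assume a: "a \<in> ?L"
        show "a \<in> ?A \<union> ?B"
        proof (cases "a (Suc n) = m")
          case False
          have "a (Suc n) < Suc m" using a by (auto simp: staircases_def words_def PiE_iff)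
          with False have top: "a (Suc n) < m" by simp
          have "a i < m" if "i \<in> {1..Suc n}" for i
            using staircase_le_last[OF a, of i] top that by simp
          then have "a \<in> words (Suc n) m"
            using a unfolding words_def staircases_def by (auto simp: PiE_iff)
          then show ?thesis using a by (auto simp: staircases_def)
        qed (use a in auto)
      qed (auto simp: staircases_def words_def PiE_iff less_Suc_eq)
      have disj: "?A \<inter> ?B = {}" by (force simp: staircases_def words_def PiE_iff)
      have "finite (staircases D N M)" for N M
        by (rule finite_subset[OF _ finite_words]) (auto simp: staircases_def)
      then have "card ?L = card ?A + card ?B"
        using split disj by (metis (lifting) card_Un_disjoint finite_Un)
      also have "card ?B = card (staircases D n (if D n then m else Suc m))"
        using card_staircases_top[of D n' m] \<open>n = Suc n'\<close> by simp
      also have "\<dots> = (n + m - ?d (Suc n)) choose n"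
        using Suc.prems \<open>n = Suc n'\<close> d IH by simp
      also have "card ?A = (n + m - ?d (Suc n)) choose Suc n"
        using Suc by simp
      finally show ?case using dn d by (simp add: Suc_diff_le)
    qed
  qed
qed simp

lemma adjacent_letters_imp_letter_before:
  assumes "\<And>i. i \<in> {1..<n} \<Longrightarrow> b i < b (Suc i) \<or> (b i = b (Suc i) \<and> \<pi> i < \<pi> (Suc i))"
    and "1 \<le> i" "i < j" "j \<le> n"
  shows "b i < b j \<or> (b i = (b j :: nat) \<and> \<pi> i < (\<pi> j :: nat))"
  using assms(3,4)
proof (induction j)
  case (Suc j)
  show ?case
  proof (cases "i = j")
    case True
    then show ?thesis using assms(1)[of i] assms(2) Suc.prems by auto
  next
    case False
    then show ?thesis using assms(1)[of j] assms(2) Suc by fastforce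
  qed
qed simp

text \<open>
  By transitivity it is enough to compare cards with consecutive labels.
\<close>

lemma staircase_word_iff:
  assumes \<sigma>: "\<sigma> permutes {1..n}" and w: "w \<in> words n m"
  shows "standardisation n w = \<sigma> \<longleftrightarrow>
    (\<forall>i\<in>{1..<n}. w (inv \<sigma> i) < w (inv \<sigma> (Suc i)) \<or>
      (w (inv \<sigma> i) = w (inv \<sigma> (Suc i)) \<and> \<not> inv \<sigma> (i + 1) < inv \<sigma> i))"
    (is "_ \<longleftrightarrow> ?R")
proof
  have inv_in: "inv \<sigma> i \<in> {1..n}" if "i \<in> {1..n}" for i
    using permutes_in_image[OF permutes_inv[OF \<sigma>]] that by blast
  have \<sigma>_inv: "\<sigma> (inv \<sigma> i) = i" for i using permutes_inverses(1)[OF \<sigma>] .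
  show ?R if std: "standardisation n w = \<sigma>"
  proof
    fix i assume i: "i \<in> {1..<n}"
    have "letter_before w (inv \<sigma> i) (inv \<sigma> (Suc i)) \<longleftrightarrow> \<sigma> (inv \<sigma> i) < \<sigma> (inv \<sigma> (Suc i))"
      using standardisation_less_iff[of "inv \<sigma> i" n "inv \<sigma> (Suc i)" w] inv_in i std by simp
    then show "w (inv \<sigma> i) < w (inv \<sigma> (Suc i)) \<or>
      (w (inv \<sigma> i) = w (inv \<sigma> (Suc i)) \<and> \<not> inv \<sigma> (i + 1) < inv \<sigma> i)"
      by (auto simp: \<sigma>_inv letter_before_def)
  qed
  show "standardisation n w = \<sigma>" if R: ?R
  proof (rule standardisation_unique[OF \<sigma>])
    have adjacent: "w (inv \<sigma> i) < w (inv \<sigma> (Suc i)) \<or>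
        (w (inv \<sigma> i) = w (inv \<sigma> (Suc i)) \<and> inv \<sigma> i < inv \<sigma> (Suc i))" if "i \<in> {1..<n}" for i
    proof -
      have "inv \<sigma> i \<noteq> inv \<sigma> (Suc i)" using \<sigma>_inv by (metis n_not_Suc_n)
      then show ?thesis using R that by fastforce
    qed
    have up: "letter_before w (inv \<sigma> i) (inv \<sigma> j)" if "1 \<le> i" "i < j" "j \<le> n" for i j
      using adjacent_letters_imp_letter_before[of n "\<lambda>i. w (inv \<sigma> i)" "inv \<sigma>" i j] adjacent that
      by (auto simp: letter_before_def)
    fix i j assume ij: "i \<in> {1..n}" "j \<in> {1..n}"
    have inv: "inv \<sigma> (\<sigma> k) = k" for k using permutes_inverses(2)[OF \<sigma>] .
    have "\<sigma> i \<in> {1..n}" "\<sigma> j \<in> {1..n}" using ij permutes_in_image[OF \<sigma>] by blast+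
    then have "letter_before w i j" if "\<sigma> i < \<sigma> j" "i \<in> {1..n}" "j \<in> {1..n}" for i j
      using up[of "\<sigma> i" "\<sigma> j"] that permutes_in_image[OF \<sigma>] inv by (metis atLeastAtMost_iff)
    from this[of i j] this[of j i] show "letter_before w i j \<longleftrightarrow> \<sigma> i < \<sigma> j"
      using ij inv by (metis letter_before_def linorder_neqE_nat order_less_asym)
  qed
qed

lemma card_words_standardisation:
  assumes "n \<ge> 1" "\<sigma> permutes {1..n}"
  shows "card {w \<in> words n m. standardisation n w = \<sigma>} = (n + m - rising_sequences n \<sigma>) choose n"
proof -
  let ?D = "\<lambda>i. inv \<sigma> (i + 1) < inv \<sigma> i"
  let ?f = "\<lambda>w. restrict (\<lambda>i. w (inv \<sigma> i)) {1..n}"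
  let ?g = "\<lambda>a. restrict (\<lambda>i. a (\<sigma> i)) {1..n}"
  note \<sigma> = assms(2)
  have inv_in: "inv \<sigma> i \<in> {1..n} \<longleftrightarrow> i \<in> {1..n}" for i
    using permutes_in_image[OF permutes_inv[OF \<sigma>]] .
  have \<sigma>_in: "\<sigma> i \<in> {1..n} \<longleftrightarrow> i \<in> {1..n}" for i
    using permutes_in_image[OF \<sigma>] .
  have inverse: "\<sigma> (inv \<sigma> i) = i" "inv \<sigma> (\<sigma> i) = i" for i using permutes_inverses[OF \<sigma>] by auto
  have g_word: "?g a \<in> words n m" if "a \<in> words n m" for a
    using that \<sigma>_in unfolding words_def by (intro restrict_PiE_iff[THEN iffD2]) auto
  have f_word: "?f w \<in> words n m" if "w \<in> words n m" for w
    using that inv_in unfolding words_def by (intro restrict_PiE_iff[THEN iffD2]) auto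
  have fg: "?f (?g a) = a" if "a \<in> words n m" for a
  proof
    fix i show "?f (?g a) i = a i"
      using inv_in[of i] inverse(1)[of i] PiE_arb[OF that[unfolded words_def], of i]
      by (cases "i \<in> {1..n}") (simp_all only: restrict_apply if_True if_False not_False_eq_True)
  qed
  have gf: "?g (?f a) = a" if "a \<in> words n m" for a
  proof
    fix i show "?g (?f a) i = a i"
      using \<sigma>_in[of i] inverse(2)[of i] PiE_arb[OF that[unfolded words_def], of i]
      by (cases "i \<in> {1..n}") (simp_all only: restrict_apply if_True if_False not_False_eq_True)
  qed
  have iff: "standardisation n w = \<sigma> \<longleftrightarrow> ?f w \<in> staircases ?D n m" if "w \<in> words n m" for w
  proof -
    have "?f w i = w (inv \<sigma> i)" "?f w (Suc i) = w (inv \<sigma> (Suc i))" if "i \<in> {1..<n}" for i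
      using that by simp_all
    then show ?thesis
      unfolding staircase_word_iff[OF \<sigma> that] staircases_def using f_word[OF that] by simp
  qed
  have "bij_betw ?f {w \<in> words n m. standardisation n w = \<sigma>} (staircases ?D n m)"
  proof (rule bij_betw_byWitness[where f' = ?g])
    have sub: "staircases ?D n m \<subseteq> words n m" by (auto simp: staircases_def)
    show "\<forall>w\<in>{w \<in> words n m. standardisation n w = \<sigma>}. ?g (?f w) = w" using gf by blast
    show "\<forall>a\<in>staircases ?D n m. ?f (?g a) = a" using fg sub by blast
    show "?f ` {w \<in> words n m. standardisation n w = \<sigma>} \<subseteq> staircases ?D n m"
      using iff by blast
    show "?g ` staircases ?D n m \<subseteq> {w \<in> words n m. standardisation n w = \<sigma>}"
    proof (rule image_subsetI)
      fix a assume a: "a \<in> staircases ?D n m"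
      then have "a \<in> words n m" using sub by blast
      then show "?g a \<in> {w \<in> words n m. standardisation n w = \<sigma>}"
        using g_word fg iff[of "?g a"] a by simp
    qed
  qed
  then have "card {w \<in> words n m. standardisation n w = \<sigma>} = card (staircases ?D n m)"
    by (rule bij_betw_same_card)
  also have "\<dots> = (n + m - rising_sequences n \<sigma>) choose n"
    using card_staircases[OF assms(1), of ?D m] by (simp add: rising_sequences_def)
  finally show ?thesis .
qed

text \<open>
  The number of words with a given standardisation is the numerator in the Bayer--Diaconis formula.
\<close>

lemma m_shuffle_eq_standardisation:
  assumes "n \<ge> 1" "m \<ge> 1"
  shows "m_shuffle n m = map_pmf (standardisation n) (pmf_of_set (words n m))"
proof (rule pmf_eqI)
  fix \<sigma>
  have "pmf (map_pmf (standardisation n) (pmf_of_set (words n m))) \<sigma> =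
      real (card {w \<in> words n m. standardisation n w = \<sigma>}) / real m ^ n"
    using words_nonempty[OF assms(2), of n]
    by (simp add: pmf_map measure_pmf_of_set card_words vimage_def Int_def)
  also have "\<dots> = pmf (m_shuffle n m) \<sigma>"
  proof (cases "\<sigma> permutes {1..n}")
    case True
    then show ?thesis using assms
      by (simp only: card_words_standardisation pmf_m_shuffle arrangements_def mem_Collect_eq if_True)
  next
    case False
    then have "{w \<in> words n m. standardisation n w = \<sigma>} = {}" using standardisation_permutes by blast
    then show ?thesis using False assms
      by (simp add: pmf_m_shuffle arrangements_def)
  qed
  finally show "pmf (m_shuffle n m) \<sigma> = pmf (map_pmf (standardisation n) (pmf_of_set (words n m))) \<sigma>" ..
qed

text \<open>
  Two shuffles are combined into one by giving the cards two-digit letters. The leading digit is the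
  letter from the first shuffle, read at the place from which the second shuffle takes the card.
\<close>

definition interleave :: "nat \<Rightarrow> nat \<Rightarrow> (nat \<Rightarrow> nat) \<Rightarrow> (nat \<Rightarrow> nat) \<Rightarrow> nat \<Rightarrow> nat" where
  "interleave n m' w u = restrict (\<lambda>j. w (standardisation n u j) * m' + u j) {1..n}"

lemma lex_nat_less_iff:
  fixes a b c d :: nat
  assumes "b < m" "d < m"
  shows "a * m + b < c * m + d \<longleftrightarrow> a < c \<or> (a = c \<and> b < d)"
proof -
  have *: "a * m + b < c * m + d" if "a < c" "b < m" for a b c d
  proof -
    have "Suc a * m \<le> c * m" using that by (intro mult_le_mono1) simp
    then show ?thesis using that by simp
  qed
  from *[of a c b d] *[of c a d b] show ?thesis using assms
    by (cases a c rule: linorder_cases) auto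
qed

lemma lex_nat_eq_iff:
  fixes a b c d :: nat
  assumes "b < m" "d < m"
  shows "a * m + b = c * m + d \<longleftrightarrow> a = c \<and> b = d"
  using lex_nat_less_iff[OF assms, of a c] lex_nat_less_iff[OF assms(2,1), of c a]
  by (cases a c rule: linorder_cases; cases b d rule: linorder_cases) auto

text \<open>
  Two-digit letters are compared by their leading digits first; ties are resolved by the second digit
  and then by position, hence in the order that the second shuffle induces.
\<close>

lemma standardisation_interleave:
  assumes u: "u \<in> words n m'"
  shows "standardisation n (interleave n m' w u) = standardisation n w \<circ> standardisation n u"
proof (rule standardisation_unique)
  show "(standardisation n w \<circ> standardisation n u) permutes {1..n}"
    by (rule permutes_compose) (rule standardisation_permutes)+
  fix i j assume ij: "i \<in> {1..n}" "j \<in> {1..n}"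
  let ?\<rho> = "standardisation n u"
  have \<rho>: "?\<rho> i \<in> {1..n}" "?\<rho> j \<in> {1..n}"
    using permutes_in_image[OF standardisation_permutes[of n u]] ij by blast+
  have "(?\<rho> i = ?\<rho> j) = (i = j)" using permutes_inj[OF standardisation_permutes[of n u]] by (auto dest: injD)
  have ub: "u i < m'" "u j < m'" using u ij by (auto simp: words_def PiE_iff)
  have "letter_before (interleave n m' w u) i j \<longleftrightarrow>
      w (?\<rho> i) < w (?\<rho> j) \<or> (w (?\<rho> i) = w (?\<rho> j) \<and> letter_before u i j)"
    using ij by (auto simp: letter_before_def interleave_def lex_nat_less_iff[OF ub] lex_nat_eq_iff[OF ub])
  also have "\<dots> \<longleftrightarrow> letter_before w (?\<rho> i) (?\<rho> j)"
    using standardisation_less_iff[OF ij, of u] by (auto simp: letter_before_def[of w])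
  also have "\<dots> \<longleftrightarrow> (standardisation n w \<circ> ?\<rho>) i < (standardisation n w \<circ> ?\<rho>) j"
    using standardisation_less_iff[OF \<rho>, of w] by simp
  finally show "letter_before (interleave n m' w u) i j \<longleftrightarrow>
      (standardisation n w \<circ> ?\<rho>) i < (standardisation n w \<circ> ?\<rho>) j" .
qed

text \<open>
  The second digits form \<open>u\<close>, which determines its standardisation, and undoing that rearrangement
  of the leading digits recovers \<open>w\<close>. So the map is injective, and both sides have the same size.
\<close>

lemma bij_betw_interleave:
  "bij_betw (\<lambda>(w, u). interleave n m' w u) (words n m \<times> words n m') (words n (m * m'))"
proof -
  let ?f = "\<lambda>(w, u). interleave n m' w u"
  have inj: "inj_on ?f (words n m \<times> words n m')"
  proof (rule inj_onI, clarify)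
    fix w u w' u'
    assume w: "w \<in> words n m" "w' \<in> words n m" and u: "u \<in> words n m'" "u' \<in> words n m'"
      and eq: "interleave n m' w u = interleave n m' w' u'"
    have *: "w (standardisation n u j) = w' (standardisation n u' j) \<and> u j = u' j" if "j \<in> {1..n}" for j
    proof -
      have "u j < m'" "u' j < m'" using u that by (auto simp: words_def PiE_iff)
      from lex_nat_eq_iff[OF this] fun_cong[OF eq, of j] that show ?thesis
        by (simp add: interleave_def)
    qed
    have uu: "u = u'" using u * unfolding words_def by (intro PiE_ext) auto
    have "w i = w' i" if i: "i \<in> {1..n}" for i
    proof -
      obtain j where "j \<in> {1..n}" "i = standardisation n u j"
        using i permutes_image[OF standardisation_permutes[of n u]] by blast
      then show ?thesis using * uu by blast
    qed
    then have "w = w'" using w unfolding words_def by (intro PiE_ext) auto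
    with uu show "w = w' \<and> u = u'" by simp
  qed
  have sub: "?f ` (words n m \<times> words n m') \<subseteq> words n (m * m')"
  proof clarify
    fix w u assume w: "w \<in> words n m" and u: "u \<in> words n m'"
    have "w (standardisation n u j) * m' + u j < m * m'" if j: "j \<in> {1..n}" for j
    proof -
      have "standardisation n u j \<in> {1..n}"
        using permutes_in_image[OF standardisation_permutes[of n u]] j by blast
      then have "w (standardisation n u j) < m" "u j < m'" using w u j by (auto simp: words_def PiE_iff)
      then show ?thesis using lex_nat_less_iff[of "u j" m' 0 "w (standardisation n u j)" m] by simp
    qed
    then show "interleave n m' w u \<in> words n (m * m')"
      unfolding words_def interleave_def by (intro restrict_PiE_iff[THEN iffD2]) auto
  qed
  have "card (?f ` (words n m \<times> words n m')) = card (words n (m * m'))"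
    by (simp add: card_image[OF inj] card_cartesian_product card_words power_mult_distrib)
  then have "?f ` (words n m \<times> words n m') = words n (m * m')" by (intro card_subset_eq sub) auto
  with inj show ?thesis by (simp add: bij_betw_def)
qed

lemma pair_pmf_of_set:
  assumes "finite A" "A \<noteq> {}" "finite B" "B \<noteq> {}"
  shows "pair_pmf (pmf_of_set A) (pmf_of_set B) = pmf_of_set (A \<times> B)"
proof (rule pmf_eqI, clarify)
  fix a b
  show "pmf (pair_pmf (pmf_of_set A) (pmf_of_set B)) (a, b) = pmf (pmf_of_set (A \<times> B)) (a, b)"
    using assms by (simp add: pmf_pair indicator_def card_cartesian_product)
qed

text \<open>
  The combined word of two independent uniform words is a uniform word over the product alphabet.
\<close>

lemma m_shuffle_convolution:
  assumes "n \<ge> 1" "m \<ge> 1" "m' \<ge> 1"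
  shows "convolution_pmf (m_shuffle n m) (m_shuffle n m') = m_shuffle n (m * m')"
proof -
  have "convolution_pmf (m_shuffle n m) (m_shuffle n m') =
      map_pmf (\<lambda>(w, u). standardisation n w \<circ> standardisation n u)
        (pair_pmf (pmf_of_set (words n m)) (pmf_of_set (words n m')))"
    using assms by (simp add: m_shuffle_eq_standardisation convolution_pmf_def pair_pmf_def
        bind_map_pmf map_bind_pmf map_pmf_comp bind_return_pmf map_pmf_def bind_assoc_pmf)
  also have "\<dots> = map_pmf (\<lambda>(w, u). standardisation n w \<circ> standardisation n u)
        (pmf_of_set (words n m \<times> words n m'))"
    using assms words_nonempty by (simp add: pair_pmf_of_set)
  also have "\<dots> = map_pmf (\<lambda>x. standardisation n ((\<lambda>(w, u). interleave n m' w u) x))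
        (pmf_of_set (words n m \<times> words n m'))"
  proof (rule map_pmf_cong[OF refl])
    fix x assume "x \<in> set_pmf (pmf_of_set (words n m \<times> words n m'))"
    then have "x \<in> words n m \<times> words n m'"
      using words_nonempty assms by (subst (asm) set_pmf_of_set) auto
    then show "(case x of (w, u) \<Rightarrow> standardisation n w \<circ> standardisation n u) =
        standardisation n (case x of (w, u) \<Rightarrow> interleave n m' w u)"
      using standardisation_interleave by force
  qed
  also have "\<dots> = map_pmf (standardisation n)
        (map_pmf (\<lambda>(w, u). interleave n m' w u) (pmf_of_set (words n m \<times> words n m')))"
    by (simp add: map_pmf_comp)
  also have "\<dots> = map_pmf (standardisation n) (pmf_of_set (words n (m * m')))"
    using assms words_nonempty by (subst map_pmf_of_set_bij_betw[OF bij_betw_interleave]) auto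
  also have "\<dots> = m_shuffle n (m * m')"
    using assms by (simp add: m_shuffle_eq_standardisation)
  finally show ?thesis .
qed

lemma m_shuffle_1:
  assumes "n \<ge> 1"
  shows "m_shuffle n 1 = return_pmf id"
proof -
  have words: "words n 1 = {restrict (\<lambda>_. 0) {1..n}}"
    unfolding words_def by (auto simp: PiE_iff extensional_def fun_eq_iff)
  have "standardisation n (restrict (\<lambda>_. 0) {1..n}) = id"
    by (rule standardisation_unique) (auto simp: permutes_id letter_before_def)
  then show ?thesis
    using assms unfolding m_shuffle_eq_standardisation[OF assms order_refl] words
    by (simp add: pmf_of_set_singleton)
qed

primrec product_law :: "nat pmf \<Rightarrow> nat \<Rightarrow> nat pmf" where
  "product_law p 0 = return_pmf 1"
| "product_law p (Suc k) = bind_pmf (product_law p k) (\<lambda>m. map_pmf (\<lambda>m'. m * m') p)"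

lemma set_product_law:
  assumes "set_pmf p \<subseteq> {1..}"
  shows "set_pmf (product_law p k) \<subseteq> {1..}"
proof (induction k)
  case (Suc k)
  show ?case
  proof
    fix x assume "x \<in> set_pmf (product_law p (Suc k))"
    then obtain m m' where "m \<in> set_pmf (product_law p k)" "m' \<in> set_pmf p" "x = m * m'" by auto
    then show "x \<in> {1..}" using Suc assms by (auto simp: subset_iff Suc_le_eq)
  qed
qed simp

lemma convolution_power_p_shuffle:
  assumes n: "n \<ge> 1" and p: "set_pmf p \<subseteq> {1..}"
  shows "convolution_power (p_shuffle n p) k = bind_pmf (product_law p k) (m_shuffle n)"
proof (induction k)
  case 0
  then show ?case using m_shuffle_1[OF n] by (simp add: bind_return_pmf)
next
  case (Suc k)
  have "convolution_power (p_shuffle n p) (Suc k) =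
      bind_pmf (product_law p k) (\<lambda>m. bind_pmf p (\<lambda>m'. convolution_pmf (m_shuffle n m) (m_shuffle n m')))"
    unfolding convolution_power.simps Suc.IH
    unfolding convolution_pmf_def p_shuffle_def bind_assoc_pmf map_bind_pmf
    by (intro bind_pmf_cong refl, rule bind_commute_pmf)
  also have "\<dots> = bind_pmf (product_law p k) (\<lambda>m. bind_pmf p (\<lambda>m'. m_shuffle n (m * m')))"
  proof (intro bind_pmf_cong refl)
    fix m m' assume "m \<in> set_pmf (product_law p k)" "m' \<in> set_pmf p"
    then have "m \<ge> 1" "m' \<ge> 1" using set_product_law[OF p, of k] p by auto
    then show "convolution_pmf (m_shuffle n m) (m_shuffle n m') = m_shuffle n (m * m')"
      by (rule m_shuffle_convolution[OF n])
  qed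
  also have "\<dots> = bind_pmf (product_law p (Suc k)) (m_shuffle n)"
    by (simp add: bind_assoc_pmf bind_map_pmf)
  finally show ?case .
qed

section \<open>Rising sequences of a uniform arrangement\<close>

lemma sum_rising_sequences:
  fixes f :: "nat \<Rightarrow> 'a :: comm_monoid_add"
  shows "(\<Sum>\<sigma>\<in>arrangements n. f (rising_sequences n \<sigma>)) =
    (\<Sum>xs\<in>permutations_of_set {1..n}. f (Suc (descents xs)))"
proof -
  let ?D = "\<lambda>\<sigma>::nat \<Rightarrow> nat. card {i \<in> {1..<n}. \<sigma> (i + 1) < \<sigma> i}"
  have "(\<Sum>\<sigma>\<in>arrangements n. f (rising_sequences n \<sigma>)) = (\<Sum>\<sigma>\<in>arrangements n. f (Suc (?D (inv \<sigma>))))"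
    by (simp add: rising_sequences_def)
  also have "\<dots> = (\<Sum>\<sigma>\<in>arrangements n. f (Suc (?D \<sigma>)))"
    unfolding arrangements_def by (rule sum_permutations_inverse[symmetric])
  also have "\<dots> = (\<Sum>\<sigma>\<in>arrangements n. f (Suc (descents (map \<sigma> [1..<Suc n]))))"
    by (simp add: descents_map_upt del: upt_Suc)
  also have "\<dots> = (\<Sum>xs\<in>permutations_of_set {1..n}. f (Suc (descents xs)))"
    by (rule sum.reindex_bij_betw[OF bij_betw_arrangements_lists])
  finally show ?thesis .
qed

text \<open>
  Let \<open>y = 2 d - (n - 1)\<close> be the centred number of descents. Inserting the largest letter at a random
  place changes \<open>y\<close> by one up or down, and the probabilities favour the move towards zero. Hence the
  second moment grows by at most one with each letter.
\<close>

lemma sum_descents_deviation_sq: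
  assumes "n \<ge> 1"
  shows "(\<Sum>xs\<in>permutations_of_set {1..n}. nat ((2 * int (descents xs) - (int n - 1))\<^sup>2)) \<le> n * fact n"
  using assms
proof (induction n rule: nat_induct_at_least)
  case base
  have "permutations_of_set {1..1::nat} = {[1]}" by (simp add: permutations_of_set_singleton)
  then show ?case by simp
next
  case (Suc n)
  define g where "g d = nat ((2 * int d - int n)\<^sup>2)" for d
  define v where "v xs = nat ((2 * int (descents xs) - (int n - 1))\<^sup>2)" for xs
  have ins: "{1..Suc n} = insert (Suc n) {1..n}" by auto
  have "(\<Sum>xs\<in>permutations_of_set {1..Suc n}. g (descents xs)) =
     (\<Sum>(xs, k)\<in>permutations_of_set {1..n} \<times> {..n}. g (descents (take k xs @ Suc n # drop k xs)))"
    unfolding ins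
    by (subst sum.reindex_bij_betw[OF bij_betw_insert_letter, symmetric])
       (auto simp: case_prod_unfold)
  also have "\<dots> = (\<Sum>xs\<in>permutations_of_set {1..n}. \<Sum>k\<le>n. g (descents (take k xs @ Suc n # drop k xs)))"
    by (simp add: sum.cartesian_product)
  also have "\<dots> \<le> (\<Sum>xs\<in>permutations_of_set {1..n}. Suc n * (v xs + 1))"
  proof (rule sum_mono)
    fix xs assume xs: "xs \<in> permutations_of_set {1..n}"
    then have len: "length xs = n" and set: "\<forall>x\<in>set xs. x < Suc n"
      by (auto simp: length_finite_permutations_of_set permutations_of_set_def)
    then have ne: "xs \<noteq> []" using Suc.hyps by auto
    define d where "d = descents xs"
    have d: "d < n" using descents_less_length[OF ne] len by (simp add: d_def)
    have "(\<Sum>k\<le>n. g (descents (take k xs @ Suc n # drop k xs))) = (d + 1) * g d + (n - d) * g (d + 1)"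
      using descents_insert_max[OF set ne, of g] len by (simp add: d_def)
    also have "int \<dots> = (int n + 1) * ((2 * int d - (int n - 1))\<^sup>2 + 1) - 2 * (2 * int d - (int n - 1))\<^sup>2"
    proof -
      have g: "int (g d) = (2 * int d - int n)\<^sup>2" "int (g (d + 1)) = (2 * int d + 2 - int n)\<^sup>2"
        by (simp_all add: g_def algebra_simps)
      have nd: "int (n - d) = int n - int d" using d by (simp add: of_nat_diff)
      have identity: "(D + 1) * (2 * D - N)\<^sup>2 + (N - D) * (2 * D + 2 - N)\<^sup>2 =
          (N + 1) * ((2 * D - (N - 1))\<^sup>2 + 1) - 2 * (2 * D - (N - 1))\<^sup>2" for D N :: int
        by algebra
      show ?thesis unfolding of_nat_add of_nat_mult of_nat_1 g nd by (rule identity)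
    qed
    also have "\<dots> \<le> int (Suc n * (v xs + 1))"
    proof -
      have "int (Suc n * (v xs + 1)) = (int n + 1) * ((2 * int d - (int n - 1))\<^sup>2 + 1)"
        unfolding v_def d_def by (simp add: distrib_left distrib_right)
      then show ?thesis by simp
    qed
    finally show "(\<Sum>k\<le>n. g (descents (take k xs @ Suc n # drop k xs))) \<le> Suc n * (v xs + 1)"
      by (simp only: of_nat_le_iff)
  qed
  also have "\<dots> = Suc n * ((\<Sum>xs\<in>permutations_of_set {1..n}. v xs) + fact n)"
    unfolding sum_distrib_left[symmetric] sum.distrib by simp
  also have "\<dots> \<le> Suc n * (n * fact n + fact n)"
    using Suc.IH by (intro mult_le_mono2 add_le_mono1) (simp add: v_def)
  also have "\<dots> = Suc n * fact (Suc n)" by (simp add: algebra_simps)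
  finally show ?case by (simp add: g_def)
qed

lemma sum_rising_deviation_sq:
  assumes "n \<ge> 1"
  shows "(\<Sum>\<sigma>\<in>arrangements n. (2 * real (rising_sequences n \<sigma>) - real n - 1)\<^sup>2) \<le> real n * fact n"
proof -
  have "(\<Sum>\<sigma>\<in>arrangements n. (2 * real (rising_sequences n \<sigma>) - real n - 1)\<^sup>2) =
      (\<Sum>xs\<in>permutations_of_set {1..n}. (2 * real (Suc (descents xs)) - real n - 1)\<^sup>2)"
    by (rule sum_rising_sequences)
  also have "\<dots> = real (\<Sum>xs\<in>permutations_of_set {1..n}. nat ((2 * int (descents xs) - (int n - 1))\<^sup>2))"
    by (simp add: algebra_simps)
  also have "\<dots> \<le> real (n * fact n)"
    using sum_descents_deviation_sq[OF assms] of_nat_le_iff by blast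
  finally show ?thesis by simp
qed

lemma descents_complement:
  assumes "distinct xs" "\<forall>x\<in>set xs. x \<le> N"
  shows "descents (map (\<lambda>x. N - x) xs) = length xs - 1 - descents xs"
  using assms
proof (induction xs rule: descents.induct)
  case (1 x y ys)
  have "descents (y # ys) \<le> length ys" using descents_less_length[of "y # ys"] by simp
  then show ?case using 1 by auto
qed auto

text \<open>
  Replacing each letter \<open>x\<close> by \<open>n + 1 - x\<close> exchanges ascents and descents.
\<close>

lemma sum_descents_complement:
  fixes f :: "nat \<Rightarrow> 'a :: comm_monoid_add"
  shows "(\<Sum>xs\<in>permutations_of_set {1..n}. f (descents xs)) =
    (\<Sum>xs\<in>permutations_of_set {1..n}. f (n - 1 - descents xs))"
proof -
  let ?c = "\<lambda>x. Suc n - x"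
  have inj: "inj_on ?c {1..n}" by (auto simp: inj_on_def)
  moreover have "?c ` {1..n} = {1..n}"
  proof (intro equalityI subsetI)
    fix x assume "x \<in> {1..n}"
    then show "x \<in> ?c ` {1..n}" by (intro image_eqI[of _ _ "Suc n - x"]) auto
  qed auto
  ultimately have "map ?c ` permutations_of_set {1..n} = permutations_of_set {1..n}"
    using permutations_of_set_image_inj[of ?c "{1..n}"] by simp
  moreover have "inj_on (map ?c) (permutations_of_set {1..n})"
  proof (rule inj_onI)
    fix xs ys
    assume "xs \<in> permutations_of_set {1..n}" "ys \<in> permutations_of_set {1..n}" "map ?c xs = map ?c ys"
    then show "xs = ys"
      using inj by (intro map_inj_on[of ?c xs ys]) (simp_all add: permutations_of_set_def)
  qed
  ultimately have "bij_betw (map ?c) (permutations_of_set {1..n}) (permutations_of_set {1..n})"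
    by (simp add: bij_betw_def)
  then have "(\<Sum>xs\<in>permutations_of_set {1..n}. f (descents xs)) =
      (\<Sum>xs\<in>permutations_of_set {1..n}. f (descents (map ?c xs)))"
    by (rule sum.reindex_bij_betw[symmetric])
  also have "\<dots> = (\<Sum>xs\<in>permutations_of_set {1..n}. f (n - 1 - descents xs))"
  proof (rule sum.cong[OF refl])
    fix xs assume xs: "xs \<in> permutations_of_set {1..n}"
    then have "distinct xs" "\<forall>x\<in>set xs. x \<le> Suc n" "length xs = n"
      by (auto simp: permutations_of_set_def length_finite_permutations_of_set[OF xs])
    then show "f (descents (map ?c xs)) = f (n - 1 - descents xs)"
      using descents_complement[of xs "Suc n"] by simp
  qed
  finally show ?thesis .
qed

lemma arrangements_nonempty [simp]: "arrangements n \<noteq> {}"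
  using permutes_id[of "{1..n}"] unfolding arrangements_def by blast

lemma card_arrangements: "card (arrangements n) = fact n"
  by (simp add: arrangements_def card_permutations)

lemma rising_sequences_bounds:
  assumes "n \<ge> 1"
  shows "1 \<le> rising_sequences n \<sigma>" "rising_sequences n \<sigma> \<le> n"
proof -
  have "card {i \<in> {1..<n}. inv \<sigma> (i + 1) < inv \<sigma> i} \<le> card {1..<n}" by (intro card_mono) auto
  then show "1 \<le> rising_sequences n \<sigma>" "rising_sequences n \<sigma> \<le> n"
    using assms by (auto simp: rising_sequences_def)
qed

lemma prob_uniform_arrangement:
  "measure_pmf.prob (uniform_arrangement n) {\<sigma>. P (rising_sequences n \<sigma>)} =
    real (\<Sum>\<sigma>\<in>arrangements n. if P (rising_sequences n \<sigma>) then 1 else 0) / fact n"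
  by (simp add: uniform_arrangement_def measure_pmf_of_set card_arrangements flip: sum.inter_filter)
     (simp add: Int_def)

text \<open>
  Chebyshev's inequality.
\<close>

lemma uniform_rising_sequences_concentrated:
  assumes "n \<ge> 1" "B > 0"
  shows "measure_pmf.prob (uniform_arrangement n)
      {\<sigma>. \<bar>real (rising_sequences n \<sigma>) - (real n + 1) / 2\<bar> \<ge> B * sqrt (real n)} \<le> 1 / B\<^sup>2"
proof -
  let ?d = "\<lambda>r. \<bar>real r - (real n + 1) / 2\<bar>"
  let ?S = "\<Sum>\<sigma>\<in>arrangements n. if ?d (rising_sequences n \<sigma>) \<ge> B * sqrt (real n) then 1 else 0 :: nat"
  have "real ?S * (B\<^sup>2 * real n) =
      (\<Sum>\<sigma>\<in>arrangements n. if ?d (rising_sequences n \<sigma>) \<ge> B * sqrt (real n) then B\<^sup>2 * real n else 0)"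
    by (auto simp: sum_distrib_right intro!: sum.cong)
  also have "\<dots> \<le> (\<Sum>\<sigma>\<in>arrangements n. (2 * real (rising_sequences n \<sigma>) - real n - 1)\<^sup>2)"
  proof (rule sum_mono)
    fix \<sigma> assume "\<sigma> \<in> arrangements n"
    have "B\<^sup>2 * real n \<le> (2 * real (rising_sequences n \<sigma>) - real n - 1)\<^sup>2"
      if "?d (rising_sequences n \<sigma>) \<ge> B * sqrt (real n)"
    proof -
      have "(B * sqrt (real n))\<^sup>2 \<le> (?d (rising_sequences n \<sigma>))\<^sup>2"
        using that assms by (intro power_mono) auto
      also have "\<dots> \<le> (2 * real (rising_sequences n \<sigma>) - real n - 1)\<^sup>2"
        unfolding power2_abs
        by (intro abs_le_square_iff[THEN iffD1]) (auto simp: abs_if field_simps)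
      finally show ?thesis by (simp add: power_mult_distrib)
    qed
    then show "(if ?d (rising_sequences n \<sigma>) \<ge> B * sqrt (real n) then B\<^sup>2 * real n else 0) \<le>
        (2 * real (rising_sequences n \<sigma>) - real n - 1)\<^sup>2" by auto
  qed
  also have "\<dots> \<le> real n * fact n" by (rule sum_rising_deviation_sq[OF assms(1)])
  finally have "real ?S * B\<^sup>2 \<le> fact n" using assms(1) by (simp add: field_simps)
  then show ?thesis
    using assms(2) unfolding prob_uniform_arrangement[of n "\<lambda>r. ?d r \<ge> B * sqrt (real n)"]
    by (simp add: pos_divide_le_eq pos_le_divide_eq mult.commute del: of_nat_sum)
qed

lemma uniform_rising_sequences_median:
  assumes "n \<ge> 1"
  shows "measure_pmf.prob (uniform_arrangement n)
      {\<sigma>. real (rising_sequences n \<sigma>) < (real n + 1) / 2} \<le> 1 / 2"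
proof -
  let ?A = "\<lambda>r. real r < (real n + 1) / 2"
  let ?S = "\<lambda>P. \<Sum>xs\<in>permutations_of_set {1..n}. if P (Suc (descents xs)) then 1 else 0 :: nat"
  have "?S ?A = (\<Sum>xs\<in>permutations_of_set {1..n}. if ?A (Suc (n - 1 - descents xs)) then 1 else 0)"
    by (rule sum_descents_complement)
  then have "?S ?A + ?S ?A = (\<Sum>xs\<in>permutations_of_set {1..n}.
      (if ?A (Suc (descents xs)) then 1 else 0) + (if ?A (Suc (n - 1 - descents xs)) then 1 else 0))"
    by (simp add: sum.distrib)
  also have "\<dots> \<le> (\<Sum>xs\<in>permutations_of_set {1..n}. 1)"
  proof (rule sum_mono)
    fix xs assume xs: "xs \<in> permutations_of_set {1..n}"
    then have len: "length xs = n" by (auto simp: length_finite_permutations_of_set)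
    then have "xs \<noteq> []" using assms by auto
    then have "descents xs < n" using descents_less_length len by blast
    then show "(if ?A (Suc (descents xs)) then 1 else 0) +
        (if ?A (Suc (n - 1 - descents xs)) then 1 else 0) \<le> (1 :: nat)"
      by (auto simp: of_nat_diff field_simps)
  qed
  finally have "2 * ?S ?A \<le> fact n" by simp
  then have "2 * real (?S ?A) \<le> fact n" by (metis of_nat_le_iff of_nat_mult of_nat_fact of_nat_numeral)
  then show ?thesis
    unfolding prob_uniform_arrangement[of n ?A]
      sum_rising_sequences[of "\<lambda>r. if ?A r then 1 else 0 :: nat" n]
    by (simp add: field_simps del: of_nat_sum)
qed

section \<open>The density of a riffle shuffle\<close>

lemma one_plus_ge_exp:
  assumes "\<bar>x\<bar> \<le> 1 / 2"
  shows "1 + x \<ge> exp (x - 2 * x\<^sup>2 :: real)"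
proof -
  have "x - 2 * x\<^sup>2 \<le> ln (1 + x)" using abs_ln_one_plus_x_minus_x_bound[OF assms] by linarith
  moreover have "1 + x > 0" using assms by (auto simp: abs_if split: if_splits)
  ultimately show ?thesis by (simp add: ln_ge_iff)
qed

text \<open>
  The difference of the two logarithms vanishes at zero, and its derivative
  \<open>x (2 - x) / (3 (1 + x))\<close> has the sign of \<open>x\<close>.
\<close>

lemma one_plus_le_exp:
  assumes "x \<le> 1"
  shows "1 + x \<le> exp (x - x\<^sup>2 / 6 :: real)"
proof (cases "x > -1")
  case False
  then show ?thesis by (smt (verit) exp_gt_zero)
next
  case True
  define f where "f x = x - x\<^sup>2 / 6 - ln (1 + x)" for x :: real
  have deriv: "(f has_real_derivative x * (2 - x) / (3 * (1 + x))) (at x)" if "x > -1" for x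
    unfolding f_def using that
    by (auto intro!: derivative_eq_intros simp: divide_simps power2_eq_square) (auto simp: algebra_simps)
  have "f 0 \<le> f x"
  proof (cases "x \<ge> 0")
    case nonneg: True
    show ?thesis
    proof (rule DERIV_nonneg_imp_nondecreasing[OF nonneg])
      fix y assume "0 \<le> y" "y \<le> x"
      then show "\<exists>D. (f has_real_derivative D) (at y) \<and> 0 \<le> D"
        using assms by (intro exI[of _ "y * (2 - y) / (3 * (1 + y))"] conjI deriv) auto
    qed
  next
    case False
    show ?thesis
    proof (rule DERIV_nonpos_imp_nonincreasing[of x 0])
      fix y assume y: "x \<le> y" "y \<le> 0"
      then show "\<exists>D. (f has_real_derivative D) (at y) \<and> D \<le> 0"
        using True
        by (intro exI[of _ "y * (2 - y) / (3 * (1 + y))"] conjI deriv)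
           (auto intro!: divide_nonpos_pos mult_nonpos_nonneg)
    qed (use False in simp)
  qed
  then have "ln (1 + x) \<le> x - x\<^sup>2 / 6" by (simp add: f_def)
  then show ?thesis using True exp_ln[of "1 + x"] by (metis add.commute exp_le_cancel_iff minus_less_iff
      diff_gt_0_iff_gt diff_minus_eq_add)
qed

text \<open>
  For \<open>n \<le> m\<close> this is the density with respect to the uniform distribution, as a function of the number \<open>r\<close> of
  rising sequences. The falling factorial in the binomial coefficient has been distributed over the
  \<open>n\<close> factors \<open>1/m\<close>.
\<close>

definition shuffle_density :: "nat \<Rightarrow> nat \<Rightarrow> nat \<Rightarrow> real" where
  "shuffle_density n m r = (\<Prod>i=1..n. 1 + (real i - real r) / real m)"

lemma pmf_uniform_arrangement:
  "\<sigma> \<in> arrangements n \<Longrightarrow> pmf (uniform_arrangement n) \<sigma> = 1 / fact n"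
  by (simp add: uniform_arrangement_def card_arrangements)

lemma pmf_m_shuffle_density:
  assumes "n \<ge> 1" "m \<ge> n" "\<sigma> \<in> arrangements n"
  shows "pmf (m_shuffle n m) \<sigma> =
    shuffle_density n m (rising_sequences n \<sigma>) * pmf (uniform_arrangement n) \<sigma>"
proof -
  define r where "r = rising_sequences n \<sigma>"
  have r: "r \<le> n" "1 \<le> r" using rising_sequences_bounds[OF assms(1)] by (auto simp: r_def)
  have "real ((n + m - r) choose n) = pochhammer (real m - real r + 1) n / fact n"
    using r assms by (simp add: binomial_gbinomial gbinomial_pochhammer' of_nat_diff algebra_simps)
  also have "pochhammer (real m - real r + 1) n = (\<Prod>i=1..n. real m - real r + real i)"
    unfolding pochhammer_prod
    by (rule prod.reindex_bij_witness[of _ "\<lambda>i. i - 1" Suc]) auto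
  also have "\<dots> = (\<Prod>i=1..n. real m * (1 + (real i - real r) / real m))"
    using assms by (intro prod.cong) (auto simp: field_simps)
  also have "\<dots> = real m ^ n * shuffle_density n m r"
    by (simp add: prod.distrib shuffle_density_def)
  finally show ?thesis
    using assms by (simp add: pmf_m_shuffle pmf_uniform_arrangement r_def[symmetric])
qed

lemma sum_centred: "(\<Sum>i=1..n. real i - r) = real n * ((real n + 1) / 2 - r)"
proof -
  have "(\<Sum>i=1..n. real i) = real n * (real n + 1) / 2"
    by (induction n) (auto simp: field_simps)
  then show ?thesis by (simp add: sum_subtractf algebra_simps)
qed

lemma sum_centred_sq:
  "(\<Sum>i=1..n. (real i - r)\<^sup>2) = real n * ((real n)\<^sup>2 - 1) / 12 + real n * ((real n + 1) / 2 - r)\<^sup>2"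
  by (induction n) (auto simp: field_simps power2_eq_square)

text \<open>
  The logarithm is expanded to second order. The first-order terms add up to \<open>n ((n + 1)/2 - r)/m\<close>, and
  each of the \<open>n\<close> second-order terms is at most a constant times \<open>n\<^sup>2/m\<^sup>2\<close>.
\<close>

lemma shuffle_density_ge:
  assumes "n \<ge> 1" "2 * n \<le> m" "1 \<le> r" "r \<le> n"
  shows "shuffle_density n m r \<ge>
    exp (real n * ((real n + 1) / 2 - real r) / real m - 2 * real n ^ 3 / (real m)\<^sup>2)"
proof -
  have m: "real m > 0" using assms by simp
  let ?x = "\<lambda>i. (real i - real r) / real m"
  have "(\<Sum>i=1..n. (real i - real r)\<^sup>2) \<le> (\<Sum>i=1..n. (real n)\<^sup>2)"
    using assms by (intro sum_mono) (auto simp: abs_le_square_iff[symmetric])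
  then have "(\<Sum>i=1..n. (real i - real r)\<^sup>2) \<le> real n ^ 3" by (simp add: power2_eq_square power3_eq_cube)
  then have "2 * (\<Sum>i=1..n. (real i - real r)\<^sup>2) / (real m)\<^sup>2 \<le> 2 * real n ^ 3 / (real m)\<^sup>2"
    using m by (intro divide_right_mono) auto
  moreover have "(\<Sum>i=1..n. ?x i - 2 * (?x i)\<^sup>2) =
      (\<Sum>i=1..n. real i - real r) / real m - 2 * (\<Sum>i=1..n. (real i - real r)\<^sup>2) / (real m)\<^sup>2"
    by (simp only: sum_subtractf[of "\<lambda>i. (real i - real r) / real m"] sum_divide_distrib sum_distrib_left power_divide times_divide_eq_right)
  ultimately have "exp (real n * ((real n + 1) / 2 - real r) / real m - 2 * real n ^ 3 / (real m)\<^sup>2) \<le>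
      exp (\<Sum>i=1..n. ?x i - 2 * (?x i)\<^sup>2)"
    by (simp add: sum_centred del: One_nat_def)
  also have "\<dots> = (\<Prod>i=1..n. exp (?x i - 2 * (?x i)\<^sup>2))" by (rule exp_sum) simp
  also have "\<dots> \<le> shuffle_density n m r"
    unfolding shuffle_density_def
  proof (intro prod_mono conjI)
    fix i assume i: "i \<in> {1..n}"
    have "\<bar>real i - real r\<bar> \<le> real m / 2" using i assms by (auto simp: abs_if)
    then have "\<bar>?x i\<bar> \<le> 1 / 2" using m by (simp add: field_simps)
    then show "exp (?x i - 2 * (?x i)\<^sup>2) \<le> 1 + ?x i" by (rule one_plus_ge_exp)
  qed simp
  finally show ?thesis .
qed

text \<open>
  The second-order terms add up to at least \<open>n\<^sup>3/m\<^sup>2\<close> times a positive constant, whatever \<open>r\<close> is, because the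
  sum of \<open>(i - r)\<^sup>2\<close> is smallest at \<open>r = (n + 1)/2\<close>.
\<close>

lemma shuffle_density_le:
  assumes "n \<ge> 2" "n \<le> m" "1 \<le> r" "r \<le> n"
  shows "shuffle_density n m r \<le>
    exp (real n * ((real n + 1) / 2 - real r) / real m - real n ^ 3 / (96 * (real m)\<^sup>2))"
proof -
  have m: "real m > 0" using assms by simp
  let ?x = "\<lambda>i. (real i - real r) / real m"
  have "shuffle_density n m r \<le> (\<Prod>i=1..n. exp (?x i - (?x i)\<^sup>2 / 6))"
    unfolding shuffle_density_def
  proof (intro prod_mono conjI)
    fix i assume i: "i \<in> {1..n}"
    have "\<bar>real i - real r\<bar> \<le> real m" using i assms by (auto simp: abs_if)
    then have *: "?x i \<le> 1" "?x i \<ge> -1" using m by (auto simp: field_simps abs_le_iff)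
    from *(1) show "1 + ?x i \<le> exp (?x i - (?x i)\<^sup>2 / 6)" by (rule one_plus_le_exp)
    from *(2) show "0 \<le> 1 + ?x i" by simp
  qed
  also have "\<dots> = exp (\<Sum>i=1..n. ?x i - (?x i)\<^sup>2 / 6)" by (rule exp_sum[symmetric]) simp
  also have "(\<Sum>i=1..n. ?x i - (?x i)\<^sup>2 / 6) =
      (\<Sum>i=1..n. real i - real r) / real m - (\<Sum>i=1..n. (real i - real r)\<^sup>2) / (6 * (real m)\<^sup>2)"
    by (simp only: sum_subtractf[of "\<lambda>i. (real i - real r) / real m"] sum_divide_distrib power_divide divide_divide_eq_left mult.commute[of 6])
  also have "exp \<dots> \<le> exp (real n * ((real n + 1) / 2 - real r) / real m - real n ^ 3 / (96 * (real m)\<^sup>2))"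
  proof -
    have "4 \<le> (real n)\<^sup>2" using assms(1) power_mono[of 2 "real n" 2] by simp
    then have "real n * (real n)\<^sup>2 * 3 / 4 \<le> real n * ((real n)\<^sup>2 - 1)"
      using mult_left_mono[of "(real n)\<^sup>2 * 3 / 4" "(real n)\<^sup>2 - 1" "real n"] by simp
    then have "real n ^ 3 / 16 \<le> real n * ((real n)\<^sup>2 - 1) / 12"
      by (simp add: power3_eq_cube power2_eq_square)
    moreover have "0 \<le> real n * ((real n + 1) / 2 - real r)\<^sup>2" by simp
    ultimately have "real n ^ 3 / 16 \<le> (\<Sum>i=1..n. (real i - real r)\<^sup>2)"
      unfolding sum_centred_sq by linarith
    then have "real n ^ 3 / 16 / (6 * (real m)\<^sup>2) \<le> (\<Sum>i=1..n. (real i - real r)\<^sup>2) / (6 * (real m)\<^sup>2)"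
      by (intro divide_right_mono) auto
    then show ?thesis by (simp add: sum_centred del: One_nat_def)
  qed
  finally show ?thesis .
qed


section \<open>Comparing a riffle shuffle with the uniform distribution\<close>

lemma prob_pmf_Compl: "measure_pmf.prob P (- A) = 1 - measure_pmf.prob P A"
  using measure_pmf.prob_compl[of A P] by (simp add: Compl_eq_Diff_UNIV)

lemma prob_eq_sum_arrangements:
  assumes "set_pmf P \<subseteq> arrangements n"
  shows "measure_pmf.prob P A = (\<Sum>\<sigma>\<in>arrangements n \<inter> A. pmf P \<sigma>)"
proof -
  have "measure_pmf.prob P A = measure_pmf.prob P (arrangements n \<inter> A)"
    using assms by (intro measure_prob_cong_0) (auto simp: set_pmf_iff)
  then show ?thesis by (simp add: measure_measure_pmf_finite)
qed

lemma set_pmf_m_shuffle: "m \<ge> 1 \<Longrightarrow> set_pmf (m_shuffle n m) \<subseteq> arrangements n"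
  by (auto simp: set_pmf_iff pmf_m_shuffle split: if_splits)

lemma set_pmf_uniform_arrangement: "set_pmf (uniform_arrangement n) \<subseteq> arrangements n"
  by (simp add: uniform_arrangement_def)

text \<open>
  Summing the cross-multiplied inequality over \<open>\<sigma> \<in> A\<close> and \<open>\<tau> \<notin> A\<close> compares \<open>Q A * P (- A)\<close> with
  \<open>P A * Q (- A)\<close>, that is, the odds of \<open>A\<close> under both laws.
\<close>

lemma prob_mono_likelihood_ratio:
  assumes P: "set_pmf P \<subseteq> arrangements n" and Q: "set_pmf Q \<subseteq> arrangements n"
    and cross: "\<And>\<sigma> \<tau>. \<sigma> \<in> arrangements n \<inter> A \<Longrightarrow> \<tau> \<in> arrangements n \<inter> - A \<Longrightarrow>
      pmf Q \<sigma> * pmf P \<tau> \<le> pmf P \<sigma> * pmf Q \<tau>"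
  shows "measure_pmf.prob Q A \<le> measure_pmf.prob P A"
proof -
  have "measure_pmf.prob Q A * measure_pmf.prob P (- A) \<le> measure_pmf.prob P A * measure_pmf.prob Q (- A)"
    unfolding prob_eq_sum_arrangements[OF P] prob_eq_sum_arrangements[OF Q] sum_product
    by (intro sum_mono cross) auto
  then show ?thesis
    by (simp add: prob_pmf_Compl algebra_simps)
qed

text \<open>
  Both sides are products of \<open>n\<close> factors, and the inequality holds factor by factor because
  \<open>x (x + u + v) \<le> (x + u) (x + v)\<close>.
\<close>

lemma binomial_log_concave:
  fixes a u v n :: nat
  shows "(a choose n) * ((a + u + v) choose n) \<le> ((a + u) choose n) * ((a + v) choose n)"
proof (cases "n \<le> a")
  case False
  then show ?thesis by (simp add: binomial_eq_0)
next
  case True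
  have b: "real ((a + x) choose n) = (\<Prod>i=0..<n. (real a + real x - real i) / (real n - real i))" for x
    using True by (simp add: binomial_altdef_of_nat of_nat_diff)
  have "real (a choose n) * real ((a + u + v) choose n) \<le> real ((a + u) choose n) * real ((a + v) choose n)"
    using b[of 0] b[of "u + v"] unfolding b[of u] b[of v]
  proof (simp add: add.assoc flip: prod.distrib, intro prod_mono conjI)
    fix i assume i: "i \<in> {0..<n}"
    then have "0 \<le> real a - real i" using True by simp
    then show "0 \<le> (real a - real i) * (real a + (real u + real v) - real i) / ((real n - real i) * (real n - real i))"
      by simp
    have "(real a - real i) * (real a + (real u + real v) - real i) \<le>
        (real a + real u - real i) * (real a + real v - real i)"
      by (simp add: algebra_simps)
    then show "(real a - real i) * (real a + (real u + real v) - real i) / ((real n - real i) * (real n - real i)) \<le>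
        (real a + real u - real i) * (real a + real v - real i) / ((real n - real i) * (real n - real i))"
      by (intro divide_right_mono) auto
  qed
  then show ?thesis by (metis of_nat_le_iff of_nat_mult)
qed

text \<open>
  More packs produce more rising sequences: the ratio of the two densities is monotone in the number
  of rising sequences by log-concavity. Thus one test event serves all smaller numbers of packs.
\<close>

lemma prob_few_rising_sequences_antimono:
  assumes "n \<ge> 1" "1 \<le> m" "m \<le> m'"
  shows "measure_pmf.prob (m_shuffle n m') {\<sigma>. real (rising_sequences n \<sigma>) < x} \<le>
    measure_pmf.prob (m_shuffle n m) {\<sigma>. real (rising_sequences n \<sigma>) < x}"
proof (rule prob_mono_likelihood_ratio)
  have m': "m' \<ge> 1" using assms by simp
  fix \<sigma> \<tau>
  assume \<sigma>: "\<sigma> \<in> arrangements n \<inter> {\<sigma>. real (rising_sequences n \<sigma>) < x}"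
    and \<tau>: "\<tau> \<in> arrangements n \<inter> - {\<sigma>. real (rising_sequences n \<sigma>) < x}"
  let ?r = "rising_sequences n \<sigma>" and ?s = "rising_sequences n \<tau>"
  have "?r < ?s" "?s \<le> n" using \<sigma> \<tau> rising_sequences_bounds[OF assms(1)] by auto
  then have eq: "n + m - ?r = (n + m - ?s) + (?s - ?r)" "n + m' - ?s = (n + m - ?s) + (m' - m)"
      "n + m' - ?r = (n + m - ?s) + (?s - ?r) + (m' - m)" using assms by auto
  have "((n + m' - ?r) choose n) * ((n + m - ?s) choose n) \<le> ((n + m - ?r) choose n) * ((n + m' - ?s) choose n)"
    unfolding eq using binomial_log_concave[of "n + m - ?s" n "?s - ?r" "m' - m"] by (simp add: mult.commute)
  then have "real ((n + m' - ?r) choose n) * real ((n + m - ?s) choose n) \<le>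
      real ((n + m - ?r) choose n) * real ((n + m' - ?s) choose n)"
    by (metis of_nat_le_iff of_nat_mult)
  then have "real ((n + m' - ?r) choose n) * real ((n + m - ?s) choose n) / (real m ^ n * real m' ^ n) \<le>
      real ((n + m - ?r) choose n) * real ((n + m' - ?s) choose n) / (real m ^ n * real m' ^ n)"
    by (intro divide_right_mono) auto
  then show "pmf (m_shuffle n m') \<sigma> * pmf (m_shuffle n m) \<tau> \<le> pmf (m_shuffle n m) \<sigma> * pmf (m_shuffle n m') \<tau>"
    using \<sigma> \<tau> assms m' by (simp add: pmf_m_shuffle mult.commute)
qed (use assms set_pmf_m_shuffle order_trans in blast)+

lemma prob_few_rising_sequences_ge_uniform:
  assumes "n \<ge> 1" "1 \<le> m"
  shows "measure_pmf.prob (uniform_arrangement n) {\<sigma>. real (rising_sequences n \<sigma>) < x} \<le>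
    measure_pmf.prob (m_shuffle n m) {\<sigma>. real (rising_sequences n \<sigma>) < x}"
proof (rule prob_mono_likelihood_ratio)
  fix \<sigma> \<tau>
  assume \<sigma>: "\<sigma> \<in> arrangements n \<inter> {\<sigma>. real (rising_sequences n \<sigma>) < x}"
    and \<tau>: "\<tau> \<in> arrangements n \<inter> - {\<sigma>. real (rising_sequences n \<sigma>) < x}"
  have "n + m - rising_sequences n \<tau> \<le> n + m - rising_sequences n \<sigma>" using \<sigma> \<tau> by auto
  then have "((n + m - rising_sequences n \<tau>) choose n) \<le> ((n + m - rising_sequences n \<sigma>) choose n)"
    by (rule binomial_right_mono)
  then have "pmf (m_shuffle n m) \<tau> \<le> pmf (m_shuffle n m) \<sigma>"
    using \<sigma> \<tau> assms by (simp add: pmf_m_shuffle divide_right_mono)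
  then show "pmf (uniform_arrangement n) \<sigma> * pmf (m_shuffle n m) \<tau> \<le>
      pmf (m_shuffle n m) \<sigma> * pmf (uniform_arrangement n) \<tau>"
    using \<sigma> \<tau> by (simp add: pmf_uniform_arrangement divide_right_mono)
qed (use assms set_pmf_m_shuffle set_pmf_uniform_arrangement in blast)+

text \<open>
  On the event that the number of rising sequences is within \<open>B sqrt n\<close> of its mean, the density
  is at least the exponential on the right. The overlap with the uniform distribution is therefore at
  least this value times the uniform probability of the event.
\<close>

lemma prob_diff_uniform_le:
  assumes "n \<ge> 1" "2 * n \<le> m" "B > 0" "a > 0" "real m \<ge> a * (real n * sqrt (real n))"
  shows "measure_pmf.prob (m_shuffle n m) A - measure_pmf.prob (uniform_arrangement n) A \<le>
    1 - (1 - 1 / B\<^sup>2) * exp (- (B / a + 2 / a\<^sup>2))"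
proof -
  define e where "e = exp (- (B / a + 2 / a\<^sup>2))"
  define G where "G = {\<sigma>. \<bar>real (rising_sequences n \<sigma>) - (real n + 1) / 2\<bar> < B * sqrt (real n)}"
  let ?Q = "m_shuffle n m" and ?U = "uniform_arrangement n"
  have "0 \<le> B / a + 2 / a\<^sup>2" using assms by simp
  then have e: "0 < e" "e \<le> 1" by (simp_all add: e_def)
  have m: "m \<ge> 1" "real m > 0" "n \<le> m" using assms by auto
  have npos: "real n * sqrt (real n) > 0" using assms by simp
  have dens: "e * pmf ?U \<sigma> \<le> pmf ?Q \<sigma>" if "\<sigma> \<in> arrangements n \<inter> G" for \<sigma>
  proof -
    let ?r = "rising_sequences n \<sigma>"
    have "- (B / a) \<le> real n * ((real n + 1) / 2 - real ?r) / real m"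
    proof -
      have "real n * (- (B * sqrt (real n))) \<le> real n * ((real n + 1) / 2 - real ?r)"
        using that by (intro mult_left_mono) (auto simp: G_def abs_less_iff)
      moreover have "- (B / a) * real m \<le> - (B / a) * (a * (real n * sqrt (real n)))"
        using assms by (intro mult_left_mono_neg) auto
      moreover have "- (B / a) * (a * (real n * sqrt (real n))) = real n * (- (B * sqrt (real n)))"
        using assms(4) by simp
      ultimately have "- (B / a) * real m \<le> real n * ((real n + 1) / 2 - real ?r)" by linarith
      then show ?thesis using m by (simp add: pos_le_divide_eq)
    qed
    moreover have "2 * real n ^ 3 / (real m)\<^sup>2 \<le> 2 / a\<^sup>2"
    proof -
      have cube: "(a * (real n * sqrt (real n)))\<^sup>2 = a\<^sup>2 * real n ^ 3"
        by (simp add: power_mult_distrib power3_eq_cube power2_eq_square[of "real n"])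
      have "(a * (real n * sqrt (real n)))\<^sup>2 \<le> (real m)\<^sup>2"
        using assms npos by (intro power_mono) auto
      then have "a\<^sup>2 * real n ^ 3 \<le> (real m)\<^sup>2" by (simp only: cube)
      then show ?thesis using m assms(4) by (simp add: field_simps)
    qed
    ultimately have "e \<le> exp (real n * ((real n + 1) / 2 - real ?r) / real m - 2 * real n ^ 3 / (real m)\<^sup>2)"
      unfolding e_def by simp
    also have "\<dots> \<le> shuffle_density n m ?r"
      using assms rising_sequences_bounds by (intro shuffle_density_ge) auto
    finally show ?thesis
      using that m assms by (simp add: pmf_m_shuffle_density mult_right_mono)
  qed
  have part: "e * measure_pmf.prob ?U (G \<inter> X) \<le> measure_pmf.prob ?Q X" for X
  proof -
    have "e * measure_pmf.prob ?U (G \<inter> X) = (\<Sum>\<sigma>\<in>arrangements n \<inter> (G \<inter> X). e * pmf ?U \<sigma>)"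
      by (simp add: prob_eq_sum_arrangements[OF set_pmf_uniform_arrangement] sum_distrib_left)
    also have "\<dots> \<le> (\<Sum>\<sigma>\<in>arrangements n \<inter> (G \<inter> X). pmf ?Q \<sigma>)"
      by (intro sum_mono dens) auto
    also have "\<dots> = measure_pmf.prob ?Q (G \<inter> X)"
      by (rule prob_eq_sum_arrangements[OF set_pmf_m_shuffle[OF m(1)], symmetric])
    also have "\<dots> \<le> measure_pmf.prob ?Q X" by (intro measure_pmf.finite_measure_mono) auto
    finally show ?thesis .
  qed
  have "e * measure_pmf.prob ?U G = e * measure_pmf.prob ?U (G \<inter> A) + e * measure_pmf.prob ?U (G \<inter> - A)"
    unfolding distrib_left[symmetric]
    by (subst measure_pmf.finite_measure_Union[symmetric]) (auto intro!: arg_cong[where f = "measure_pmf.prob ?U"])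
  moreover have "e * measure_pmf.prob ?U (G \<inter> A) \<le> measure_pmf.prob ?U A"
    using e mult_mono[of e 1 "measure_pmf.prob ?U (G \<inter> A)" "measure_pmf.prob ?U A"]
    by (simp add: measure_pmf.finite_measure_mono)
  moreover have "measure_pmf.prob ?Q (- A) = 1 - measure_pmf.prob ?Q A"
    by (rule prob_pmf_Compl)
  moreover have "e * measure_pmf.prob ?U (G \<inter> - A) \<le> measure_pmf.prob ?Q (- A)" by (rule part)
  ultimately have "measure_pmf.prob ?Q A - measure_pmf.prob ?U A \<le> 1 - e * measure_pmf.prob ?U G" by linarith
  also have "\<dots> \<le> 1 - e * (1 - 1 / B\<^sup>2)"
  proof -
    have "measure_pmf.prob ?U (- G) \<le> 1 / B\<^sup>2"
      using uniform_rising_sequences_concentrated[OF assms(1,3)]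
      by (simp add: G_def Collect_neg_eq[symmetric] not_less)
    then have "1 - 1 / B\<^sup>2 \<le> measure_pmf.prob ?U G"
      by (simp add: prob_pmf_Compl)
    then have "e * (1 - 1 / B\<^sup>2) \<le> e * measure_pmf.prob ?U G" using e by (intro mult_left_mono) auto
    then show ?thesis by simp
  qed
  finally show ?thesis by (simp add: e_def mult.commute)
qed

text \<open>
  Outside \<open>A n\<close> the density of the shuffle with \<open>m0\<close> packs is at most the exponential on the
  right. The parameter \<open>m0\<close> is an integer close to \<open>a * n powr (3/2)\<close>, and smaller \<open>m\<close> are reduced
  to it by monotonicity.
\<close>

lemma prob_diff_few_rising_sequences_ge:
  fixes B a :: real
  defines "A \<equiv> \<lambda>n. {\<sigma>. real (rising_sequences n \<sigma>) < (real n + 1) / 2 - B * sqrt (real n)}"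
  assumes "n \<ge> 2" "n \<le> m0" "B \<ge> 0" "a > 0" "1 \<le> m" "m \<le> m0"
    and m0: "a / 2 * (real n * sqrt (real n)) \<le> real m0" "real m0 \<le> a * (real n * sqrt (real n))"
  shows "measure_pmf.prob (m_shuffle n m) (A n) - measure_pmf.prob (uniform_arrangement n) (A n) \<ge>
    (1 - exp (2 * B / a - 1 / (96 * a\<^sup>2))) * (1 - measure_pmf.prob (uniform_arrangement n) (A n))"
proof -
  define h where "h = exp (2 * B / a - 1 / (96 * a\<^sup>2))"
  let ?Q = "m_shuffle n m0" and ?U = "uniform_arrangement n"
  have m0pos: "m0 \<ge> 1" "real m0 > 0" using assms by auto
  have npos: "real n * sqrt (real n) > 0" using assms by simp
  have dens: "pmf ?Q \<sigma> \<le> h * pmf ?U \<sigma>" if "\<sigma> \<in> arrangements n \<inter> - A n" for \<sigma>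
  proof -
    let ?r = "rising_sequences n \<sigma>"
    have "real n * ((real n + 1) / 2 - real ?r) / real m0 \<le> 2 * B / a"
    proof -
      have "real n * ((real n + 1) / 2 - real ?r) \<le> real n * (B * sqrt (real n))"
        using that by (intro mult_left_mono) (auto simp: A_def)
      moreover have "2 * B / a * (a / 2 * (real n * sqrt (real n))) \<le> 2 * B / a * real m0"
        using assms by (intro mult_left_mono) auto
      moreover have "2 * B / a * (a / 2 * (real n * sqrt (real n))) = real n * (B * sqrt (real n))"
        using \<open>a > 0\<close> by simp
      ultimately have "real n * ((real n + 1) / 2 - real ?r) \<le> 2 * B / a * real m0" by linarith
      then show ?thesis using m0pos by (simp add: pos_divide_le_eq)
    qed
    moreover have "1 / (96 * a\<^sup>2) \<le> real n ^ 3 / (96 * (real m0)\<^sup>2)"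
    proof -
      have cube: "(a * (real n * sqrt (real n)))\<^sup>2 = a\<^sup>2 * real n ^ 3"
        by (simp add: power_mult_distrib power3_eq_cube power2_eq_square[of "real n"])
      have "(real m0)\<^sup>2 \<le> (a * (real n * sqrt (real n)))\<^sup>2"
        using m0 by (intro power_mono) auto
      then have "(real m0)\<^sup>2 \<le> a\<^sup>2 * real n ^ 3" by (simp only: cube)
      then show ?thesis using m0pos \<open>a > 0\<close> by (simp add: field_simps)
    qed
    moreover have "shuffle_density n m0 ?r \<le>
        exp (real n * ((real n + 1) / 2 - real ?r) / real m0 - real n ^ 3 / (96 * (real m0)\<^sup>2))"
      using assms rising_sequences_bounds[of n \<sigma>] by (intro shuffle_density_le) auto
    moreover have "exp (real n * ((real n + 1) / 2 - real ?r) / real m0 - real n ^ 3 / (96 * (real m0)\<^sup>2)) \<le> h"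
      using calculation(1,2) unfolding h_def by simp
    ultimately have "shuffle_density n m0 ?r \<le> h" by linarith
    then show ?thesis using that assms by (simp add: pmf_m_shuffle_density mult_right_mono)
  qed
  have "measure_pmf.prob ?Q (- A n) \<le> h * measure_pmf.prob ?U (- A n)"
    unfolding prob_eq_sum_arrangements[OF set_pmf_m_shuffle[OF m0pos(1)]]
      prob_eq_sum_arrangements[OF set_pmf_uniform_arrangement] sum_distrib_left
    by (intro sum_mono dens)
  then have "measure_pmf.prob ?Q (A n) - measure_pmf.prob ?U (A n) \<ge> (1 - h) * (1 - measure_pmf.prob ?U (A n))"
    by (simp add: prob_pmf_Compl algebra_simps)
  moreover have "measure_pmf.prob ?Q (A n) \<le> measure_pmf.prob (m_shuffle n m) (A n)"
    unfolding A_def using assms by (intro prob_few_rising_sequences_antimono) auto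
  ultimately show ?thesis by (simp add: h_def)
qed

section \<open>A central limit theorem for products of random factors\<close>

lemma expectation_bind_pmf:
  fixes f :: "'a \<Rightarrow> real"
  assumes "\<And>x. \<bar>f x\<bar> \<le> B"
  shows "measure_pmf.expectation (bind_pmf P N) f =
    measure_pmf.expectation P (\<lambda>x. measure_pmf.expectation (N x) f)"
  unfolding measure_pmf_bind
proof (rule integral_bind[where K = "count_space UNIV" and B' = 1 and B = B])
  show "(\<lambda>x. measure_pmf (N x)) \<in> measure_pmf P \<rightarrow>\<^sub>M subprob_algebra (count_space UNIV)"
    using measurable_measure_pmf[of N] by simp
  show "finite_measure (measure_pmf P)" by (rule measure_pmf.finite_measure_axioms)
  show "AE x in measure_pmf P. emeasure (measure_pmf (N x)) (space (measure_pmf (N x))) \<le> ennreal 1"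
    by (simp add: measure_pmf.emeasure_le_1)
qed (use assms in auto)

lemma expectation_bind_pmf_complex:
  fixes f :: "'a \<Rightarrow> complex"
  assumes "\<And>x. norm (f x) \<le> B"
  shows "measure_pmf.expectation (bind_pmf P N) f =
    measure_pmf.expectation P (\<lambda>x. measure_pmf.expectation (N x) f)"
proof -
  have int: "integrable (measure_pmf Q) f" for Q
    using assms by (intro measure_pmf.integrable_const_bound[where B = B]) auto
  have "norm (measure_pmf.expectation Q f) \<le> B" for Q
  proof -
    have "norm (measure_pmf.expectation Q f) \<le> measure_pmf.expectation Q (\<lambda>x. norm (f x))"
      by (rule integral_norm_bound)
    also have "\<dots> \<le> B"
      using assms by (intro measure_pmf.integral_le_const integrable_norm int) auto
    finally show ?thesis .
  qed
  then have int': "integrable (measure_pmf P) (\<lambda>x. measure_pmf.expectation (N x) f)"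
    by (intro measure_pmf.integrable_const_bound[where B = B]) auto
  have "\<bar>Re (f x)\<bar> \<le> B" "\<bar>Im (f x)\<bar> \<le> B" for x
    using assms[of x] abs_Re_le_cmod[of "f x"] abs_Im_le_cmod[of "f x"] by linarith+
  note bind = this[THEN expectation_bind_pmf]
  show ?thesis
    using bind[of P N] int int'
    by (intro complex_eqI) (simp_all flip: integral_Re integral_Im)
qed

lemma prob_bind_pmf:
  "measure_pmf.prob (bind_pmf P f) A = measure_pmf.expectation P (\<lambda>x. measure_pmf.prob (f x) A)"
proof -
  have "\<bar>indicator A x :: real\<bar> \<le> 1" for x by (simp add: indicator_def)
  from expectation_bind_pmf[of "indicator A", OF this] show ?thesis by simp
qed

text \<open>
  On the support the logarithm of a product is a sum of independent summands.
\<close>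

lemma char_product_law:
  assumes p: "set_pmf p \<subseteq> {1..}"
  shows "char (distr (product_law p k) borel (\<lambda>m. (ln (real m) - real k * \<mu>) / s)) t =
    char (distr p borel (\<lambda>m. (ln (real m) - \<mu>) / s)) t ^ k"
proof (induction k)
  case 0
  show ?case by (simp add: char_def integral_distr)
next
  case (Suc k)
  let ?f = "\<lambda>k m. iexp (t * ((ln (real m) - real k * \<mu>) / s))"
  have "measure_pmf.expectation (product_law p (Suc k)) (?f (Suc k)) =
      measure_pmf.expectation (product_law p k)
        (\<lambda>m. measure_pmf.expectation p (\<lambda>m'. ?f (Suc k) (m * m')))"
    unfolding product_law.simps by (subst expectation_bind_pmf_complex[where B = 1]) auto
  also have "\<dots> = measure_pmf.expectation (product_law p k)
        (\<lambda>m. measure_pmf.expectation p (\<lambda>m'. ?f k m * ?f 1 m'))"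
  proof (intro integral_cong_AE)
    show "AE m in product_law p k. measure_pmf.expectation p (\<lambda>m'. ?f (Suc k) (m * m')) =
        measure_pmf.expectation p (\<lambda>m'. ?f k m * ?f 1 m')"
    proof (rule AE_pmfI, intro integral_cong_AE AE_pmfI)
      fix m m' assume "m \<in> set_pmf (product_law p k)" "m' \<in> set_pmf p"
      then have "m \<ge> 1" "m' \<ge> 1" using set_product_law[OF p, of k] p by auto
      then have "t * ((ln (real (m * m')) - real (Suc k) * \<mu>) / s) =
          t * ((ln (real m) - real k * \<mu>) / s) + t * ((ln (real m') - real 1 * \<mu>) / s)"
        by (simp add: ln_mult algebra_simps add_divide_distrib diff_divide_distrib)
      then show "?f (Suc k) (m * m') = ?f k m * ?f 1 m'"
        by (simp only: of_real_add distrib_left exp_add)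
    qed auto
  qed auto
  also have "\<dots> = measure_pmf.expectation (product_law p k) (?f k) * measure_pmf.expectation p (?f 1)"
    by simp
  finally show ?case
    using Suc by (simp add: char_def integral_distr)
qed

text \<open>
  The third-order bound for a characteristic function at \<open>t / sqrt k\<close>, where the cubic term
  is used only for \<open>x\<^sup>2 \<le> \<epsilon> k\<close> and the quadratic one on the tail. Replacing the base of a \<open>k\<close>-th power costs
  a factor \<open>k\<close>, which the factor \<open>1/k\<close> in the squared argument compensates; the lower bound on \<open>k\<close> keeps
  the base \<open>1 - t\<^sup>2/(2k)\<close> in the unit disc.
\<close>

lemma (in real_distribution) char_power_approx:
  fixes k :: nat and t \<epsilon> :: real
  assumes mean: "integrable M (\<lambda>x. x)" "expectation (\<lambda>x. x) = 0"
    and var: "integrable M (\<lambda>x. x\<^sup>2)" "expectation (\<lambda>x. x\<^sup>2) = 1"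
    and k: "k > 0" "real k \<ge> t\<^sup>2 / 4" and \<epsilon>: "\<epsilon> > 0"
  shows "cmod (char M (t / sqrt (real k)) ^ k - complex_of_real ((1 + (- (t\<^sup>2) / 2) / real k) ^ k)) \<le>
    t\<^sup>2 / 6 * (6 * expectation (\<lambda>x. x\<^sup>2 * indicator {x. x\<^sup>2 > \<epsilon> * real k} x) + \<bar>t\<bar> * sqrt \<epsilon>)"
proof -
  define tail where "tail x = x\<^sup>2 * indicator {x. x\<^sup>2 > \<epsilon> * real k} x" for x :: real
  define w where "w = 1 + (- (t\<^sup>2) / 2) / real k"
  define u where "u = t / sqrt (real k)"
  have k0: "real k > 0" using k by simp
  have u2: "u\<^sup>2 = t\<^sup>2 / real k" by (simp add: u_def power_divide)
  have w: "\<bar>w\<bar> \<le> 1" using k(2) k0 by (simp add: w_def abs_le_iff field_simps)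
  have tail_meas: "tail \<in> borel_measurable M" unfolding tail_def by simp
  have tail: "integrable M tail"
    by (rule Bochner_Integration.integrable_bound[OF var(1) tail_meas])
       (simp add: tail_def indicator_def)
  have "variance (\<lambda>x. x) = 1" using mean var by simp
  then have "cmod (char M u - complex_of_real (1 - u\<^sup>2 * 1 / 2)) \<le>
      u\<^sup>2 / 6 * expectation (\<lambda>x. min (6 * x\<^sup>2) (\<bar>u\<bar> * \<bar>x\<bar> ^ 3))"
    by (rule char_approx3[OF mean var(1)])
  also have "1 - u\<^sup>2 * 1 / 2 = w" unfolding u2 w_def by simp
  also have "expectation (\<lambda>x. min (6 * x\<^sup>2) (\<bar>u\<bar> * \<bar>x\<bar> ^ 3)) \<le>
      expectation (\<lambda>x. 6 * tail x + \<bar>t\<bar> * sqrt \<epsilon> * x\<^sup>2)"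
  proof (rule integral_mono)
    show "integrable M (\<lambda>x. min (6 * x\<^sup>2) (\<bar>u\<bar> * \<bar>x\<bar> ^ 3))"
      by (rule Bochner_Integration.integrable_bound[of M "\<lambda>x. 6 * x\<^sup>2"]) (use var(1) in auto)
    show "integrable M (\<lambda>x. 6 * tail x + \<bar>t\<bar> * sqrt \<epsilon> * x\<^sup>2)"
      using var(1) tail by simp
    fix x :: real
    show "min (6 * x\<^sup>2) (\<bar>u\<bar> * \<bar>x\<bar> ^ 3) \<le> 6 * tail x + \<bar>t\<bar> * sqrt \<epsilon> * x\<^sup>2"
    proof (cases "x\<^sup>2 > \<epsilon> * real k")
      case True
      then have "6 * x\<^sup>2 \<le> 6 * tail x + \<bar>t\<bar> * sqrt \<epsilon> * x\<^sup>2" using \<epsilon> by (simp add: tail_def)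
      then show ?thesis by (rule min.coboundedI1)
    next
      case False
      then have "\<bar>x\<bar> \<le> sqrt (\<epsilon> * real k)" by (metis not_less real_sqrt_abs real_sqrt_le_iff)
      then have "\<bar>u\<bar> * \<bar>x\<bar> \<le> \<bar>u\<bar> * sqrt (\<epsilon> * real k)" by (intro mult_left_mono) auto
      also have "\<dots> = \<bar>t\<bar> * sqrt \<epsilon>" using k0 by (simp add: u_def real_sqrt_mult abs_divide)
      finally have "\<bar>u\<bar> * \<bar>x\<bar> * x\<^sup>2 \<le> \<bar>t\<bar> * sqrt \<epsilon> * x\<^sup>2" by (intro mult_right_mono) auto
      moreover have "\<bar>x\<bar> ^ 3 = \<bar>x\<bar> * x\<^sup>2"
        by (simp add: power3_eq_cube power2_eq_square)
      ultimately have "\<bar>u\<bar> * \<bar>x\<bar> ^ 3 \<le> 6 * tail x + \<bar>t\<bar> * sqrt \<epsilon> * x\<^sup>2"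
        using False by (simp add: tail_def mult.assoc)
      then show ?thesis by (rule min.coboundedI2)
    qed
  qed
  also have "\<dots> = 6 * expectation tail + \<bar>t\<bar> * sqrt \<epsilon>"
    using var tail by simp
  finally have *: "cmod (char M u - complex_of_real w) \<le> u\<^sup>2 / 6 * (6 * expectation tail + \<bar>t\<bar> * sqrt \<epsilon>)"
    by (simp add: mult_left_mono)
  have "cmod (char M u ^ k - complex_of_real w ^ k) \<le> real k * cmod (char M u - complex_of_real w)"
    by (rule norm_power_diff) (use w cmod_char_le_1 in auto)
  also have "\<dots> \<le> real k * (u\<^sup>2 / 6 * (6 * expectation tail + \<bar>t\<bar> * sqrt \<epsilon>))"
    by (rule mult_left_mono[OF *]) simp
  also have "\<dots> = t\<^sup>2 / 6 * (6 * expectation tail + \<bar>t\<bar> * sqrt \<epsilon>)"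
    using k0 unfolding u2 by simp
  finally show ?thesis by (simp add: u_def w_def tail_def[abs_def])
qed

text \<open>
  The Lindeberg argument: for fixed \<open>\<epsilon>\<close> the tail term disappears in the limit, and what is left of
  the bound is a multiple of \<open>sqrt \<epsilon>\<close>.
\<close>

lemma char_power_tendsto_std_normal:
  fixes \<nu> :: "nat \<Rightarrow> real measure" and k :: "nat \<Rightarrow> nat"
  assumes dist: "\<forall>\<^sub>F n in sequentially. real_distribution (\<nu> n)"
    and mean: "\<forall>\<^sub>F n in sequentially. integrable (\<nu> n) (\<lambda>x. x) \<and> (LINT x|\<nu> n. x) = 0"
    and var: "\<forall>\<^sub>F n in sequentially. integrable (\<nu> n) (\<lambda>x. x\<^sup>2) \<and> (LINT x|\<nu> n. x\<^sup>2) = 1"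
    and k: "filterlim k at_top sequentially"
    and lindeberg: "\<And>\<epsilon>. \<epsilon> > 0 \<Longrightarrow>
      (\<lambda>n. LINT x|\<nu> n. x\<^sup>2 * indicator {x. x\<^sup>2 > \<epsilon> * real (k n)} x) \<longlonglongrightarrow> 0"
  shows "(\<lambda>n. char (\<nu> n) (t / sqrt (real (k n))) ^ k n) \<longlonglongrightarrow> char std_normal_distribution t"
proof -
  let ?w = "\<lambda>n. 1 + (- (t\<^sup>2) / 2) / real (k n)"
  define L where "L \<epsilon> n = (LINT x|\<nu> n. x\<^sup>2 * indicator {x. x\<^sup>2 > \<epsilon> * real (k n)} x)" for \<epsilon> n
  have bound: "\<forall>\<^sub>F n in sequentially.
      cmod (char (\<nu> n) (t / sqrt (real (k n))) ^ k n - complex_of_real (?w n ^ k n)) \<le>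
      t\<^sup>2 / 6 * (6 * L \<epsilon> n + \<bar>t\<bar> * sqrt \<epsilon>)" if \<epsilon>: "\<epsilon> > 0" for \<epsilon>
  proof -
    have "\<forall>\<^sub>F n in sequentially. k n \<ge> nat \<lceil>t\<^sup>2 / 4\<rceil> + 1"
      using k by (simp add: filterlim_at_top)
    with dist mean var show ?thesis
    proof eventually_elim
      case (elim n)
      have "k n > 0" "real (k n) \<ge> t\<^sup>2 / 4" using elim(4) by linarith+
      then show ?case
        unfolding L_def using elim(2,3) \<epsilon> by (intro real_distribution.char_power_approx[OF elim(1)]) blast+
    qed
  qed
  have "(\<lambda>n. char (\<nu> n) (t / sqrt (real (k n))) ^ k n - complex_of_real (?w n ^ k n)) \<longlonglongrightarrow> 0"
  proof (rule tendstoI)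
    fix e :: real assume e: "e > 0"
    \<comment> \<open>This makes the error \<open>t\<^sup>2 \<bar>t\<bar> sqrt \<epsilon>\<close> at most \<open>e\<close>; the one avoids a division by zero at \<open>t = 0\<close>.\<close>
    define \<epsilon> where "\<epsilon> = (e / (\<bar>t\<bar> ^ 3 + 1))\<^sup>2"
    have c: "\<bar>t\<bar> ^ 3 + 1 > 0" by (intro add_nonneg_pos) auto
    have \<epsilon>: "\<epsilon> > 0" using e c by (simp add: \<epsilon>_def)
    have "sqrt \<epsilon> = e / (\<bar>t\<bar> ^ 3 + 1)" using e c by (simp add: \<epsilon>_def)
    then have "t\<^sup>2 * (\<bar>t\<bar> * sqrt \<epsilon>) = \<bar>t\<bar> ^ 3 * (e / (\<bar>t\<bar> ^ 3 + 1))"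
      by (simp add: power3_eq_cube power2_eq_square)
    also have "\<dots> \<le> e" using e c by (simp add: pos_divide_le_eq algebra_simps)
    finally have small: "t\<^sup>2 / 6 * (\<bar>t\<bar> * sqrt \<epsilon>) \<le> e / 6" by simp
    have "(\<lambda>n. t\<^sup>2 * L \<epsilon> n) \<longlonglongrightarrow> t\<^sup>2 * 0"
      using lindeberg[OF \<epsilon>] unfolding L_def by (intro tendsto_intros)
    then have "\<forall>\<^sub>F n in sequentially. t\<^sup>2 * L \<epsilon> n < e / 2"
      using e by (intro order_tendstoD) auto
    with bound[OF \<epsilon>] show "\<forall>\<^sub>F n in sequentially.
        dist (char (\<nu> n) (t / sqrt (real (k n))) ^ k n - complex_of_real (?w n ^ k n)) 0 < e"
    proof eventually_elim
      case (elim n)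
      have "t\<^sup>2 / 6 * (6 * L \<epsilon> n + \<bar>t\<bar> * sqrt \<epsilon>) = t\<^sup>2 * L \<epsilon> n + t\<^sup>2 / 6 * (\<bar>t\<bar> * sqrt \<epsilon>)"
        by (simp add: algebra_simps)
      then have "cmod (char (\<nu> n) (t / sqrt (real (k n))) ^ k n - complex_of_real (?w n ^ k n)) < e"
        using elim small e by linarith
      then show ?case by simp
    qed
  qed
  moreover have "(\<lambda>n. complex_of_real (?w n ^ k n)) \<longlonglongrightarrow> complex_of_real (exp (- (t\<^sup>2) / 2))"
    using filterlim_compose[OF tendsto_exp_limit_sequentially k, of "- (t\<^sup>2) / 2"]
    by (rule tendsto_of_real)
  ultimately show ?thesis
    using Lim_transform by (fastforce simp: char_std_normal_distribution)
qed

lemma std_normal_pos: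
  assumes "A \<in> sets borel" "emeasure lborel A > 0"
  shows "measure std_normal_distribution A > 0"
proof -
  interpret real_distribution std_normal_distribution by (rule real_dist_normal_dist)
  have "emeasure std_normal_distribution A \<noteq> 0"
  proof
    assume "emeasure std_normal_distribution A = 0"
    then have "A \<in> null_sets std_normal_distribution" using assms(1) by auto
    then have "AE x in lborel. x \<in> A \<longrightarrow> ennreal (std_normal_density x) = 0"
      by (subst (asm) null_sets_density_iff) auto
    then have "AE x in lborel. x \<notin> A"
      by eventually_elim (use normal_density_pos[of 1 0] in \<open>force simp: ennreal_eq_0_iff not_le[symmetric]\<close>)
    then show False using assms by (simp add: AE_iff_measurable[OF _ refl])
  qed
  then show ?thesis by (simp add: emeasure_eq_measure zero_less_measure_iff)
qed

abbreviation "\<Phi> \<equiv> cdf std_normal_distribution"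

lemma Phi_pos: "0 < \<Phi> x"
  unfolding cdf_def2
proof (rule std_normal_pos)
  have "0 < emeasure lborel {x - 1..x}" by simp
  also have "\<dots> \<le> emeasure lborel {..x}" by (intro emeasure_mono) auto
  finally show "0 < emeasure lborel {..x}" .
qed simp

lemma Phi_less_1: "\<Phi> x < 1"
proof -
  interpret real_distribution std_normal_distribution by (rule real_dist_normal_dist)
  have "0 < emeasure lborel {x + 1..x + 2}" by simp
  also have "\<dots> \<le> emeasure lborel (space borel - {..x})" by (intro emeasure_mono) auto
  finally have "0 < measure std_normal_distribution (space std_normal_distribution - {..x})"
    by (intro std_normal_pos) auto
  then show ?thesis unfolding cdf_def2 by (subst (asm) prob_compl) auto
qed

lemma isCont_Phi: "isCont \<Phi> x"
proof -
  interpret real_distribution std_normal_distribution by (rule real_dist_normal_dist)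
  have "{x} \<in> null_sets std_normal_distribution"
  proof (rule null_sets_density_iff[THEN iffD2], safe)
    show "AE y in lborel. y \<in> {x} \<longrightarrow> ennreal (std_normal_density y) = 0"
      using AE_lborel_singleton[of x] by eventually_elim simp
  qed simp_all
  then show ?thesis unfolding isCont_cdf by (simp add: measure_eq_0_null_sets)
qed

lemma clt_product_law:
  fixes p :: "nat \<Rightarrow> nat pmf" and k :: "nat \<Rightarrow> nat" and \<mu> \<sigma> :: "nat \<Rightarrow> real"
  defines "\<xi> \<equiv> \<lambda>n m. (ln (real m) - \<mu> n) / \<sigma> n"
  assumes p: "\<And>n. n \<ge> 1 \<Longrightarrow> set_pmf (p n) \<subseteq> {1..}"
    and mean: "\<And>n. n \<ge> 1 \<Longrightarrow> integrable (p n) (\<xi> n) \<and> measure_pmf.expectation (p n) (\<xi> n) = 0"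
    and var: "\<And>n. n \<ge> 1 \<Longrightarrow> integrable (p n) (\<lambda>m. (\<xi> n m)\<^sup>2) \<and>
      measure_pmf.expectation (p n) (\<lambda>m. (\<xi> n m)\<^sup>2) = 1"
    and \<sigma>: "\<And>n. n \<ge> 1 \<Longrightarrow> \<sigma> n > 0"
    and k: "filterlim k at_top sequentially"
    and lindeberg: "\<And>\<epsilon>. \<epsilon> > 0 \<Longrightarrow>
      (\<lambda>n. measure_pmf.expectation (p n) (\<lambda>m. (\<xi> n m)\<^sup>2 * indicator {m. (\<xi> n m)\<^sup>2 > \<epsilon> * real (k n)} m))
        \<longlonglongrightarrow> 0"
  shows "(\<lambda>n. measure_pmf.prob (product_law (p n) (k n))
      {m. ln (real m) \<le> real (k n) * \<mu> n + x * (sqrt (real (k n)) * \<sigma> n)}) \<longlonglongrightarrow> \<Phi> x"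
proof -
  define Z where "Z n m = (ln (real m) - real (k n) * \<mu> n) / (sqrt (real (k n)) * \<sigma> n)" for n m
  define \<nu> where "\<nu> n = distr (p n) borel (\<xi> n)" for n
  have ge1: "\<forall>\<^sub>F n in sequentially. n \<ge> (1::nat)" by (rule eventually_ge_at_top)
  have "weak_conv_m (\<lambda>n. distr (product_law (p n) (k n)) borel (Z n)) std_normal_distribution"
  proof (rule levy_continuity)
    show "real_distribution (distr (product_law (p n) (k n)) borel (Z n))" for n
      by (rule prob_space.real_distribution_distr[OF measure_pmf.prob_space_axioms]) auto
    show "real_distribution std_normal_distribution" by (rule real_dist_normal_dist)
    fix t
    have "(\<lambda>n. char (\<nu> n) (t / sqrt (real (k n))) ^ k n) \<longlonglongrightarrow> char std_normal_distribution t"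
    proof (rule char_power_tendsto_std_normal[OF _ _ _ k])
      show "\<forall>\<^sub>F n in sequentially. real_distribution (\<nu> n)"
        unfolding \<nu>_def by (intro always_eventually allI prob_space.real_distribution_distr[OF measure_pmf.prob_space_axioms]) auto
      show "\<forall>\<^sub>F n in sequentially. integrable (\<nu> n) (\<lambda>x. x) \<and> (LINT x|\<nu> n. x) = 0"
        using ge1 by eventually_elim (use mean in \<open>simp add: \<nu>_def integrable_distr_eq integral_distr\<close>)
      show "\<forall>\<^sub>F n in sequentially. integrable (\<nu> n) (\<lambda>x. x\<^sup>2) \<and> (LINT x|\<nu> n. x\<^sup>2) = 1"
        using ge1 by eventually_elim (use var in \<open>simp add: \<nu>_def integrable_distr_eq integral_distr\<close>)
      show "(\<lambda>n. LINT x|\<nu> n. x\<^sup>2 * indicator {x. x\<^sup>2 > \<epsilon> * real (k n)} x) \<longlonglongrightarrow> 0" if "\<epsilon> > 0" for \<epsilon>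
        using lindeberg[OF that] by (simp add: \<nu>_def integral_distr indicator_def)
    qed
    moreover have "\<forall>\<^sub>F n in sequentially. char (\<nu> n) (t / sqrt (real (k n))) ^ k n =
        char (distr (product_law (p n) (k n)) borel (Z n)) t"
      using ge1
    proof eventually_elim
      case (elim n)
      have "char (distr (p n) borel (\<lambda>m. (ln (real m) - \<mu> n) / (sqrt (real (k n)) * \<sigma> n))) t =
          char (\<nu> n) (t / sqrt (real (k n)))"
        by (simp add: \<nu>_def \<xi>_def char_def integral_distr mult.commute)
      then show ?case unfolding Z_def char_product_law[OF p[OF elim]] by simp
    qed
    ultimately show "(\<lambda>n. char (distr (product_law (p n) (k n)) borel (Z n)) t)
        \<longlonglongrightarrow> char std_normal_distribution t"
      by (rule Lim_transform_eventually)
  qed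
  then have "(\<lambda>n. cdf (distr (product_law (p n) (k n)) borel (Z n)) x) \<longlonglongrightarrow> \<Phi> x"
    unfolding weak_conv_m_def weak_conv_def using isCont_Phi by blast
  moreover have "\<forall>\<^sub>F n in sequentially. cdf (distr (product_law (p n) (k n)) borel (Z n)) x =
      measure_pmf.prob (product_law (p n) (k n))
        {m. ln (real m) \<le> real (k n) * \<mu> n + x * (sqrt (real (k n)) * \<sigma> n)}"
  proof -
    have "\<forall>\<^sub>F n in sequentially. k n \<ge> 1" using k by (simp add: filterlim_at_top)
    with ge1 show ?thesis
    proof eventually_elim
      case (elim n)
      then have "sqrt (real (k n)) * \<sigma> n > 0" using \<sigma> by simp
      then have "Z n m \<le> x \<longleftrightarrow> ln (real m) \<le> real (k n) * \<mu> n + x * (sqrt (real (k n)) * \<sigma> n)" for m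
        unfolding Z_def by (simp add: pos_divide_le_eq algebra_simps)
      then show ?case by (simp add: cdf_def2 measure_distr vimage_def)
    qed
  qed
  ultimately show ?thesis by (rule Lim_transform_eventually)
qed

section \<open>Total variation distance of mixtures of riffle shuffles\<close>

lemma tv_dist_bdd: "bdd_above (range (\<lambda>A. measure_pmf.prob P A - measure_pmf.prob Q A))"
proof (rule bdd_aboveI)
  fix x assume "x \<in> range (\<lambda>A. measure_pmf.prob P A - measure_pmf.prob Q A)"
  then obtain A where "x = measure_pmf.prob P A - measure_pmf.prob Q A" by blast
  then show "x \<le> 1" using measure_pmf.prob_le_1[of P A] measure_nonneg[of Q A] by linarith
qed

lemma tv_dist_ge: "measure_pmf.prob P A - measure_pmf.prob Q A \<le> tv_dist P Q"
  unfolding tv_dist_def by (rule cSUP_upper[OF UNIV_I tv_dist_bdd])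

lemma tv_dist_le: "(\<And>A. measure_pmf.prob P A - measure_pmf.prob Q A \<le> x) \<Longrightarrow> tv_dist P Q \<le> x"
  unfolding tv_dist_def by (rule cSUP_least) auto

lemma tv_dist_nonneg: "0 \<le> tv_dist P Q"
  using tv_dist_ge[of P "{}" Q] by simp

lemma tv_dist_le_1: "tv_dist P Q \<le> 1"
proof (rule tv_dist_le)
  fix A show "measure_pmf.prob P A - measure_pmf.prob Q A \<le> 1"
    using measure_pmf.prob_le_1[of P A] measure_nonneg[of Q A] by linarith
qed

lemma prob_bind_pmf_diff:
  "measure_pmf.prob (bind_pmf P f) A - c = measure_pmf.expectation P (\<lambda>x. measure_pmf.prob (f x) A - c)"
proof -
  have "integrable (measure_pmf P) (\<lambda>x. measure_pmf.prob (f x) A)"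
    by (intro measure_pmf.integrable_const_bound[where B = 1]) auto
  then show ?thesis by (simp add: prob_bind_pmf)
qed

lemma integrable_indicator_pmf: "integrable (measure_pmf P) (indicator G :: _ \<Rightarrow> real)"
  by (rule measure_pmf.integrable_const_bound[where B = 1]) (auto simp: indicator_def)

text \<open>
  Components outside \<open>G\<close> contribute at most one, which is the trivial bound.
\<close>

lemma tv_dist_mixture_le:
  assumes "\<And>x A. x \<in> set_pmf P \<Longrightarrow> x \<in> G \<Longrightarrow>
    measure_pmf.prob (f x) A - measure_pmf.prob U A \<le> 1 - \<eta>"
  shows "tv_dist (bind_pmf P f) U \<le> 1 - \<eta> * measure_pmf.prob P G"
proof (rule tv_dist_le)
  fix A
  have "measure_pmf.prob (bind_pmf P f) A - measure_pmf.prob U A =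
      measure_pmf.expectation P (\<lambda>x. measure_pmf.prob (f x) A - measure_pmf.prob U A)"
    by (rule prob_bind_pmf_diff)
  also have "\<dots> \<le> measure_pmf.expectation P (\<lambda>x. 1 - \<eta> * indicator G x)"
  proof (rule integral_mono_AE)
    show "integrable (measure_pmf P) (\<lambda>x. measure_pmf.prob (f x) A - measure_pmf.prob U A)"
      by (intro Bochner_Integration.integrable_diff measure_pmf.integrable_const_bound[where B = 1]) auto
    show "AE x in measure_pmf P. measure_pmf.prob (f x) A - measure_pmf.prob U A \<le> 1 - \<eta> * indicator G x"
    proof (rule AE_pmfI)
      fix x assume "x \<in> set_pmf P"
      then show "measure_pmf.prob (f x) A - measure_pmf.prob U A \<le> 1 - \<eta> * indicator G x"
        using assms[of x A] tv_dist_ge[of "f x" A U] tv_dist_le_1[of "f x" U]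
        by (cases "x \<in> G") auto
    qed
  qed (simp add: integrable_indicator_pmf)
  also have "\<dots> = 1 - \<eta> * measure_pmf.prob P G" by (simp add: integrable_indicator_pmf)
  finally show "measure_pmf.prob (bind_pmf P f) A - measure_pmf.prob U A \<le> 1 - \<eta> * measure_pmf.prob P G" .
qed

text \<open>
  All components use the same event \<open>A\<close>. Those outside \<open>G\<close> cannot cancel the contribution of the
  others since their difference is nonnegative.
\<close>

lemma tv_dist_mixture_ge:
  assumes "\<And>x. x \<in> set_pmf P \<Longrightarrow> measure_pmf.prob U A \<le> measure_pmf.prob (f x) A"
    and "\<And>x. x \<in> set_pmf P \<Longrightarrow> x \<in> G \<Longrightarrow> \<eta> \<le> measure_pmf.prob (f x) A - measure_pmf.prob U A"
  shows "\<eta> * measure_pmf.prob P G \<le> tv_dist (bind_pmf P f) U"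
proof -
  have "\<eta> * measure_pmf.prob P G = measure_pmf.expectation P (\<lambda>x. \<eta> * indicator G x)" by simp
  also have "\<dots> \<le> measure_pmf.expectation P (\<lambda>x. measure_pmf.prob (f x) A - measure_pmf.prob U A)"
  proof (rule integral_mono_AE)
    show "integrable (measure_pmf P) (\<lambda>x. measure_pmf.prob (f x) A - measure_pmf.prob U A)"
      by (intro Bochner_Integration.integrable_diff measure_pmf.integrable_const_bound[where B = 1]) auto
    show "AE x in measure_pmf P. \<eta> * indicator G x \<le> measure_pmf.prob (f x) A - measure_pmf.prob U A"
    proof (rule AE_pmfI)
      fix x assume "x \<in> set_pmf P"
      then show "\<eta> * indicator G x \<le> measure_pmf.prob (f x) A - measure_pmf.prob U A"
        using assms[of x] by (cases "x \<in> G") auto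
    qed
  qed (simp add: integrable_indicator_pmf)
  also have "\<dots> = measure_pmf.prob (bind_pmf P f) A - measure_pmf.prob U A"
    by (rule prob_bind_pmf_diff[symmetric])
  also have "\<dots> \<le> tv_dist (bind_pmf P f) U" by (rule tv_dist_ge)
  finally show ?thesis .
qed

lemma ln_le_three_halves_iff:
  assumes "n \<ge> 1" "m \<ge> 1" "a > 0"
  shows "ln (real m) \<le> 3 / 2 * ln (real n) + ln a \<longleftrightarrow> real m \<le> a * (real n * sqrt (real n))"
proof -
  have "ln (a * (real n * sqrt (real n))) = 3 / 2 * ln (real n) + ln a"
    using assms by (simp add: ln_mult ln_sqrt)
  moreover have "a * (real n * sqrt (real n)) > 0" using assms by simp
  ultimately show ?thesis using assms by (metis ln_le_cancel_iff of_nat_0_less_iff less_le_trans zero_less_one)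
qed

lemma tv_p_shuffle_le:
  assumes n: "n \<ge> 1" and p: "set_pmf p \<subseteq> {1..}" and "B > 0" "a > 0"
    and large: "2 * real n \<le> a * (real n * sqrt (real n))"
  shows "tv_dist (convolution_power (p_shuffle n p) k) (uniform_arrangement n) \<le>
    1 - (1 - 1 / B\<^sup>2) * exp (- (B / a + 2 / a\<^sup>2)) *
      measure_pmf.prob (product_law p k) {m. ln (real m) > 3 / 2 * ln (real n) + ln a}"
  unfolding convolution_power_p_shuffle[OF n p]
proof (rule tv_dist_mixture_le)
  fix m A assume "m \<in> set_pmf (product_law p k)" "m \<in> {m. ln (real m) > 3 / 2 * ln (real n) + ln a}"
  then have "m \<ge> 1" "\<not> ln (real m) \<le> 3 / 2 * ln (real n) + ln a"
    using set_product_law[OF p, of k] by auto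
  then have am: "a * (real n * sqrt (real n)) \<le> real m"
    using ln_le_three_halves_iff[OF n _ \<open>a > 0\<close>, of m] by simp
  have "real (2 * n) \<le> real m" using large am by simp
  then have "2 * n \<le> m" by (simp only: of_nat_le_iff)
  then show "measure_pmf.prob (m_shuffle n m) A - measure_pmf.prob (uniform_arrangement n) A \<le>
      1 - (1 - 1 / B\<^sup>2) * exp (- (B / a + 2 / a\<^sup>2))"
    by (rule prob_diff_uniform_le[OF n _ \<open>B > 0\<close> \<open>a > 0\<close> am])
qed

lemma tv_p_shuffle_ge:
  assumes n: "n \<ge> 2" and p: "set_pmf p \<subseteq> {1..}" and "B \<ge> 0" "a > 0"
    and large: "2 * real n \<le> a * (real n * sqrt (real n))"
    and h: "exp (2 * B / a - 1 / (96 * a\<^sup>2)) \<le> 1"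
    and u: "measure_pmf.prob (uniform_arrangement n)
      {\<sigma>. real (rising_sequences n \<sigma>) < (real n + 1) / 2 - B * sqrt (real n)} \<le> 1 - u"
  shows "(1 - exp (2 * B / a - 1 / (96 * a\<^sup>2))) * u *
      measure_pmf.prob (product_law p k) {m. ln (real m) \<le> 3 / 2 * ln (real n) + ln a} \<le>
    tv_dist (convolution_power (p_shuffle n p) k) (uniform_arrangement n)"
proof -
  \<comment> \<open>Rounding down loses at most a factor of two, since the real number is at least four.\<close>
  define m0 where "m0 = nat \<lfloor>a * (real n * sqrt (real n))\<rfloor>"
  let ?N = "a * (real n * sqrt (real n))"
  let ?A = "{\<sigma>. real (rising_sequences n \<sigma>) < (real n + 1) / 2 - B * sqrt (real n)}"
  have n1: "n \<ge> 1" using n by simp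
  have N: "?N \<ge> 4" using large n by linarith
  have m0: "real m0 \<le> ?N" "?N \<le> real m0 + 1" using N by (auto simp: m0_def)
  have "?N \<ge> 2 * real n" by (rule large)
  then have "n \<le> m0" using m0 n by linarith
  have half: "a / 2 * (real n * sqrt (real n)) \<le> real m0" using m0 N by linarith
  show ?thesis
    unfolding convolution_power_p_shuffle[OF n1 p]
  proof (rule tv_dist_mixture_ge)
    fix m assume m: "m \<in> set_pmf (product_law p k)"
    then have m1: "m \<ge> 1" using set_product_law[OF p, of k] by auto
    then show "measure_pmf.prob (uniform_arrangement n) ?A \<le> measure_pmf.prob (m_shuffle n m) ?A"
      by (rule prob_few_rising_sequences_ge_uniform[OF n1])
    assume "m \<in> {m. ln (real m) \<le> 3 / 2 * ln (real n) + ln a}"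
    then have "real m \<le> ?N" using ln_le_three_halves_iff[OF n1 m1 \<open>a > 0\<close>] by simp
    then have "m \<le> m0" unfolding m0_def by (rule le_nat_floor)
    then have "(1 - exp (2 * B / a - 1 / (96 * a\<^sup>2))) * (1 - measure_pmf.prob (uniform_arrangement n) ?A) \<le>
        measure_pmf.prob (m_shuffle n m) ?A - measure_pmf.prob (uniform_arrangement n) ?A"
      using assms m1 m0 half \<open>n \<le> m0\<close> by (intro prob_diff_few_rising_sequences_ge[of n m0]) auto
    moreover have "(1 - exp (2 * B / a - 1 / (96 * a\<^sup>2))) * u \<le>
        (1 - exp (2 * B / a - 1 / (96 * a\<^sup>2))) * (1 - measure_pmf.prob (uniform_arrangement n) ?A)"
      using h u by (intro mult_left_mono) auto
    ultimately show "(1 - exp (2 * B / a - 1 / (96 * a\<^sup>2))) * u \<le>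
        measure_pmf.prob (m_shuffle n m) ?A - measure_pmf.prob (uniform_arrangement n) ?A" by linarith
  qed
qed

section \<open>Families satisfying the Lindeberg condition\<close>

text \<open>
  The random variables enter only through their laws \<open>p n\<close>, and sample spaces are left out. The
  functions \<open>t\<close> and \<open>b\<close> are parameters, tied to \<open>\<mu>\<close> and \<open>\<sigma>\<close> by equations, so that the locale can be
  interpreted for given functions.
\<close>

locale lindeberg_shuffles =
  fixes p :: "nat \<Rightarrow> nat pmf" and \<mu> \<sigma> t b :: "nat \<Rightarrow> real"
  assumes support: "\<And>n. n \<ge> 1 \<Longrightarrow> set_pmf (p n) \<subseteq> {1..}"
    and integrable_ln: "\<And>n. n \<ge> 1 \<Longrightarrow> integrable (p n) (\<lambda>m. ln (real m))"
    and expectation_ln: "\<And>n. n \<ge> 1 \<Longrightarrow> measure_pmf.expectation (p n) (\<lambda>m. ln (real m)) = \<mu> n"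
    and integrable_ln_sq: "\<And>n. n \<ge> 1 \<Longrightarrow> integrable (p n) (\<lambda>m. (ln (real m))\<^sup>2)"
    and variance_ln: "\<And>n. n \<ge> 1 \<Longrightarrow> measure_pmf.expectation (p n) (\<lambda>m. (ln (real m) - \<mu> n)\<^sup>2) = (\<sigma> n)\<^sup>2"
    and \<mu>_pos: "\<And>n. n \<ge> 1 \<Longrightarrow> 0 < \<mu> n"
    and \<sigma>_pos: "\<And>n. n \<ge> 1 \<Longrightarrow> 0 < \<sigma> n"
    and t_eq: "\<And>n. t n = 3 * ln (real n) / (2 * \<mu> n)"
    and b_eq: "\<And>n. b n = 1 / \<mu> n * max 1 (sqrt ((\<sigma> n)\<^sup>2 * ln (real n) / \<mu> n))"
    and lindeberg: "\<And>\<epsilon>. \<epsilon> > 0 \<Longrightarrow> (\<lambda>n. measure_pmf.expectation (p n)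
       (\<lambda>m. ((ln (real m) - \<mu> n) / \<sigma> n)\<^sup>2 *
         indicator {m. ((ln (real m) - \<mu> n) / \<sigma> n)\<^sup>2 > \<epsilon> * (ln (real n) / \<mu> n)} m)) \<longlonglongrightarrow> 0"
begin

definition \<xi> :: "nat \<Rightarrow> nat \<Rightarrow> real" where
  "\<xi> n m = (ln (real m) - \<mu> n) / \<sigma> n"

definition tail :: "nat \<Rightarrow> real \<Rightarrow> real" where
  "tail n y = measure_pmf.expectation (p n) (\<lambda>m. (\<xi> n m)\<^sup>2 * indicator {m. (\<xi> n m)\<^sup>2 > y} m)"

lemma standardised_mean:
  assumes "n \<ge> 1"
  shows "integrable (p n) (\<xi> n)" "measure_pmf.expectation (p n) (\<xi> n) = 0"
  using integrable_ln[OF assms] expectation_ln[OF assms] unfolding \<xi>_def[abs_def] by simp_all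

lemma standardised_variance:
  assumes "n \<ge> 1"
  shows "integrable (p n) (\<lambda>m. (\<xi> n m)\<^sup>2)" "measure_pmf.expectation (p n) (\<lambda>m. (\<xi> n m)\<^sup>2) = 1"
proof -
  have "(\<lambda>m. (ln (real m) - \<mu> n)\<^sup>2) = (\<lambda>m. (ln (real m))\<^sup>2 - 2 * \<mu> n * ln (real m) + (\<mu> n)\<^sup>2)"
    by (simp add: power2_diff algebra_simps)
  then have "integrable (p n) (\<lambda>m. (ln (real m) - \<mu> n)\<^sup>2)"
    using integrable_ln[OF assms] integrable_ln_sq[OF assms] by simp
  then show "integrable (p n) (\<lambda>m. (\<xi> n m)\<^sup>2)" "measure_pmf.expectation (p n) (\<lambda>m. (\<xi> n m)\<^sup>2) = 1"
    using variance_ln[OF assms] \<sigma>_pos[OF assms] unfolding \<xi>_def by (simp_all add: power_divide)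
qed

lemma integrable_tail:
  assumes "n \<ge> 1"
  shows "integrable (p n) (\<lambda>m. (\<xi> n m)\<^sup>2 * indicator {m. (\<xi> n m)\<^sup>2 > y} m)"
  using standardised_variance(1)[OF assms]
  by (rule Bochner_Integration.integrable_bound) (auto simp: indicator_def)

lemma tail_nonneg: "0 \<le> tail n y"
  unfolding tail_def by (intro integral_nonneg_AE) auto

lemma tail_antimono:
  assumes "n \<ge> 1" "x \<le> y"
  shows "tail n y \<le> tail n x"
  unfolding tail_def
  using assms by (intro integral_mono integrable_tail) (auto simp: indicator_def)

text \<open>
  The second moment of \<open>\<xi>\<close> is one, and outside the tail \<open>\<xi>\<^sup>2\<close> is at most \<open>y\<close>. For
  \<open>y = \<epsilon> ln n/\<mu>\<close> a small tail therefore forces \<open>ln n/\<mu>\<close> to be large.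
\<close>

lemma one_le_tail_plus_cutoff:
  assumes "n \<ge> 1" "y \<ge> 0"
  shows "1 \<le> tail n y + y"
proof -
  have "1 = measure_pmf.expectation (p n) (\<lambda>m. (\<xi> n m)\<^sup>2)" using standardised_variance[OF assms(1)] by simp
  also have "\<dots> \<le> measure_pmf.expectation (p n) (\<lambda>m. (\<xi> n m)\<^sup>2 * indicator {m. (\<xi> n m)\<^sup>2 > y} m + y)"
    using assms standardised_variance integrable_tail
    by (intro integral_mono Bochner_Integration.integrable_add) (auto simp: indicator_def)
  also have "\<dots> = tail n y + y" using integrable_tail[OF assms(1), of y] by (simp add: tail_def)
  finally show ?thesis .
qed

text \<open>
  Outside the tail \<open>\<xi>\<^sup>2 \<le> sqrt y * \<bar>\<xi>\<bar>\<close>, and the first absolute moment of \<open>\<xi>\<close> is at most \<open>2 \<mu>/\<sigma>\<close>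
  because \<open>ln X\<close> is nonnegative with mean \<open>\<mu>\<close>. This is how the condition \<open>X \<ge> 1\<close> bounds
  the variance in terms of the mean.
\<close>

lemma one_le_tail_plus_sqrt_cutoff:
  assumes "n \<ge> 1" "y \<ge> 0"
  shows "1 \<le> tail n y + sqrt y * (2 * \<mu> n / \<sigma> n)"
proof -
  have \<sigma>: "\<sigma> n > 0" using \<sigma>_pos assms by simp
  have abs_le: "\<bar>\<xi> n m\<bar> \<le> (ln (real m) + \<mu> n) / \<sigma> n" for m
  proof -
    \<comment> \<open>This includes \<open>m = 0\<close>, where the logarithm has the value zero.\<close>
    have "0 \<le> ln (real m)" by (cases m) auto
    then have "\<bar>ln (real m) - \<mu> n\<bar> \<le> ln (real m) + \<mu> n" using \<mu>_pos[OF assms(1)] by (auto simp: abs_if)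
    then show ?thesis using \<sigma> by (simp add: \<xi>_def abs_divide divide_right_mono)
  qed
  have int: "integrable (p n) (\<lambda>m. (ln (real m) + \<mu> n) / \<sigma> n)"
    using integrable_ln[OF assms(1)] by simp
  have "1 = measure_pmf.expectation (p n) (\<lambda>m. (\<xi> n m)\<^sup>2)" using standardised_variance[OF assms(1)] by simp
  also have "\<dots> \<le> measure_pmf.expectation (p n)
      (\<lambda>m. (\<xi> n m)\<^sup>2 * indicator {m. (\<xi> n m)\<^sup>2 > y} m + sqrt y * ((ln (real m) + \<mu> n) / \<sigma> n))"
  proof (intro integral_mono Bochner_Integration.integrable_add integrable_mult_right)
    fix m
    show "(\<xi> n m)\<^sup>2 \<le> (\<xi> n m)\<^sup>2 * indicator {m. (\<xi> n m)\<^sup>2 > y} m + sqrt y * ((ln (real m) + \<mu> n) / \<sigma> n)"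
    proof (cases "(\<xi> n m)\<^sup>2 > y")
      case True
      have "0 \<le> sqrt y * ((ln (real m) + \<mu> n) / \<sigma> n)"
        using assms(2) abs_le[of m] by (intro mult_nonneg_nonneg) auto
      then show ?thesis using True by simp
    next
      case False
      then have "\<bar>\<xi> n m\<bar> \<le> sqrt y" by (metis not_less real_sqrt_abs real_sqrt_le_iff)
      then have "\<bar>\<xi> n m\<bar> * \<bar>\<xi> n m\<bar> \<le> sqrt y * ((ln (real m) + \<mu> n) / \<sigma> n)"
        using abs_le[of m] assms(2) by (intro mult_mono) auto
      then show ?thesis using False by (simp add: power2_eq_square)
    qed
  qed (use assms standardised_variance integrable_tail int in auto)
  also have "\<dots> = tail n y + sqrt y * (2 * \<mu> n / \<sigma> n)"
    using integrable_tail[OF assms(1), of y] int integrable_ln[OF assms(1)] expectation_ln[OF assms(1)]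
    by (simp add: tail_def)
  finally show ?thesis .
qed

lemma tail_less_half:
  assumes "\<epsilon> > 0"
  shows "\<forall>\<^sub>F n in sequentially. tail n (\<epsilon> * (ln (real n) / \<mu> n)) < 1 / 2"
  using lindeberg[OF assms] unfolding tail_def \<xi>_def by (rule order_tendstoD) simp

lemma scale_nonneg: "n \<ge> 1 \<Longrightarrow> 0 \<le> ln (real n) / \<mu> n"
  using \<mu>_pos[of n] by simp

lemma scale_at_top: "filterlim (\<lambda>n. ln (real n) / \<mu> n) at_top sequentially"
  unfolding filterlim_at_top
proof
  fix Z :: real
  define C where "C = max 1 Z"
  define \<epsilon> where "\<epsilon> = 1 / (2 * C)"
  have C: "C > 0" "Z \<le> C" by (simp_all add: C_def)
  then have \<epsilon>: "\<epsilon> > 0" by (simp add: \<epsilon>_def)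
  show "\<forall>\<^sub>F n in sequentially. Z \<le> ln (real n) / \<mu> n"
    using tail_less_half[OF \<epsilon>] eventually_ge_at_top[of 1]
  proof eventually_elim
    case (elim n)
    have "0 \<le> \<epsilon> * (ln (real n) / \<mu> n)" using \<epsilon> scale_nonneg[OF elim(2)] by (intro mult_nonneg_nonneg) auto
    from one_le_tail_plus_cutoff[OF elim(2) this] elim(1)
    have "1 / 2 \<le> \<epsilon> * (ln (real n) / \<mu> n)" by linarith
    moreover have "C \<le> y" if "1 / 2 \<le> 1 / (2 * C) * y" for y using that C(1) by (simp add: field_simps)
    ultimately have "C \<le> ln (real n) / \<mu> n" unfolding \<epsilon>_def by blast
    then show ?case using C(2) by linarith
  qed
qed

lemma variance_ratio_tendsto_0: "(\<lambda>n. (\<sigma> n)\<^sup>2 / (\<mu> n * ln (real n))) \<longlonglongrightarrow> 0"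
proof (rule tendstoI)
  fix e :: real assume e: "e > 0"
  define \<epsilon> where "\<epsilon> = e / 32"
  have \<epsilon>: "\<epsilon> > 0" using e by (simp add: \<epsilon>_def)
  show "\<forall>\<^sub>F n in sequentially. dist ((\<sigma> n)\<^sup>2 / (\<mu> n * ln (real n))) 0 < e"
    using tail_less_half[OF \<epsilon>] eventually_ge_at_top[of 2]
  proof eventually_elim
    case (elim n)
    have n1: "n \<ge> 1" and L: "ln (real n) > 0" using elim by auto
    note pos = \<mu>_pos[OF n1] \<sigma>_pos[OF n1]
    let ?y = "\<epsilon> * (ln (real n) / \<mu> n)"
    have y: "?y \<ge> 0" using \<epsilon> scale_nonneg[OF n1] by (intro mult_nonneg_nonneg) auto
    have "1 / 2 \<le> sqrt ?y * (2 * \<mu> n / \<sigma> n)"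
      using one_le_tail_plus_sqrt_cutoff[OF n1 y] elim(1) by linarith
    then have "\<sigma> n \<le> 4 * (sqrt ?y * \<mu> n)" using pos by (simp add: field_simps)
    then have "(\<sigma> n)\<^sup>2 \<le> (4 * (sqrt ?y * \<mu> n))\<^sup>2" using pos by (intro power_mono) auto
    also have "\<dots> = 16 * (?y * (\<mu> n)\<^sup>2)" using y by (simp only: power_mult_distrib real_sqrt_pow2) simp
    also have "\<dots> = 16 * \<epsilon> * (\<mu> n * ln (real n))" using pos by (simp add: power2_eq_square)
    finally have "(\<sigma> n)\<^sup>2 / (\<mu> n * ln (real n)) \<le> 16 * \<epsilon>" using pos L by (simp add: pos_divide_le_eq)
    moreover have "0 \<le> (\<sigma> n)\<^sup>2 / (\<mu> n * ln (real n))" using pos L by simp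
    moreover have "16 * \<epsilon> < e" using e by (simp add: \<epsilon>_def)
    ultimately show ?case unfolding dist_real_def by linarith
  qed
qed

abbreviation spread :: "nat \<Rightarrow> real" where
  "spread n \<equiv> sqrt ((\<sigma> n)\<^sup>2 * ln (real n) / \<mu> n)"

lemma t_at_top: "filterlim t at_top sequentially"
proof -
  have "filterlim (\<lambda>n. 3 / 2 * (ln (real n) / \<mu> n)) at_top sequentially"
    by (rule filterlim_tendsto_pos_mult_at_top[OF tendsto_const _ scale_at_top]) simp
  then show ?thesis unfolding t_eq by (simp add: mult.commute mult.left_commute)
qed

lemma b_over_t: "(\<lambda>n. b n / t n) \<longlonglongrightarrow> 0"
proof -
  have "(\<lambda>n. 1 / ln (real n)) \<longlonglongrightarrow> 0" by real_asymp
  moreover have "(\<lambda>n. sqrt ((\<sigma> n)\<^sup>2 / (\<mu> n * ln (real n)))) \<longlonglongrightarrow> sqrt 0"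
    by (intro tendsto_real_sqrt variance_ratio_tendsto_0)
  ultimately have "(\<lambda>n. 2 / 3 * (1 / ln (real n) + sqrt ((\<sigma> n)\<^sup>2 / (\<mu> n * ln (real n))))) \<longlonglongrightarrow> 2 / 3 * (0 + sqrt 0)"
    by (rule tendsto_mult_left[OF tendsto_add])
  then have lim: "(\<lambda>n. 2 / 3 * (1 / ln (real n) + sqrt ((\<sigma> n)\<^sup>2 / (\<mu> n * ln (real n))))) \<longlonglongrightarrow> 0" by simp
  have ev: "\<forall>\<^sub>F n in sequentially. 0 \<le> b n / t n \<and>
      b n / t n \<le> 2 / 3 * (1 / ln (real n) + sqrt ((\<sigma> n)\<^sup>2 / (\<mu> n * ln (real n))))"
    using eventually_ge_at_top[of 2]
  proof eventually_elim
    case (elim n)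
    have n1: "n \<ge> 1" and L: "ln (real n) > 0" using elim by auto
    note pos = \<mu>_pos[OF n1] \<sigma>_pos[OF n1]
    have "spread n / ln (real n) = sqrt ((\<sigma> n)\<^sup>2 / (\<mu> n * ln (real n)))"
    proof -
      have "(\<sigma> n)\<^sup>2 * ln (real n) / \<mu> n = (\<sigma> n)\<^sup>2 / (\<mu> n * ln (real n)) * (ln (real n))\<^sup>2"
        using pos L by (simp add: power2_eq_square)
      then show ?thesis using L by (simp only: real_sqrt_mult real_sqrt_abs) simp
    qed
    moreover have "b n / t n = 2 / 3 * (max 1 (spread n) / ln (real n))"
    proof -
      have "1 / \<mu> n * x / (3 * ln (real n) / (2 * \<mu> n)) = 2 / 3 * (x / ln (real n))" for x
        using pos L by simp
      then show ?thesis unfolding b_eq t_eq .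
    qed
    moreover have "max 1 (spread n) / ln (real n) \<le> (1 + spread n) / ln (real n)"
      using pos L by (intro divide_right_mono) auto
    moreover have "0 \<le> max 1 (spread n) / ln (real n)" using L by simp
    ultimately show ?case by (simp add: add_divide_distrib)
  qed
  show ?thesis
    by (rule tendsto_sandwich[OF _ _ tendsto_const lim]) (use ev in \<open>auto elim: eventually_mono\<close>)
qed

text \<open>
  The times asymptotic to \<open>t\<close>, expressed through the mean \<open>k \<mu>\<close> of the logarithm of the number of packs.
\<close>

definition in_window :: "(nat \<Rightarrow> nat) \<Rightarrow> bool" where
  "in_window k \<longleftrightarrow> (\<lambda>n. real (k n) * \<mu> n / ln (real n)) \<longlonglongrightarrow> 3 / 2"

lemma in_windowI:
  assumes "\<forall>\<^sub>F n in sequentially. \<bar>real (k n) - t n\<bar> \<le> C * b n + 1"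
  shows "in_window k"
proof -
  have "(\<lambda>n. C * (b n / t n) + 1 / t n) \<longlonglongrightarrow> C * 0 + 0"
    using b_over_t t_at_top
    by (intro tendsto_intros) (auto intro!: tendsto_divide_0[OF tendsto_const] filterlim_at_top_imp_at_infinity)
  then have lim: "(\<lambda>n. C * (b n / t n) + 1 / t n) \<longlonglongrightarrow> 0" by simp
  have t_pos: "\<forall>\<^sub>F n in sequentially. t n > 0" using t_at_top by (simp add: filterlim_at_top_dense)
  have "(\<lambda>n. real (k n) / t n - 1) \<longlonglongrightarrow> 0"
  proof (rule Lim_null_comparison[OF _ lim])
    show "\<forall>\<^sub>F n in sequentially. norm (real (k n) / t n - 1) \<le> C * (b n / t n) + 1 / t n"
      using assms t_pos
    proof eventually_elim
      case (elim n)
      have "\<bar>real (k n) / t n - 1\<bar> = \<bar>real (k n) - t n\<bar> / t n"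
        using elim(2) by (simp add: field_simps abs_divide[symmetric] flip: diff_divide_distrib)
      also have "\<dots> \<le> (C * b n + 1) / t n" using elim by (intro divide_right_mono) auto
      finally show ?case by (simp add: add_divide_distrib)
    qed
  qed
  then have "(\<lambda>n. 3 / 2 * ((real (k n) / t n - 1) + 1)) \<longlonglongrightarrow> 3 / 2 * (0 + 1)"
    by (intro tendsto_intros)
  moreover have "\<forall>\<^sub>F n in sequentially. 3 / 2 * ((real (k n) / t n - 1) + 1) = real (k n) * \<mu> n / ln (real n)"
    using eventually_ge_at_top[of 2]
  proof eventually_elim
    case (elim n)
    then have "\<mu> n > 0" "ln (real n) > 0" using \<mu>_pos by auto
    then show ?case by (simp add: t_eq)
  qed
  ultimately show ?thesis unfolding in_window_def by (simp add: Lim_transform_eventually)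
qed

lemma in_window_bounds:
  assumes "in_window k"
  shows "\<forall>\<^sub>F n in sequentially. ln (real n) / \<mu> n \<le> real (k n) \<and> real (k n) \<le> 4 * (ln (real n) / \<mu> n)"
proof -
  have "\<forall>\<^sub>F n in sequentially. 1 < real (k n) * \<mu> n / ln (real n)"
       "\<forall>\<^sub>F n in sequentially. real (k n) * \<mu> n / ln (real n) < 4"
    using assms unfolding in_window_def by (rule order_tendstoD, simp)+
  with eventually_ge_at_top[of 2] show ?thesis
  proof eventually_elim
    case (elim n)
    then have "\<mu> n > 0" "ln (real n) > 0" using \<mu>_pos by auto
    then show ?case using elim by (simp add: field_simps)
  qed
qed

text \<open>
  The standard deviation of \<open>ln m\<close> after \<open>k\<close> steps is \<open>sqrt (3/2)\<close> times the spread in the limit, and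
  this constant lies strictly between one and two.
\<close>

lemma in_window_spread:
  assumes "in_window k"
  shows "\<forall>\<^sub>F n in sequentially. spread n \<le> sqrt (real (k n)) * \<sigma> n \<and> sqrt (real (k n)) * \<sigma> n \<le> 2 * spread n"
  using in_window_bounds[OF assms] eventually_ge_at_top[of 1]
proof eventually_elim
  case (elim n)
  note \<sigma> = \<sigma>_pos[OF elim(2)]
  have s: "spread n = sqrt (ln (real n) / \<mu> n) * \<sigma> n"
    using \<sigma> by (simp add: real_sqrt_mult real_sqrt_divide)
  have "sqrt (ln (real n) / \<mu> n) \<le> sqrt (real (k n))" using elim(1) by simp
  moreover have "sqrt (real (k n)) \<le> sqrt (2\<^sup>2 * (ln (real n) / \<mu> n))" using elim(1) by simp
  moreover have "sqrt (2\<^sup>2 * (ln (real n) / \<mu> n)) = 2 * sqrt (ln (real n) / \<mu> n)"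
    by (simp only: real_sqrt_mult real_sqrt_abs)
  ultimately show ?case
    unfolding s using \<sigma> by (simp add: mult_right_mono mult.assoc[symmetric] del: real_sqrt_le_iff)
qed

lemma clt_in_window:
  assumes "in_window k"
  shows "(\<lambda>n. measure_pmf.prob (product_law (p n) (k n))
      {m. ln (real m) \<le> real (k n) * \<mu> n + x * (sqrt (real (k n)) * \<sigma> n)}) \<longlonglongrightarrow> \<Phi> x"
proof (rule clt_product_law)
  have "filterlim (\<lambda>n. real (k n)) at_top sequentially"
    by (rule filterlim_at_top_mono[OF scale_at_top])
       (use in_window_bounds[OF assms] in \<open>auto elim: eventually_mono\<close>)
  then show "filterlim k at_top sequentially"
    unfolding filterlim_at_top by (metis (mono_tags, lifting) eventually_mono of_nat_le_iff)
  show "(\<lambda>n. measure_pmf.expectation (p n) (\<lambda>m. ((ln (real m) - \<mu> n) / \<sigma> n)\<^sup>2 *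
      indicator {m. ((ln (real m) - \<mu> n) / \<sigma> n)\<^sup>2 > \<epsilon> * real (k n)} m)) \<longlonglongrightarrow> 0" if \<epsilon>: "\<epsilon> > 0" for \<epsilon>
  proof -
    have "(\<lambda>n. tail n (\<epsilon> * real (k n))) \<longlonglongrightarrow> 0"
    proof (rule tendsto_sandwich[OF _ _ tendsto_const])
      show "(\<lambda>n. tail n (\<epsilon> * (ln (real n) / \<mu> n))) \<longlonglongrightarrow> 0"
        using lindeberg[OF \<epsilon>] unfolding tail_def \<xi>_def .
      show "\<forall>\<^sub>F n in sequentially. tail n (\<epsilon> * real (k n)) \<le> tail n (\<epsilon> * (ln (real n) / \<mu> n))"
        using in_window_bounds[OF assms] eventually_ge_at_top[of 1]
        by eventually_elim (use \<epsilon> in \<open>intro tail_antimono mult_left_mono, auto\<close>)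
    qed (simp add: tail_nonneg)
    then show ?thesis unfolding tail_def \<xi>_def .
  qed
qed (use support standardised_mean[unfolded \<xi>_def[abs_def]] standardised_variance[unfolded \<xi>_def]
    \<sigma>_pos in blast)+

abbreviation tv :: "nat \<Rightarrow> nat \<Rightarrow> real" where
  "tv n k \<equiv> tv_dist (convolution_power (p_shuffle n (p n)) k) (uniform_arrangement n)"

lemma eventually_large:
  assumes "a > 0"
  shows "\<forall>\<^sub>F n in sequentially. 2 * real n \<le> a * (real n * sqrt (real n))"
  using assms by real_asymp

text \<open>
  With limiting probability at least \<open>1 - \<Phi> x\<close> the number of packs exceeds \<open>a * n powr (3/2)\<close>.
\<close>

lemma limsup_tv_le:
  assumes k: "in_window k" and a: "a > 0" and B: "B \<ge> 1"
    and late: "\<forall>\<^sub>F n in sequentially.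
      3 / 2 * ln (real n) + ln a \<le> real (k n) * \<mu> n + x * (sqrt (real (k n)) * \<sigma> n)"
  shows "limsup (\<lambda>n. ereal (tv n (k n))) \<le>
    ereal (1 - (1 - 1 / B\<^sup>2) * exp (- (B / a + 2 / a\<^sup>2)) * (1 - \<Phi> x))"
proof -
  define \<eta> where "\<eta> = (1 - 1 / B\<^sup>2) * exp (- (B / a + 2 / a\<^sup>2))"
  have "1 \<le> B\<^sup>2" using B by simp
  then have "1 / B\<^sup>2 \<le> 1" using B by (simp add: divide_le_eq)
  then have \<eta>: "\<eta> \<ge> 0" unfolding \<eta>_def by (intro mult_nonneg_nonneg) auto
  let ?P = "\<lambda>n. measure_pmf.prob (product_law (p n) (k n))"
  let ?E = "\<lambda>n. {m. ln (real m) \<le> real (k n) * \<mu> n + x * (sqrt (real (k n)) * \<sigma> n)}"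
  have "(\<lambda>n. ereal (1 - \<eta> * (1 - ?P n (?E n)))) \<longlonglongrightarrow> ereal (1 - \<eta> * (1 - \<Phi> x))"
    unfolding lim_ereal by (intro tendsto_intros clt_in_window k)
  then have limit: "limsup (\<lambda>n. ereal (1 - \<eta> * (1 - ?P n (?E n)))) = ereal (1 - \<eta> * (1 - \<Phi> x))"
    by (intro lim_imp_Limsup) auto
  have "\<forall>\<^sub>F n in sequentially. ereal (tv n (k n)) \<le> ereal (1 - \<eta> * (1 - ?P n (?E n)))"
    using late eventually_large[OF a] eventually_ge_at_top[of 1]
  proof eventually_elim
    case (elim n)
    have "1 - ?P n (?E n) = ?P n (- ?E n)" by (simp add: prob_pmf_Compl)
    also have "\<dots> \<le> ?P n {m. ln (real m) > 3 / 2 * ln (real n) + ln a}"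
      using elim(1) by (intro measure_pmf.finite_measure_mono) auto
    finally have "\<eta> * (1 - ?P n (?E n)) \<le> \<eta> * ?P n {m. ln (real m) > 3 / 2 * ln (real n) + ln a}"
      using \<eta> by (intro mult_left_mono)
    moreover have "tv n (k n) \<le> 1 - \<eta> * ?P n {m. ln (real m) > 3 / 2 * ln (real n) + ln a}"
      unfolding \<eta>_def using elim a B support by (intro tv_p_shuffle_le) auto
    ultimately show ?case by simp
  qed
  then have "limsup (\<lambda>n. ereal (tv n (k n))) \<le> limsup (\<lambda>n. ereal (1 - \<eta> * (1 - ?P n (?E n))))"
    by (rule Limsup_mono)
  also note limit
  finally show ?thesis unfolding \<eta>_def .
qed

text \<open>
  With limiting probability at least \<open>\<Phi> x\<close> the number of packs is at most \<open>a * n powr (3/2)\<close>. The number \<open>u\<close>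
  bounds from below the uniform probability that there are not few rising sequences.
\<close>

lemma liminf_tv_ge:
  assumes k: "in_window k" and a: "a > 0" and B: "B \<ge> 0" and u: "u \<ge> 0"
    and h: "exp (2 * B / a - 1 / (96 * a\<^sup>2)) \<le> 1"
    and spread: "\<forall>\<^sub>F n in sequentially. measure_pmf.prob (uniform_arrangement n)
      {\<sigma>. real (rising_sequences n \<sigma>) < (real n + 1) / 2 - B * sqrt (real n)} \<le> 1 - u"
    and early: "\<forall>\<^sub>F n in sequentially.
      real (k n) * \<mu> n + x * (sqrt (real (k n)) * \<sigma> n) \<le> 3 / 2 * ln (real n) + ln a"
  shows "ereal ((1 - exp (2 * B / a - 1 / (96 * a\<^sup>2))) * u * \<Phi> x) \<le> liminf (\<lambda>n. ereal (tv n (k n)))"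
proof -
  define \<eta> where "\<eta> = (1 - exp (2 * B / a - 1 / (96 * a\<^sup>2))) * u"
  have \<eta>: "\<eta> \<ge> 0" unfolding \<eta>_def using h u by (intro mult_nonneg_nonneg) auto
  let ?P = "\<lambda>n. measure_pmf.prob (product_law (p n) (k n))"
  let ?E = "\<lambda>n. {m. ln (real m) \<le> real (k n) * \<mu> n + x * (sqrt (real (k n)) * \<sigma> n)}"
  have "(\<lambda>n. ereal (\<eta> * ?P n (?E n))) \<longlonglongrightarrow> ereal (\<eta> * \<Phi> x)"
    unfolding lim_ereal by (intro tendsto_intros clt_in_window k)
  then have "ereal (\<eta> * \<Phi> x) = liminf (\<lambda>n. ereal (\<eta> * ?P n (?E n)))"
    by (intro lim_imp_Liminf[symmetric]) auto
  also have "\<dots> \<le> liminf (\<lambda>n. ereal (tv n (k n)))"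
  proof (rule Liminf_mono)
    show "\<forall>\<^sub>F n in sequentially. ereal (\<eta> * ?P n (?E n)) \<le> ereal (tv n (k n))"
      using early spread eventually_large[OF a] eventually_ge_at_top[of 2]
    proof eventually_elim
      case (elim n)
      have "?P n (?E n) \<le> ?P n {m. ln (real m) \<le> 3 / 2 * ln (real n) + ln a}"
        using elim(1) by (intro measure_pmf.finite_measure_mono) auto
      then have "\<eta> * ?P n (?E n) \<le> \<eta> * ?P n {m. ln (real m) \<le> 3 / 2 * ln (real n) + ln a}"
        using \<eta> by (intro mult_left_mono)
      also have "\<dots> \<le> tv n (k n)"
        unfolding \<eta>_def using elim a B h support[of n] by (intro tv_p_shuffle_ge) auto
      finally show ?case by simp
    qed
  qed
  finally show ?thesis unfolding \<eta>_def .
qed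


lemma t_times_\<mu>: "n \<ge> 1 \<Longrightarrow> t n * \<mu> n = 3 / 2 * ln (real n)"
  using \<mu>_pos[of n] by (simp add: t_eq)

lemma b_times_\<mu>: "n \<ge> 1 \<Longrightarrow> b n * \<mu> n = max 1 (spread n)"
  using \<mu>_pos[of n] by (simp add: b_eq)

lemma t_nonneg: "n \<ge> 1 \<Longrightarrow> 0 \<le> t n"
  using \<mu>_pos[of n] by (simp add: t_eq)

lemma b_pos: "n \<ge> 1 \<Longrightarrow> 0 < b n"
  using \<mu>_pos[of n] by (simp add: b_eq)

lemma eventually_t_pos: "\<forall>\<^sub>F n in sequentially. t n > 0"
  using t_at_top by (simp add: filterlim_at_top_dense)

lemma cutoff_time_bounds_pos:
  assumes "c > 0" "n \<ge> 1"
  shows "t n + c * b n \<le> real (cutoff_time t b c n)" "real (cutoff_time t b c n) \<le> t n + c * b n + 1"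
proof -
  have "0 \<le> t n + c * b n" using assms t_nonneg b_pos[of n] by simp
  then have "real (cutoff_time t b c n) = real_of_int \<lceil>t n + c * b n\<rceil>"
    using assms(1) by (simp add: cutoff_time_def)
  then show "t n + c * b n \<le> real (cutoff_time t b c n)" "real (cutoff_time t b c n) \<le> t n + c * b n + 1"
    by linarith+
qed

lemma cutoff_time_bounds_neg:
  assumes "c < 0"
  shows "\<forall>\<^sub>F n in sequentially. t n + c * b n - 1 \<le> real (cutoff_time t b c n) \<and>
    real (cutoff_time t b c n) \<le> t n + c * b n"
proof -
  have "\<forall>\<^sub>F n in sequentially. b n / t n < 1 / (- c)"
    using b_over_t assms by (intro order_tendstoD) auto
  with eventually_t_pos show ?thesis
  proof eventually_elim
    case (elim n)
    then have "b n * (- c) < t n" using assms by (simp add: field_simps)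
    then have "0 \<le> t n + c * b n" by (simp add: mult.commute)
    then have "real (cutoff_time t b c n) = real_of_int \<lfloor>t n + c * b n\<rfloor>"
      using assms by (simp add: cutoff_time_def)
    then show ?case by linarith
  qed
qed

lemma in_window_cutoff_time:
  assumes "c \<noteq> 0"
  shows "in_window (cutoff_time t b c)"
proof (rule in_windowI)
  show "\<forall>\<^sub>F n in sequentially. \<bar>real (cutoff_time t b c n) - t n\<bar> \<le> \<bar>c\<bar> * b n + 1"
  proof (cases "c > 0")
    case True
    show ?thesis
      using eventually_ge_at_top[of 1]
    proof eventually_elim
      case (elim n)
      have "0 \<le> c * b n" using True b_pos[OF elim] by simp
      then show ?case using cutoff_time_bounds_pos[OF True elim] True by (simp add: abs_le_iff)
    qed
  next
    case False
    then have c: "c < 0" using assms by simp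
    show ?thesis
      using cutoff_time_bounds_neg[OF c] eventually_ge_at_top[of 1]
    proof eventually_elim
      case (elim n)
      have "c * b n \<le> 0" using c b_pos[OF elim(2)] by (simp add: mult_nonpos_nonneg)
      then show ?case using elim(1) c by (simp add: abs_le_iff)
    qed
  qed
qed

text \<open>
  The surplus \<open>c * max 1 (spread n)\<close> of the mean of \<open>ln m\<close> over \<open>3/2 ln n\<close> is divided evenly: one half
  absorbs a fluctuation of \<open>c/4\<close> standard deviations (each at most twice the spread),
  the other half makes \<open>a = exp (c/2)\<close> large.
  The choice \<open>B = exp (c/4)\<close> tends to infinity while \<open>B/a\<close> tends to zero.
\<close>

lemma upper_profile_le:
  assumes c: "c > 0"
  shows "upper_profile (\<lambda>n. p_shuffle n (p n)) t b c \<le>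
    ereal (1 - (1 - 1 / (exp (c / 4))\<^sup>2) * exp (- (exp (c / 4) / exp (c / 2) + 2 / (exp (c / 2))\<^sup>2)) *
      (1 - \<Phi> (- (c / 4))))"
  unfolding upper_profile_def
proof (rule limsup_tv_le)
  show window: "in_window (cutoff_time t b c)" using c by (intro in_window_cutoff_time) simp
  show "\<forall>\<^sub>F n in sequentially. 3 / 2 * ln (real n) + ln (exp (c / 2)) \<le>
      real (cutoff_time t b c n) * \<mu> n + - (c / 4) * (sqrt (real (cutoff_time t b c n)) * \<sigma> n)"
    using in_window_spread[OF window] eventually_ge_at_top[of 1]
  proof eventually_elim
    case (elim n)
    let ?k = "cutoff_time t b c n"
    define y where "y = sqrt (real ?k) * \<sigma> n"
    have "(t n + c * b n) * \<mu> n \<le> real ?k * \<mu> n"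
      using cutoff_time_bounds_pos(1)[OF c elim(2)] \<mu>_pos[OF elim(2)] by (intro mult_right_mono) auto
    moreover have "(t n + c * b n) * \<mu> n = t n * \<mu> n + c * (b n * \<mu> n)" by (simp add: algebra_simps)
    moreover have "c / 4 * y \<le> c / 4 * (2 * max 1 (spread n))"
      using elim(1) c by (intro mult_left_mono) (auto simp: y_def)
    moreover have "c * 1 \<le> c * max 1 (spread n)" using c by (intro mult_left_mono) auto
    ultimately show ?case
      unfolding t_times_\<mu>[OF elim(2)] b_times_\<mu>[OF elim(2)] y_def[symmetric] by simp
  qed
qed (use c in auto)

text \<open>
  The deficit is divided as the surplus in the previous lemma. Here \<open>a = exp (c/2)\<close> is small, and
  with \<open>B = exp (- c/4)\<close> the term \<open>2 B/a\<close> is negligible against \<open>1/a\<^sup>2\<close>.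
\<close>

lemma lower_profile_ge:
  assumes c: "c < 0"
    and h: "exp (2 * exp (- c / 4) / exp (c / 2) - 1 / (96 * (exp (c / 2))\<^sup>2)) \<le> 1"
  shows "ereal ((1 - exp (2 * exp (- c / 4) / exp (c / 2) - 1 / (96 * (exp (c / 2))\<^sup>2))) *
      (1 - 1 / (exp (- c / 4))\<^sup>2) * \<Phi> (- (c / 4))) \<le>
    lower_profile (\<lambda>n. p_shuffle n (p n)) t b c"
  unfolding lower_profile_def
proof (rule liminf_tv_ge[OF _ _ _ _ h])
  show window: "in_window (cutoff_time t b c)" using c by (intro in_window_cutoff_time) simp
  show "\<forall>\<^sub>F n in sequentially. real (cutoff_time t b c n) * \<mu> n +
      - (c / 4) * (sqrt (real (cutoff_time t b c n)) * \<sigma> n) \<le> 3 / 2 * ln (real n) + ln (exp (c / 2))"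
    using in_window_spread[OF window] eventually_ge_at_top[of 1] cutoff_time_bounds_neg[OF c]
  proof eventually_elim
    case (elim n)
    let ?k = "cutoff_time t b c n"
    define y where "y = sqrt (real ?k) * \<sigma> n"
    have "real ?k * \<mu> n \<le> (t n + c * b n) * \<mu> n"
      using elim(3) \<mu>_pos[OF elim(2)] by (intro mult_right_mono) auto
    moreover have "(t n + c * b n) * \<mu> n = t n * \<mu> n + c * (b n * \<mu> n)" by (simp add: algebra_simps)
    moreover have "- c / 4 * y \<le> - c / 4 * (2 * max 1 (spread n))"
      using elim(1) c by (intro mult_left_mono) (auto simp: y_def)
    moreover have "c * max 1 (spread n) \<le> c * 1" using c by (intro mult_left_mono_neg) auto
    ultimately show ?case
      unfolding t_times_\<mu>[OF elim(2)] b_times_\<mu>[OF elim(2)] y_def[symmetric] by simp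
  qed
  show "\<forall>\<^sub>F n in sequentially. measure_pmf.prob (uniform_arrangement n)
      {\<sigma>. real (rising_sequences n \<sigma>) < (real n + 1) / 2 - exp (- c / 4) * sqrt (real n)} \<le>
      1 - (1 - 1 / (exp (- c / 4))\<^sup>2)"
    using eventually_ge_at_top[of 1]
  proof eventually_elim
    case (elim n)
    have "measure_pmf.prob (uniform_arrangement n)
        {\<sigma>. real (rising_sequences n \<sigma>) < (real n + 1) / 2 - exp (- c / 4) * sqrt (real n)} \<le>
      measure_pmf.prob (uniform_arrangement n)
        {\<sigma>. \<bar>real (rising_sequences n \<sigma>) - (real n + 1) / 2\<bar> \<ge> exp (- c / 4) * sqrt (real n)}"
      by (intro measure_pmf.finite_measure_mono) auto
    then show ?case using uniform_rising_sequences_concentrated[OF elim, of "exp (- c / 4)"] by simp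
  qed
  have "1 \<le> exp (- c / 4)" using c by simp
  then have "1 \<le> (exp (- c / 4))\<^sup>2" by (rule one_le_power)
  then show "0 \<le> 1 - 1 / (exp (- c / 4))\<^sup>2" by (simp add: divide_le_eq)
qed auto

lemma upper_profile_nonneg: "0 \<le> upper_profile (\<lambda>n. p_shuffle n (p n)) t b c"
  unfolding upper_profile_def by (intro le_Limsup) (auto intro!: always_eventually tv_dist_nonneg)

lemma lower_profile_le_1: "lower_profile (\<lambda>n. p_shuffle n (p n)) t b c \<le> 1"
  unfolding lower_profile_def by (intro Liminf_le) (auto intro!: always_eventually tv_dist_le_1)

lemma upper_profile_tendsto_0: "(upper_profile (\<lambda>n. p_shuffle n (p n)) t b \<longlongrightarrow> 0) at_top"
proof (rule tendsto_sandwich[OF _ _ tendsto_const])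
  let ?g = "\<lambda>c. 1 - (1 - 1 / (exp (c / 4))\<^sup>2) * exp (- (exp (c / 4) / exp (c / 2) + 2 / (exp (c / 2))\<^sup>2)) *
      (1 - \<Phi> (- (c / 4)))"
  interpret N: real_distribution std_normal_distribution by (rule real_dist_normal_dist)
  have "((\<lambda>c. 1 - 1 / (exp (c / 4))\<^sup>2) \<longlongrightarrow> (1 :: real)) at_top" by real_asymp
  moreover have "((\<lambda>c. exp (- (exp (c / 4) / exp (c / 2) + 2 / (exp (c / 2))\<^sup>2))) \<longlongrightarrow> (1 :: real)) at_top"
    by real_asymp
  moreover have "((\<lambda>c. \<Phi> (- (c / 4))) \<longlongrightarrow> 0) at_top"
  proof (rule filterlim_compose[OF N.cdf_lim_at_bot])
    show "filterlim (\<lambda>c. - (c / 4) :: real) at_bot at_top" by real_asymp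
  qed
  ultimately have "(?g \<longlongrightarrow> 1 - 1 * 1 * (1 - 0)) at_top"
    by (intro tendsto_diff tendsto_mult tendsto_const)
  then have "(?g \<longlongrightarrow> 0) at_top" by simp
  then show "((\<lambda>c. ereal (?g c)) \<longlongrightarrow> 0) at_top" unfolding zero_ereal_def lim_ereal .
  show "\<forall>\<^sub>F c in at_top. upper_profile (\<lambda>n. p_shuffle n (p n)) t b c \<le> ereal (?g c)"
    using eventually_gt_at_top[of 0] by eventually_elim (rule upper_profile_le)
qed (use upper_profile_nonneg in auto)

lemma lower_profile_tendsto_1: "(lower_profile (\<lambda>n. p_shuffle n (p n)) t b \<longlongrightarrow> 1) at_bot"
proof (rule tendsto_sandwich[OF _ _ _ tendsto_const])
  let ?h = "\<lambda>c. exp (2 * exp (- c / 4) / exp (c / 2) - 1 / (96 * (exp (c / 2))\<^sup>2)) :: real"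
  let ?g = "\<lambda>c. (1 - ?h c) * (1 - 1 / (exp (- c / 4))\<^sup>2) * \<Phi> (- (c / 4))"
  interpret N: real_distribution std_normal_distribution by (rule real_dist_normal_dist)
  have h: "(?h \<longlongrightarrow> 0) at_bot" by real_asymp
  moreover have "((\<lambda>c. 1 - 1 / (exp (- c / 4))\<^sup>2) \<longlongrightarrow> (1 :: real)) at_bot" by real_asymp
  moreover have "((\<lambda>c. \<Phi> (- (c / 4))) \<longlongrightarrow> 1) at_bot"
  proof (rule filterlim_compose[OF N.cdf_lim_at_top_prob])
    show "filterlim (\<lambda>c. - (c / 4) :: real) at_top at_bot" by real_asymp
  qed
  ultimately have "(?g \<longlongrightarrow> (1 - 0) * 1 * 1) at_bot"
    by (intro tendsto_diff tendsto_mult tendsto_const)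
  then have "(?g \<longlongrightarrow> 1) at_bot" by simp
  then show "((\<lambda>c. ereal (?g c)) \<longlongrightarrow> 1) at_bot" unfolding one_ereal_def lim_ereal .
  have "\<forall>\<^sub>F c in at_bot. ?h c < 1" using h by (rule order_tendstoD) simp
  then show "\<forall>\<^sub>F c in at_bot. ereal (?g c) \<le> lower_profile (\<lambda>n. p_shuffle n (p n)) t b c"
    using eventually_gt_at_bot[of 0] by eventually_elim (rule lower_profile_ge, auto)
qed (use lower_profile_le_1 in auto)

lemma cutoff: "tv_cutoff (\<lambda>n. p_shuffle n (p n)) t b"
  unfolding tv_cutoff_def
  using eventually_t_pos b_over_t upper_profile_tendsto_0 lower_profile_tendsto_1 by blast

text \<open>
  Rounding adds less than one step, hence at most \<open>\<mu>\<close> to the mean of \<open>ln m\<close>, and \<open>\<mu> \<le> b \<mu>/\<delta>\<close>. So the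
  mean is at most \<open>3/2 ln n + K * max 1 (spread n)\<close>. Falling short of it by \<open>K\<close> standard deviations brings
  \<open>ln m\<close> below \<open>3/2 ln n + K\<close>, whichever of the two terms of the maximum is the larger one. The test event is
  the lower half of the number of rising sequences (\<open>B = 0\<close>): for an arbitrary \<open>a\<close> the density is
  below one on the upper half, but in general not further down.
\<close>

lemma lower_profile_pos:
  assumes c: "c > 0" and \<delta>: "\<delta> > 0" "\<And>n. n \<ge> 1 \<Longrightarrow> b n \<ge> \<delta>"
  shows "lower_profile (\<lambda>n. p_shuffle n (p n)) t b c > 0"
proof -
  define K where "K = c + 1 / \<delta>"
  define a where "a = exp K"
  have K: "K > 0" using c \<delta> by (simp add: K_def add_pos_pos)
  have "ereal ((1 - exp (2 * 0 / a - 1 / (96 * a\<^sup>2))) * (1 / 2) * \<Phi> (- K)) \<le>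
      liminf (\<lambda>n. ereal (tv n (cutoff_time t b c n)))"
  proof (rule liminf_tv_ge)
    show window: "in_window (cutoff_time t b c)" using c by (intro in_window_cutoff_time) simp
    show "\<forall>\<^sub>F n in sequentially. measure_pmf.prob (uniform_arrangement n)
        {\<sigma>. real (rising_sequences n \<sigma>) < (real n + 1) / 2 - 0 * sqrt (real n)} \<le> 1 - 1 / 2"
      using eventually_ge_at_top[of 1] by eventually_elim (use uniform_rising_sequences_median in simp)
    show "\<forall>\<^sub>F n in sequentially. real (cutoff_time t b c n) * \<mu> n +
        - K * (sqrt (real (cutoff_time t b c n)) * \<sigma> n) \<le> 3 / 2 * ln (real n) + ln a"
      using in_window_spread[OF window] eventually_ge_at_top[of 1]
    proof eventually_elim
      case (elim n)
      let ?k = "cutoff_time t b c n"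
      define y where "y = sqrt (real ?k) * \<sigma> n"
      note \<mu> = \<mu>_pos[OF elim(2)]
      have "real ?k * \<mu> n \<le> (t n + c * b n + 1) * \<mu> n"
        using cutoff_time_bounds_pos(2)[OF c elim(2)] \<mu> by (intro mult_right_mono) auto
      also have "\<dots> \<le> (t n + c * b n + b n / \<delta>) * \<mu> n"
        using \<delta>(1) \<delta>(2)[OF elim(2)] \<mu> by (intro mult_right_mono) (auto simp: le_divide_eq)
      also have "\<dots> = t n * \<mu> n + K * (b n * \<mu> n)" by (simp add: K_def algebra_simps)
      finally have "real ?k * \<mu> n \<le> t n * \<mu> n + K * (b n * \<mu> n)" .
      moreover have "K * spread n \<le> K * y"
        using elim(1) K by (intro mult_left_mono) (auto simp: y_def)
      moreover have "K * max 1 (spread n) \<le> K * (1 + spread n)"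
        using K \<mu> elim(2) by (intro mult_left_mono) auto
      ultimately show ?case
        unfolding t_times_\<mu>[OF elim(2)] b_times_\<mu>[OF elim(2)] y_def[symmetric] by (simp add: a_def distrib_left)
    qed
  qed (auto simp: a_def)
  moreover have "0 < (1 - exp (2 * 0 / a - 1 / (96 * a\<^sup>2))) * (1 / 2) * \<Phi> (- K)"
    using Phi_pos by (intro mult_pos_pos) (auto simp: a_def)
  then have "0 < ereal ((1 - exp (2 * 0 / a - 1 / (96 * a\<^sup>2))) * (1 / 2) * \<Phi> (- K))"
    by (simp only: ereal_less(2))
  ultimately show ?thesis
    unfolding lower_profile_def by (simp only: less_le_trans)
qed

text \<open>
  The reasoning of the previous lemma with the inequalities reversed. The choice \<open>B = 2\<close> is arbitrary
  among the numbers greater than one.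
\<close>

lemma upper_profile_less_1:
  assumes c: "c > 0" and \<delta>: "\<delta> > 0" "\<And>n. n \<ge> 1 \<Longrightarrow> b n \<ge> \<delta>"
  shows "upper_profile (\<lambda>n. p_shuffle n (p n)) t b (- c) < 1"
proof -
  define K where "K = c + 1 / \<delta>"
  define a where "a = exp (- K)"
  have K: "K > 0" using c \<delta> by (simp add: K_def add_pos_pos)
  have "limsup (\<lambda>n. ereal (tv n (cutoff_time t b (- c) n))) \<le>
      ereal (1 - (1 - 1 / 2\<^sup>2) * exp (- (2 / a + 2 / a\<^sup>2)) * (1 - \<Phi> K))"
  proof (rule limsup_tv_le)
    show window: "in_window (cutoff_time t b (- c))" using c by (intro in_window_cutoff_time) simp
    have "- c < 0" using c by simp
    from in_window_spread[OF window] eventually_ge_at_top[of 1] cutoff_time_bounds_neg[OF this]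
    show "\<forall>\<^sub>F n in sequentially. 3 / 2 * ln (real n) + ln a \<le>
        real (cutoff_time t b (- c) n) * \<mu> n + K * (sqrt (real (cutoff_time t b (- c) n)) * \<sigma> n)"
    proof eventually_elim
      case (elim n)
      let ?k = "cutoff_time t b (- c) n"
      define y where "y = sqrt (real ?k) * \<sigma> n"
      note \<mu> = \<mu>_pos[OF elim(2)]
      have "t n * \<mu> n - K * (b n * \<mu> n) = (t n + - c * b n - b n / \<delta>) * \<mu> n"
        by (simp add: K_def algebra_simps)
      also have "\<dots> \<le> (t n + - c * b n - 1) * \<mu> n"
        using \<delta>(1) \<delta>(2)[OF elim(2)] \<mu> by (intro mult_right_mono) (auto simp: le_divide_eq)
      also have "\<dots> \<le> real ?k * \<mu> n"
        using elim(3) \<mu> by (intro mult_right_mono) auto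
      finally have "t n * \<mu> n - K * (b n * \<mu> n) \<le> real ?k * \<mu> n" .
      moreover have "K * spread n \<le> K * y"
        using elim(1) K by (intro mult_left_mono) (auto simp: y_def)
      moreover have "K * max 1 (spread n) \<le> K * (1 + spread n)"
        using K \<mu> elim(2) by (intro mult_left_mono) auto
      ultimately show ?case
        unfolding t_times_\<mu>[OF elim(2)] b_times_\<mu>[OF elim(2)] y_def[symmetric] by (simp add: a_def distrib_left)
    qed
  qed (auto simp: a_def)
  moreover have "0 < (1 - 1 / 2\<^sup>2) * exp (- (2 / a + 2 / a\<^sup>2)) * (1 - \<Phi> K)"
    using Phi_less_1[of K] by (intro mult_pos_pos) auto
  then have "ereal (1 - (1 - 1 / 2\<^sup>2) * exp (- (2 / a + 2 / a\<^sup>2)) * (1 - \<Phi> K)) < 1"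
    by (simp only: less_ereal.simps(1) one_ereal_def)
  ultimately show ?thesis
    unfolding upper_profile_def by (rule le_less_trans)
qed

lemma optimal_cutoff:
  assumes "\<delta> > 0" "\<And>n. n \<ge> 1 \<Longrightarrow> b n \<ge> \<delta>"
  shows "optimal_tv_cutoff (\<lambda>n. p_shuffle n (p n)) t b"
  unfolding optimal_tv_cutoff_def
  using cutoff lower_profile_pos upper_profile_less_1 assms by blast

end

theorem theorem3p3:
  fixes p :: "nat \<Rightarrow> nat pmf"
    and M :: "nat \<Rightarrow> 'a measure" and X :: "nat \<Rightarrow> 'a \<Rightarrow> nat"
    and \<mu> \<sigma> t b :: "nat \<Rightarrow> real" and \<xi> :: "nat \<Rightarrow> 'a \<Rightarrow> real"
  assumes p_pos: "\<And>n. n \<ge> 1 \<Longrightarrow> set_pmf (p n) \<subseteq> {1..}"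
    and p_nontrivial: "\<And>n. n \<ge> 1 \<Longrightarrow> \<not> (\<exists>m. set_pmf (p n) \<subseteq> {m})"
    and M_prob: "\<And>n. n \<ge> 1 \<Longrightarrow> prob_space (M n)"
    and X_rv: "\<And>n. n \<ge> 1 \<Longrightarrow> X n \<in> M n \<rightarrow>\<^sub>M count_space UNIV"
    and X_distr: "\<And>n. n \<ge> 1 \<Longrightarrow> distr (M n) (count_space UNIV) (X n) = measure_pmf (p n)"
    and \<mu>_def: "\<And>n. \<mu> n = prob_space.expectation (M n) (\<lambda>\<omega>. ln (real (X n \<omega>)))"
    and \<sigma>_def: "\<And>n. \<sigma> n = sqrt (prob_space.variance (M n) (\<lambda>\<omega>. ln (real (X n \<omega>))))"
    and \<xi>_def: "\<And>n \<omega>. \<xi> n \<omega> = (ln (real (X n \<omega>)) - \<mu> n) / \<sigma> n"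
    and \<mu>_finite: "\<And>n. n \<ge> 1 \<Longrightarrow> integrable (M n) (\<lambda>\<omega>. ln (real (X n \<omega>)))"
    and \<sigma>_finite: "\<And>n. n \<ge> 1 \<Longrightarrow> integrable (M n) (\<lambda>\<omega>. (ln (real (X n \<omega>)))\<^sup>2)"
    and \<mu>_pos: "\<And>n. n \<ge> 1 \<Longrightarrow> 0 < \<mu> n"
    and \<sigma>_pos: "\<And>n. n \<ge> 1 \<Longrightarrow> 0 < \<sigma> n"
    and t_def: "\<And>n. t n = 3 * ln (real n) / (2 * \<mu> n)"
    and b_def: "\<And>n. b n = 1 / \<mu> n * max 1 (sqrt ((\<sigma> n)\<^sup>2 * ln (real n) / \<mu> n))"
    and lindeberg: "\<And>\<epsilon>. \<epsilon> > 0 \<Longrightarrow>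
      (\<lambda>n. prob_space.expectation (M n)
         (\<lambda>\<omega>. (\<xi> n \<omega>)\<^sup>2 * indicator {\<omega>. (\<xi> n \<omega>)\<^sup>2 > \<epsilon> * inverse (\<mu> n) * ln (real n)} \<omega>))
      \<longlonglongrightarrow> 0"
  shows "tv_cutoff (\<lambda>n. p_shuffle n (p n)) t b \<and>
    ((\<exists>\<delta>>0. \<forall>n\<ge>1. b n \<ge> \<delta>) \<longrightarrow> optimal_tv_cutoff (\<lambda>n. p_shuffle n (p n)) t b)"
proof -
  have transfer: "prob_space.expectation (M n) (\<lambda>\<omega>. g (X n \<omega>)) = measure_pmf.expectation (p n) g"
    "integrable (M n) (\<lambda>\<omega>. g (X n \<omega>)) \<longleftrightarrow> integrable (p n) g"
    if "n \<ge> 1" for n and g :: "nat \<Rightarrow> real"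
    unfolding X_distr[OF that, symmetric]
    by (auto simp: integral_distr[OF X_rv[OF that]] integrable_distr_eq[OF X_rv[OF that]])
  interpret lindeberg_shuffles p \<mu> \<sigma> t b
  proof
    fix n :: nat assume n: "n \<ge> 1"
    show "set_pmf (p n) \<subseteq> {1..}" by (rule p_pos[OF n])
    show "integrable (p n) (\<lambda>m. ln (real m))" using \<mu>_finite[OF n] transfer(2)[OF n, of "\<lambda>m. ln (real m)"] by simp
    show mean: "measure_pmf.expectation (p n) (\<lambda>m. ln (real m)) = \<mu> n"
      using transfer(1)[OF n, of "\<lambda>m. ln (real m)"] by (simp add: \<mu>_def)
    show "integrable (p n) (\<lambda>m. (ln (real m))\<^sup>2)"
      using \<sigma>_finite[OF n] transfer(2)[OF n, of "\<lambda>m. (ln (real m))\<^sup>2"] by simp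
    have "prob_space.variance (M n) (\<lambda>\<omega>. ln (real (X n \<omega>))) =
        measure_pmf.expectation (p n) (\<lambda>m. (ln (real m) - \<mu> n)\<^sup>2)"
      using transfer(1)[OF n, of "\<lambda>m. (ln (real m) - \<mu> n)\<^sup>2"] by (simp add: \<mu>_def)
    moreover have "0 \<le> measure_pmf.expectation (p n) (\<lambda>m. (ln (real m) - \<mu> n)\<^sup>2)" by simp
    ultimately show "measure_pmf.expectation (p n) (\<lambda>m. (ln (real m) - \<mu> n)\<^sup>2) = (\<sigma> n)\<^sup>2"
      by (simp add: \<sigma>_def)
    show "0 < \<mu> n" "0 < \<sigma> n" by (rule \<mu>_pos[OF n], rule \<sigma>_pos[OF n])
  next
    fix n
    show "t n = 3 * ln (real n) / (2 * \<mu> n)" by (rule t_def)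
    show "b n = 1 / \<mu> n * max 1 (sqrt ((\<sigma> n)\<^sup>2 * ln (real n) / \<mu> n))" by (rule b_def)
  next
    fix \<epsilon> :: real assume "\<epsilon> > 0"
    let ?\<zeta> = "\<lambda>n m. (ln (real m) - \<mu> n) / \<sigma> n"
    let ?f = "\<lambda>n m. (?\<zeta> n m)\<^sup>2 * indicator {m. (?\<zeta> n m)\<^sup>2 > \<epsilon> * (ln (real n) / \<mu> n)} m"
    have "\<forall>\<^sub>F n in sequentially. prob_space.expectation (M n)
         (\<lambda>\<omega>. (\<xi> n \<omega>)\<^sup>2 * indicator {\<omega>. (\<xi> n \<omega>)\<^sup>2 > \<epsilon> * inverse (\<mu> n) * ln (real n)} \<omega>) =
        measure_pmf.expectation (p n) (?f n)"
      using eventually_ge_at_top[of 1]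
    proof eventually_elim
      case (elim n)
      have "(\<xi> n \<omega>)\<^sup>2 * indicator {\<omega>. (\<xi> n \<omega>)\<^sup>2 > \<epsilon> * inverse (\<mu> n) * ln (real n)} \<omega> = ?f n (X n \<omega>)" for \<omega>
        by (simp add: \<xi>_def indicator_def field_simps)
      then show ?case using transfer(1)[OF elim, of "?f n"] by simp
    qed
    with lindeberg[OF \<open>\<epsilon> > 0\<close>] show "(\<lambda>n. measure_pmf.expectation (p n) (?f n)) \<longlonglongrightarrow> 0"
      by (rule Lim_transform_eventually)
  qed
  show ?thesis using cutoff optimal_cutoff by blast
qed

end
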